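(* Let $\mathcal{M}\models\mathrm{KP}^{\mathcal{P}}+\Sigma_1^{\mathcal{P}}\text{-Separation}$ and $\mathcal{N}\models\mathrm{KP}^{\mathcal{P}}+\Sigma_1^{\mathcal{P}}\text{-Separation}$ be countable and non-standard. Let $\mathcal{S}$ be a common rank-initial topless substructure of $\mathcal{M}$ and $\mathcal{N}$. Then the following are equivalent: (a) There is a rank-initial embedding $i:\mathcal{M}\to\mathcal{N}$ fixing $\mathcal{S}$ pointwise. (a') There is a topless rank-initial embedding $i:\mathcal{M}\to\mathcal{N}$ fixing $\mathcal{S}$ pointwise. (b) $\mathrm{SSy}_{\mathcal{S}}(\mathcal{M})=\mathrm{SSy}_{\mathcal{S}}(\mathcal{N})$, and $\mathrm{Th}_{\Sigma_1^{\mathcal{P}},\mathcal{S}}(\mathcal{M})\subseteq\mathrm{Th}_{\Sigma_1^{\mathcal{P}},\mathcal{S}}(\mathcal{N})$.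
   Context: Theories. The language is $\{\in\}$. Quantifiers of the forms $\exists x\in y$, $\forall x\in y$, $\exists x\subseteq y$, $\forall x\subseteq y$ count as bounded. $\Delta_0^{\mathcal{P}}=\Sigma_0^{\mathcal{P}}=\Pi_0^{\mathcal{P}}$ is the set of formulae all of whose quantifiers are bounded in this sense; $\Sigma_{n+1}^{\mathcal{P}}$ consists of the formulae $\exists x\,.\,\phi$ with $\phi\in\Pi_n^{\mathcal{P}}$, and $\Pi_{n+1}^{\mathcal{P}}$ of the $\forall x\,.\,\phi$ with $\phi\in\Sigma_n^{\mathcal{P}}$ (all up to provable equivalence in the background theory). $\mathrm{KP}^{\mathcal{P}}$ is axiomatized by Extensionality, Pair, Union, Powerset, Infinity, $\Delta_0^{\mathcal{P}}$-Separation, $\Delta_0^{\mathcal{P}}$-Collection ($\forall u\in x\exists v\,\phi(u,v)\to\exists y\forall u\in x\exists v\in y\,\phi(u,v)$) and $\Pi_1^{\mathcal{P}}$-Foundation ($\exists x\,\phi(x)\to\exists y(\phi(y)\wedge\forall v\in y\,\neg\phi(v))$). It proves that each set has an ordinal rank. Models. A model is non-standard if its membership relation is not well-founded. An embedding is an injection preserving and reflecting $\in$. An embedding $i:\mathcal{M}\to\mathcal{N}$ is rank-initial if every $n\in\mathcal{N}$ with $\mathrm{rank}^{\mathcal{N}}(n)\le\mathrm{rank}^{\mathcal{N}}(i(m))$ for some $m\in\mathcal{M}$ lies in $i(\mathcal{M})$; it is topless if all elements of $i(\mathcal{M})$ have $\mathcal{N}$-rank below some fixed $\alpha\in\mathrm{Ord}^{\mathcal{N}}$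 and $\mathrm{Ord}^{\mathcal{N}}\setminus i(\mathcal{M})$ has no least element. A substructure is rank-initial/topless if its inclusion map is. $\mathrm{SSy}_{\mathcal{S}}(\mathcal{M})$ is the structure $\mathcal{S}$ together with, as classes, all sets of the form $\{x\in\mathcal{S}\mid\mathcal{M}\models x\in c\}$, $c\in\mathcal{M}$. $\mathrm{Th}_{\Gamma,\mathcal{S}}(\mathcal{M})=\{\phi(\vec{s})\mid\phi\in\Gamma,\ \vec{s}\in\mathcal{S},\ \mathcal{M}\models\phi(\vec{s})\}$. *)

theory Defs
  imports Complex_Main "HOL-Library.Countable_Set"
begin

section \<open>First-order formulae over membership\<close>

text \<open>Formulae use de Bruijn indices: a quantifier binds index 0 of its body.
  Equality is a logical symbol.\<close>

datatype fm =
    Fls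
  | Mem nat nat
  | Eql nat nat
  | Imp fm fm
  | And fm fm
  | Or fm fm
  | Ex fm
  | All fm

definition Neg :: "fm \<Rightarrow> fm" where
  "Neg p = Imp p Fls"

definition Iff :: "fm \<Rightarrow> fm \<Rightarrow> fm" where
  "Iff p q = And (Imp p q) (Imp q p)"

definition Sub :: "nat \<Rightarrow> nat \<Rightarrow> fm" where
  "Sub x y = All (Imp (Mem 0 (Suc x)) (Mem 0 (Suc y)))"

text \<open>In the four bounded quantifiers the bound \<open>y\<close> is an index of the surrounding
  context, hence the shift by one (so the bounded variable never is its own bound).\<close>

definition ExIn :: "nat \<Rightarrow> fm \<Rightarrow> fm" where
  "ExIn y p = Ex (And (Mem 0 (Suc y)) p)"

definition AllIn :: "nat \<Rightarrow> fm \<Rightarrow> fm" where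
  "AllIn y p = All (Imp (Mem 0 (Suc y)) p)"

definition ExSub :: "nat \<Rightarrow> fm \<Rightarrow> fm" where
  "ExSub y p = Ex (And (Sub 0 (Suc y)) p)"

definition AllSub :: "nat \<Rightarrow> fm \<Rightarrow> fm" where
  "AllSub y p = All (Imp (Sub 0 (Suc y)) p)"

primrec fv :: "fm \<Rightarrow> nat set" where
  "fv Fls = {}"
| "fv (Mem x y) = {x, y}"
| "fv (Eql x y) = {x, y}"
| "fv (Imp p q) = fv p \<union> fv q"
| "fv (And p q) = fv p \<union> fv q"
| "fv (Or p q) = fv p \<union> fv q"
| "fv (Ex p) = {n. Suc n \<in> fv p}"
| "fv (All p) = {n. Suc n \<in> fv p}"

definition lift :: "(nat \<Rightarrow> nat) \<Rightarrow> nat \<Rightarrow> nat" where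
  "lift r = case_nat 0 (\<lambda>n. Suc (r n))"

primrec ren :: "(nat \<Rightarrow> nat) \<Rightarrow> fm \<Rightarrow> fm" where
  "ren r Fls = Fls"
| "ren r (Mem x y) = Mem (r x) (r y)"
| "ren r (Eql x y) = Eql (r x) (r y)"
| "ren r (Imp p q) = Imp (ren r p) (ren r q)"
| "ren r (And p q) = And (ren r p) (ren r q)"
| "ren r (Or p q) = Or (ren r p) (ren r q)"
| "ren r (Ex p) = Ex (ren (lift r) p)"
| "ren r (All p) = All (ren (lift r) p)"

text \<open>\<open>shift c d\<close> keeps the first \<open>c\<close> variables and moves the remaining ones past
  \<open>d\<close> newly bound variables; \<open>inst k p\<close> substitutes variable \<open>k\<close> for index 0.\<close>

definition shift :: "nat \<Rightarrow> nat \<Rightarrow> fm \<Rightarrow> fm" where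
  "shift c d = ren (\<lambda>n. if n < c then n else n + d)"

definition inst :: "nat \<Rightarrow> fm \<Rightarrow> fm" where
  "inst k = ren (case_nat k (\<lambda>n. n))"


section \<open>Provability\<close>

text \<open>Classical natural deduction with equality. Derivations are finite; the set of
  hypotheses may be infinite, and all theories below consist of sentences.\<close>

inductive proves :: "fm set \<Rightarrow> fm \<Rightarrow> bool" (infix "\<turnstile>" 50) where
  Assm: "p \<in> H \<Longrightarrow> H \<turnstile> p"
| Class: "insert (Neg p) H \<turnstile> Fls \<Longrightarrow> H \<turnstile> p"
| ImpI: "insert p H \<turnstile> q \<Longrightarrow> H \<turnstile> Imp p q"
| ImpE: "H \<turnstile> Imp p q \<Longrightarrow> H \<turnstile> p \<Longrightarrow> H \<turnstile> q"
| AndI: "H \<turnstile> p \<Longrightarrow> H \<turnstile> q \<Longrightarrow> H \<turnstile> And p q"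
| AndE1: "H \<turnstile> And p q \<Longrightarrow> H \<turnstile> p"
| AndE2: "H \<turnstile> And p q \<Longrightarrow> H \<turnstile> q"
| OrI1: "H \<turnstile> p \<Longrightarrow> H \<turnstile> Or p q"
| OrI2: "H \<turnstile> q \<Longrightarrow> H \<turnstile> Or p q"
| OrE: "H \<turnstile> Or p q \<Longrightarrow> insert p H \<turnstile> s \<Longrightarrow> insert q H \<turnstile> s \<Longrightarrow> H \<turnstile> s"
| AllI: "ren Suc ` H \<turnstile> p \<Longrightarrow> H \<turnstile> All p"
| AllE: "H \<turnstile> All p \<Longrightarrow> H \<turnstile> inst k p"
| ExI: "H \<turnstile> inst k p \<Longrightarrow> H \<turnstile> Ex p"
| ExE: "H \<turnstile> Ex p \<Longrightarrow> insert p (ren Suc ` H) \<turnstile> ren Suc q \<Longrightarrow> H \<turnstile> q"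
| EqlI: "H \<turnstile> Eql k k"
| EqlE: "H \<turnstile> Eql j k \<Longrightarrow> H \<turnstile> inst j p \<Longrightarrow> H \<turnstile> inst k p"


section \<open>The Takahashi hierarchy\<close>

inductive_set Delta0P :: "fm set" where
  "Fls \<in> Delta0P"
| "Mem x y \<in> Delta0P"
| "Eql x y \<in> Delta0P"
| "p \<in> Delta0P \<Longrightarrow> q \<in> Delta0P \<Longrightarrow> Imp p q \<in> Delta0P"
| "p \<in> Delta0P \<Longrightarrow> q \<in> Delta0P \<Longrightarrow> And p q \<in> Delta0P"
| "p \<in> Delta0P \<Longrightarrow> q \<in> Delta0P \<Longrightarrow> Or p q \<in> Delta0P"
| "p \<in> Delta0P \<Longrightarrow> ExIn y p \<in> Delta0P"
| "p \<in> Delta0P \<Longrightarrow> AllIn y p \<in> Delta0P"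
| "p \<in> Delta0P \<Longrightarrow> ExSub y p \<in> Delta0P"
| "p \<in> Delta0P \<Longrightarrow> AllSub y p \<in> Delta0P"

fun strict_SigmaP :: "nat \<Rightarrow> fm set" and strict_PiP :: "nat \<Rightarrow> fm set" where
  "strict_SigmaP 0 = Delta0P"
| "strict_SigmaP (Suc n) = Ex ` strict_PiP n"
| "strict_PiP 0 = Delta0P"
| "strict_PiP (Suc n) = All ` strict_SigmaP n"

text \<open>The class up to provable equivalence in the background theory \<open>T\<close>.\<close>

definition SigmaP :: "fm set \<Rightarrow> nat \<Rightarrow> fm set" where
  "SigmaP T n = {p. \<exists>q \<in> strict_SigmaP n. T \<turnstile> Iff p q}"


section \<open>Theories\<close>

text \<open>Parameters of schemata are free variables; they are universally quantified here.\<close>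

definition closures :: "fm set \<Rightarrow> fm set" where
  "closures A = {(All ^^ n) p | n p. p \<in> A \<and> fv ((All ^^ n) p) = {}}"

definition Extensionality_ax :: fm where
  "Extensionality_ax = All (All (Imp (All (Iff (Mem 0 1) (Mem 0 2))) (Eql 0 1)))"

definition Pairing_ax :: fm where
  "Pairing_ax = All (All (Ex (All (Iff (Mem 0 1) (Or (Eql 0 2) (Eql 0 3))))))"

definition Union_ax :: fm where
  "Union_ax = All (Ex (All (Iff (Mem 0 1) (ExIn 2 (Mem 1 0)))))"

definition Powerset_ax :: fm where
  "Powerset_ax = All (Ex (All (Iff (Mem 0 1) (Sub 0 2))))"

text \<open>Some set contains the empty set and is closed under \<open>x \<mapsto> x \<union> {x}\<close>.\<close>

definition Infinity_ax :: fm where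
  "Infinity_ax = Ex (And (ExIn 0 (All (Neg (Mem 0 1))))
     (AllIn 0 (ExIn 1 (All (Iff (Mem 0 1) (Or (Mem 0 2) (Eql 0 2)))))))"

text \<open>\<open>p(u)\<close> has \<open>u\<close> as variable 0 and parameters from 1 on:
  \<open>\<forall>x \<exists>y \<forall>u (u \<in> y \<longleftrightarrow> u \<in> x \<and> p(u))\<close>.\<close>

definition Separation :: "fm set \<Rightarrow> fm set" where
  "Separation A = closures
     ((\<lambda>p. All (Ex (All (Iff (Mem 0 1) (And (Mem 0 2) (shift 1 2 p)))))) ` A)"

text \<open>\<open>p(u,v)\<close> has \<open>v\<close> as variable 0, \<open>u\<close> as variable 1 and parameters from 2 on:
  \<open>\<forall>x (\<forall>u\<in>x \<exists>v p(u,v) \<longrightarrow> \<exists>y \<forall>u\<in>x \<exists>v\<in>y p(u,v))\<close>.\<close>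

definition Collection :: "fm set \<Rightarrow> fm set" where
  "Collection A = closures
     ((\<lambda>p. All (Imp (AllIn 0 (Ex (shift 2 1 p)))
                    (Ex (AllIn 1 (ExIn 1 (shift 2 2 p)))))) ` A)"

definition Foundation :: "fm set \<Rightarrow> fm set" where
  "Foundation A = closures
     ((\<lambda>p. Imp (Ex p) (Ex (And p (AllIn 0 (Neg (shift 1 1 p)))))) ` A)"

definition KPP :: "fm set" where
  "KPP = {Extensionality_ax, Pairing_ax, Union_ax, Powerset_ax, Infinity_ax}
     \<union> Separation Delta0P \<union> Collection Delta0P \<union> Foundation (strict_PiP 1)"

definition Sigma1P :: "fm set" where
  "Sigma1P = SigmaP KPP 1"


section \<open>Structures\<close>

text \<open>Only the restriction of \<open>mem\<close> to the universe \<open>univ\<close> is meaningful.\<close>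

record 'a eps_struct =
  univ :: "'a set"
  mem :: "'a \<Rightarrow> 'a \<Rightarrow> bool"

primrec sat :: "'a eps_struct \<Rightarrow> (nat \<Rightarrow> 'a) \<Rightarrow> fm \<Rightarrow> bool" where
  "sat M e Fls = False"
| "sat M e (Mem x y) = mem M (e x) (e y)"
| "sat M e (Eql x y) = (e x = e y)"
| "sat M e (Imp p q) = (sat M e p \<longrightarrow> sat M e q)"
| "sat M e (And p q) = (sat M e p \<and> sat M e q)"
| "sat M e (Or p q) = (sat M e p \<or> sat M e q)"
| "sat M e (Ex p) = (\<exists>a \<in> univ M. sat M (case_nat a e) p)"
| "sat M e (All p) = (\<forall>a \<in> univ M. sat M (case_nat a e) p)"

definition models :: "'a eps_struct \<Rightarrow> fm set \<Rightarrow> bool" (infix "\<Turnstile>" 50) where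
  "M \<Turnstile> T \<longleftrightarrow> univ M \<noteq> {} \<and> (\<forall>p \<in> T. \<forall>e. range e \<subseteq> univ M \<longrightarrow> sat M e p)"

definition nonstandard :: "'a eps_struct \<Rightarrow> bool" where
  "nonstandard M \<longleftrightarrow> \<not> wf {(x, y). x \<in> univ M \<and> y \<in> univ M \<and> mem M x y}"

definition substructure :: "'a eps_struct \<Rightarrow> 'a eps_struct \<Rightarrow> bool" where
  "substructure S M \<longleftrightarrow> univ S \<noteq> {} \<and> univ S \<subseteq> univ M
     \<and> (\<forall>x \<in> univ S. \<forall>y \<in> univ S. mem S x y \<longleftrightarrow> mem M x y)"


section \<open>Ordinals and rank inside a structure\<close>

text \<open>\<open>a\<close> is, in the sense of \<open>M\<close>, a transitive set strictly well-ordered by membership.\<close>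

definition is_ord :: "'a eps_struct \<Rightarrow> 'a \<Rightarrow> bool" where
  "is_ord M a \<longleftrightarrow> a \<in> univ M
     \<and> (\<forall>x \<in> univ M. \<forall>y \<in> univ M. mem M x y \<and> mem M y a \<longrightarrow> mem M x a)
     \<and> (\<forall>x \<in> univ M. mem M x a \<longrightarrow> \<not> mem M x x)
     \<and> (\<forall>x \<in> univ M. \<forall>y \<in> univ M. \<forall>z \<in> univ M. mem M x a \<and> mem M y a \<and> mem M z a
          \<longrightarrow> mem M x y \<and> mem M y z \<longrightarrow> mem M x z)
     \<and> (\<forall>x \<in> univ M. \<forall>y \<in> univ M. mem M x a \<and> mem M y a
          \<longrightarrow> mem M x y \<or> x = y \<or> mem M y x)
     \<and> (\<forall>b \<in> univ M. (\<forall>x \<in> univ M. mem M x b \<longrightarrow> mem M x a) \<and> (\<exists>x \<in> univ M. mem M x b)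
          \<longrightarrow> (\<exists>x \<in> univ M. mem M x b \<and> (\<forall>y \<in> univ M. mem M y b \<longrightarrow> x = y \<or> mem M x y)))"

definition Ord :: "'a eps_struct \<Rightarrow> 'a set" where
  "Ord M = {a. is_ord M a}"

definition ord_le :: "'a eps_struct \<Rightarrow> 'a \<Rightarrow> 'a \<Rightarrow> bool" where
  "ord_le M a b \<longleftrightarrow> a = b \<or> mem M a b"

definition is_upair :: "'a eps_struct \<Rightarrow> 'a \<Rightarrow> 'a \<Rightarrow> 'a \<Rightarrow> bool" where
  "is_upair M p x y \<longleftrightarrow> (\<forall>z \<in> univ M. mem M z p \<longleftrightarrow> z = x \<or> z = y)"

text \<open>Kuratowski pairs.\<close>

definition is_opair :: "'a eps_struct \<Rightarrow> 'a \<Rightarrow> 'a \<Rightarrow> 'a \<Rightarrow> bool" where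
  "is_opair M p x y \<longleftrightarrow>
     (\<exists>u \<in> univ M. \<exists>v \<in> univ M. is_upair M u x x \<and> is_upair M v x y \<and> is_upair M p u v)"

definition maps_to :: "'a eps_struct \<Rightarrow> 'a \<Rightarrow> 'a \<Rightarrow> 'a \<Rightarrow> bool" where
  "maps_to M f x y \<longleftrightarrow> (\<exists>p \<in> univ M. mem M p f \<and> is_opair M p x y)"

definition is_function :: "'a eps_struct \<Rightarrow> 'a \<Rightarrow> 'a \<Rightarrow> bool" where
  "is_function M f t \<longleftrightarrow>
     (\<forall>p \<in> univ M. mem M p f \<longrightarrow> (\<exists>x \<in> univ M. \<exists>y \<in> univ M. mem M x t \<and> is_opair M p x y))
     \<and> (\<forall>x \<in> univ M. mem M x t \<longrightarrow> (\<exists>!y. y \<in> univ M \<and> maps_to M f x y))"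

text \<open>\<open>f\<close> satisfies the rank recursion \<open>f(x) = sup {f(z) + 1 | z \<in> x}\<close> on the
  transitive set \<open>t\<close>.\<close>

definition is_rank_function :: "'a eps_struct \<Rightarrow> 'a \<Rightarrow> 'a \<Rightarrow> bool" where
  "is_rank_function M f t \<longleftrightarrow>
     (\<forall>x \<in> univ M. \<forall>y \<in> univ M. mem M x y \<and> mem M y t \<longrightarrow> mem M x t)
     \<and> is_function M f t
     \<and> (\<forall>x \<in> univ M. \<forall>a \<in> univ M. mem M x t \<and> maps_to M f x a \<longrightarrow>
          is_ord M a
          \<and> (\<forall>b \<in> univ M. mem M b a \<longleftrightarrow>
               (\<exists>z \<in> univ M. mem M z x \<and> (\<exists>c \<in> univ M. maps_to M f z c \<and> ord_le M b c))))"

definition has_rank :: "'a eps_struct \<Rightarrow> 'a \<Rightarrow> 'a \<Rightarrow> bool" where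
  "has_rank M x a \<longleftrightarrow> a \<in> univ M
     \<and> (\<exists>f \<in> univ M. \<exists>t \<in> univ M. is_rank_function M f t \<and> mem M x t \<and> maps_to M f x a)"

definition rank :: "'a eps_struct \<Rightarrow> 'a \<Rightarrow> 'a" where
  "rank M x = (THE a. has_rank M x a)"


section \<open>Embeddings\<close>

definition embedding :: "'a eps_struct \<Rightarrow> 'b eps_struct \<Rightarrow> ('a \<Rightarrow> 'b) \<Rightarrow> bool" where
  "embedding M N i \<longleftrightarrow> i ` univ M \<subseteq> univ N \<and> inj_on i (univ M)
     \<and> (\<forall>x \<in> univ M. \<forall>y \<in> univ M. mem M x y \<longleftrightarrow> mem N (i x) (i y))"

definition rank_initial :: "'a eps_struct \<Rightarrow> 'b eps_struct \<Rightarrow> ('a \<Rightarrow> 'b) \<Rightarrow> bool" where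
  "rank_initial M N i \<longleftrightarrow> embedding M N i
     \<and> (\<forall>n \<in> univ N. (\<exists>m \<in> univ M. ord_le N (rank N n) (rank N (i m))) \<longrightarrow> n \<in> i ` univ M)"

definition topless :: "'a eps_struct \<Rightarrow> 'b eps_struct \<Rightarrow> ('a \<Rightarrow> 'b) \<Rightarrow> bool" where
  "topless M N i \<longleftrightarrow> embedding M N i
     \<and> (\<exists>a \<in> Ord N. \<forall>m \<in> univ M. mem N (rank N (i m)) a)
     \<and> \<not> (\<exists>a \<in> Ord N - i ` univ M. \<forall>b \<in> Ord N - i ` univ M. ord_le N a b)"


section \<open>Standard systems and theories with parameters\<close>

definition SSy :: "'a eps_struct \<Rightarrow> 'a eps_struct \<Rightarrow> 'a eps_struct \<times> 'a set set" where
  "SSy S M = (S, {{x \<in> univ S. mem M x c} | c. c \<in> univ M})"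

text \<open>The sentence \<open>p(s)\<close> is represented by the pair of \<open>p\<close> and the tuple \<open>s\<close>, whose
  entries interpret the variables \<open>0, 1, \<dots>\<close>; the tuple covers all free variables.\<close>

definition Th :: "fm set \<Rightarrow> 'a eps_struct \<Rightarrow> 'a eps_struct \<Rightarrow> (fm \<times> 'a list) set" where
  "Th A S M = {(p, s). p \<in> A \<and> set s \<subseteq> univ S \<and> fv p \<subseteq> {..<length s} \<and> sat M (\<lambda>n. s ! n) p}"

end

theory Submission
  imports Defs
begin

text \<open>
  The equivalence is a theorem of Friedman's type, and the embedding is built by back and forth.
  Necessity of (b) is the easy half. The image of a rank-initial embedding is closed under elements
  and subsets, so the embedding preserves and reflects \<open>\<Delta>\<^sub>0\<^sup>P\<close> formulae
  (\<open>Delta0P_absolute\<close>); this gives the inclusion of theories. It also shows that every trace on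
  \<open>S\<close> of an element of \<open>N\<close> is the trace of an element of \<open>M\<close>: cut that element down to the image of
  a level including \<open>S\<close>.

  For sufficiency, a finite partial map \<open>a \<mapsto> b\<close> (tuples are coded as single elements) is kept such
  that every \<open>\<Sigma>\<^sub>1\<^sup>P\<close> statement about \<open>a\<close> and a parameter from \<open>S\<close> true in \<open>M\<close> is
  witnessed for \<open>b\<close> inside a level \<open>v\<close> of \<open>N\<close>; this is the relation \<open>tr a b v\<close>. Three
  ingredients make the extension steps work.

  First, there is a \<open>\<Sigma>\<^sub>1\<^sup>P\<close> formula \<open>\<exists>v. Psi v d a\<close>, universal for these statements: \<open>d\<close> pairs
  the code of a formula with a parameter (\<open>universal\<close>). By \<open>\<Sigma>\<^sub>1\<^sup>P\<close>-Separation the set of true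
  codes in \<open>S\<close> is therefore the trace of an element of \<open>M\<close>, and by equality of the standard systems
  also of an element of \<open>N\<close>. The truth definition asks for a set of pairs of codes and relations, each
  pair justified by others in the same set. Only codes of actual formulae matter, so existence and
  uniqueness of such sets are proved by induction on the formula outside the model.

  Secondly, for each \<open>u \<in> S\<close> the true codes in \<open>u\<close> form an element of \<open>S\<close>, so their joint
  truth is one single \<open>\<Sigma>\<^sub>1\<^sup>P\<close> statement with a parameter from \<open>S\<close>, which transfers to \<open>N\<close>.

  Thirdly, \<open>S\<close> overspills (\<open>overspill\<close>): since \<open>S\<close> is topless, a set containing all levels of \<open>S\<close>
  contains a level outside \<open>S\<close>, and such a level includes \<open>S\<close>. Hence what can be achieved for the
  codes in each \<open>u \<in> S\<close> can be achieved for all codes in \<open>S\<close> simultaneously.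

  These yield a first bound (\<open>tr_init\<close>), the forth and the back step (\<open>tr_forth\<close>, \<open>tr_back\<close>), and
  a step that lowers the bound below any level that is itself a bound (\<open>tr_lower\<close>). The last one
  makes the embedding topless. A least ordinal outside the image would make the image a single level
  \<open>l\<close>; by absoluteness \<open>l\<close> would be a bound at every stage, so some stage would have lowered the bound
  to an element of \<open>l\<close>, that is, of the image, whereas the image lies below all the bounds.

  Inside a model the cumulative hierarchy is handled through the notion of a level, which has a
  bounded definition; the rank of a set is recovered as the set of ordinals in the
  least level including it, so that comparing ranks amounts to comparing levels (\<open>rank_le_iff\<close>).
\<close>

section \<open>Semantics of formulae\<close>

abbreviation push :: "'a \<Rightarrow> (nat \<Rightarrow> 'a) \<Rightarrow> nat \<Rightarrow> 'a" (infixr "##" 65) where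
  "x ## e \<equiv> case_nat x e"

lemma range_push: "range (x ## e) \<subseteq> A \<longleftrightarrow> x \<in> A \<and> range e \<subseteq> A"
proof
  assume h: "range (x ## e) \<subseteq> A"
  have "(x ## e) 0 \<in> A" "(x ## e) (Suc n) \<in> A" for n
    using h by blast+
  then show "x \<in> A \<and> range e \<subseteq> A" by auto
next
  assume "x \<in> A \<and> range e \<subseteq> A"
  then show "range (x ## e) \<subseteq> A" by (force split: nat.splits)
qed

lemma push_split: "e 0 ## (\<lambda>n. e (Suc n)) = e"
  by (rule ext) (simp split: nat.splits)

lemma push_lift: "(x ## e) \<circ> lift r = x ## (e \<circ> r)"
  by (rule ext) (simp add: lift_def split: nat.splits)

lemma sat_ren: "sat M e (ren r p) = sat M (e \<circ> r) p"
  by (induction p arbitrary: e r) (simp_all add: push_lift)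

lemma sat_fv: "(\<And>n. n \<in> fv p \<Longrightarrow> e n = e' n) \<Longrightarrow> sat M e p = sat M e' p"
proof (induction p arbitrary: e e')
  case (Ex p)
  have "sat M (a ## e) p = sat M (a ## e') p" for a
    by (rule Ex.IH) (auto simp: Ex.prems split: nat.splits)
  then show ?case by simp
next
  case (All p)
  have "sat M (a ## e) p = sat M (a ## e') p" for a
    by (rule All.IH) (auto simp: All.prems split: nat.splits)
  then show ?case by simp
next
  case (Imp p q)
  have "sat M e p = sat M e' p" "sat M e q = sat M e' q"
    using Imp.prems by (auto intro!: Imp.IH)
  then show ?case by simp
next
  case (And p q)
  have "sat M e p = sat M e' p" "sat M e q = sat M e' q"
    using And.prems by (auto intro!: And.IH)
  then show ?case by simp
next
  case (Or p q)
  have "sat M e p = sat M e' p" "sat M e q = sat M e' q"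
    using Or.prems by (auto intro!: Or.IH)
  then show ?case by simp
qed simp_all

lemma finite_fv: "finite (fv p)"
proof (induction p)
  case (Ex p)
  have "{n. Suc n \<in> fv p} = Suc -` fv p" by auto
  then show ?case using Ex by (simp add: finite_vimageI)
next
  case (All p)
  have "{n. Suc n \<in> fv p} = Suc -` fv p" by auto
  then show ?case using All by (simp add: finite_vimageI)
qed simp_all

lemma sat_Neg [simp]: "sat M e (Neg p) \<longleftrightarrow> \<not> sat M e p"
  by (simp add: Neg_def)

lemma sat_Iff [simp]: "sat M e (Iff p q) \<longleftrightarrow> (sat M e p \<longleftrightarrow> sat M e q)"
  by (auto simp: Iff_def)

lemma sat_Sub [simp]:
  "sat M e (Sub x y) \<longleftrightarrow> (\<forall>a \<in> univ M. mem M a (e x) \<longrightarrow> mem M a (e y))"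
  by (simp add: Sub_def)

lemma sat_ExIn [simp]:
  "sat M e (ExIn y p) \<longleftrightarrow> (\<exists>a \<in> univ M. mem M a (e y) \<and> sat M (a ## e) p)"
  by (simp add: ExIn_def)

lemma sat_AllIn [simp]:
  "sat M e (AllIn y p) \<longleftrightarrow> (\<forall>a \<in> univ M. mem M a (e y) \<longrightarrow> sat M (a ## e) p)"
  by (simp add: AllIn_def)

lemma sat_ExSub [simp]:
  "sat M e (ExSub y p) \<longleftrightarrow>
     (\<exists>a \<in> univ M. (\<forall>z \<in> univ M. mem M z a \<longrightarrow> mem M z (e y)) \<and> sat M (a ## e) p)"
  by (simp add: ExSub_def)

lemma sat_AllSub [simp]:
  "sat M e (AllSub y p) \<longleftrightarrow>
     (\<forall>a \<in> univ M. (\<forall>z \<in> univ M. mem M z a \<longrightarrow> mem M z (e y)) \<longrightarrow> sat M (a ## e) p)"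
  by (simp add: AllSub_def)

lemma sat_inst: "sat M e (inst k p) = sat M (e k ## e) p"
proof -
  have "e \<circ> case_nat k (\<lambda>n. n) = e k ## e"
    by (rule ext) (simp split: nat.splits)
  then show ?thesis by (simp add: inst_def sat_ren)
qed

lemma sat_ren_Suc: "sat M (a ## e) (ren Suc p) = sat M e p"
proof -
  have "(a ## e) \<circ> Suc = e" by (rule ext) simp
  then show ?thesis by (simp add: sat_ren)
qed

text \<open>Formulae are \<open>\<Sigma>\<^sub>1\<^sup>P\<close> only up to provable equivalence, so passing to a strict form
  inside a model rests on soundness.\<close>

lemma soundness:
  assumes "H \<turnstile> p" and "range e \<subseteq> univ M" and "\<forall>q \<in> H. sat M e q"
  shows "sat M e p"
  using assms
proof (induction arbitrary: e rule: proves.induct)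
  case (Class p H)
  have "\<not> sat M e Fls" by simp
  then show ?case
    using Class.IH[OF Class.prems(1)] Class.prems(2) by (metis insert_iff sat_Neg)
next
  case (AllI H p)
  have "sat M (a ## e) p" if "a \<in> univ M" for a
    by (rule AllI.IH) (use AllI.prems that in \<open>auto simp: range_push sat_ren_Suc\<close>)
  then show ?case by simp
next
  case (AllE H p k)
  then have "sat M e (All p)" by blast
  moreover have "e k \<in> univ M" using AllE.prems by auto
  ultimately show ?case by (simp add: sat_inst)
next
  case (ExI H k p)
  then have "sat M (e k ## e) p" by (simp add: sat_inst)
  moreover have "e k \<in> univ M" using ExI.prems by auto
  ultimately show ?case by auto
next
  case (ExE H p q)
  then have "sat M e (Ex p)" by blast
  then obtain a where a: "a \<in> univ M" "sat M (a ## e) p" by auto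
  have "sat M (a ## e) (ren Suc q)"
    by (rule ExE.IH(2)) (use ExE.prems a in \<open>auto simp: range_push sat_ren_Suc\<close>)
  then show ?case by (simp add: sat_ren_Suc)
next
  case (EqlE H j k p)
  then have "e j = e k" "sat M e (inst j p)" by auto
  then show ?case by (simp add: sat_inst)
next
  case (OrE H p q s)
  then show ?case by (metis insert_iff sat.simps(6))
qed (auto; fail)+

lemma Iff_refl: "H \<turnstile> Iff q q"
  unfolding Iff_def by (intro AndI ImpI Assm) auto

lemma Delta0P_subset_Sigma1P: "p \<in> Delta0P \<Longrightarrow> Ex p \<in> Sigma1P"
  unfolding Sigma1P_def SigmaP_def using Iff_refl by force

lemma fv_All_pow: "fv ((All ^^ n) p) = {m. m + n \<in> fv p}"
  by (induction n) auto

lemma closure_sat: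
  assumes "\<And>e. range e \<subseteq> univ M \<Longrightarrow> sat M e ((All ^^ n) p)" and "range e \<subseteq> univ M"
  shows "sat M e p"
  using assms
proof (induction n arbitrary: e)
  case (Suc n)
  have "sat M e ((All ^^ n) p)" if "range e \<subseteq> univ M" for e
  proof -
    have "range (\<lambda>n. e (Suc n)) \<subseteq> univ M" "e 0 \<in> univ M" using that by auto
    then have "sat M (e 0 ## (\<lambda>n. e (Suc n))) ((All ^^ n) p)"
      using Suc.prems(1)[of "\<lambda>n. e (Suc n)"] by simp
    then show ?thesis by (simp add: push_split)
  qed
  then show ?case using Suc by blast
qed simp

text \<open>A schema is given by its closed instances; sufficiently many universal quantifiers bind all
  parameters, so each instance holds under every assignment.\<close>

lemma closures_sat:
  assumes "M \<Turnstile> T" and "closures A \<subseteq> T" and "p \<in> A" and "range e \<subseteq> univ M"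
  shows "sat M e p"
proof -
  obtain n where "\<forall>m \<in> fv p. m < n"
    using finite_fv finite_nat_set_iff_bounded by metis
  then have "fv ((All ^^ n) p) = {}" by (auto simp: fv_All_pow)
  then have "(All ^^ n) p \<in> T" using assms by (auto simp: closures_def)
  then have "\<And>e. range e \<subseteq> univ M \<Longrightarrow> sat M e ((All ^^ n) p)"
    using assms(1) by (auto simp: models_def)
  then show ?thesis by (rule closure_sat) (use assms in auto)
qed

lemma ren_Sub [simp]: "ren (lift r) (Sub 0 (Suc y)) = Sub 0 (Suc (r y))"
  by (simp add: Sub_def lift_def)

lemma Delta0P_ren: "p \<in> Delta0P \<Longrightarrow> ren r p \<in> Delta0P"
proof (induction arbitrary: r rule: Delta0P.induct)
  case (7 p y)
  have "ren r (ExIn y p) = ExIn (r y) (ren (lift r) p)" by (simp add: ExIn_def lift_def)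
  then show ?case using 7 Delta0P.intros by metis
next
  case (8 p y)
  have "ren r (AllIn y p) = AllIn (r y) (ren (lift r) p)" by (simp add: AllIn_def lift_def)
  then show ?case using 8 Delta0P.intros by metis
next
  case (9 p y)
  have "ren r (ExSub y p) = ExSub (r y) (ren (lift r) p)" by (simp add: ExSub_def)
  then show ?case using 9 Delta0P.intros by metis
next
  case (10 p y)
  have "ren r (AllSub y p) = AllSub (r y) (ren (lift r) p)" by (simp add: AllSub_def)
  then show ?case using 10 Delta0P.intros by metis
qed (auto intro: Delta0P.intros)

section \<open>Relations definable by bounded formulae\<close>

text \<open>Conjoining membership in the universe lets bounded quantifiers range over the whole type.\<close>

definition ein :: "'a eps_struct \<Rightarrow> 'a \<Rightarrow> 'a \<Rightarrow> bool" where
  "ein M x y \<longleftrightarrow> x \<in> univ M \<and> y \<in> univ M \<and> mem M x y"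

definition sbs :: "'a eps_struct \<Rightarrow> 'a \<Rightarrow> 'a \<Rightarrow> bool" where
  "sbs M x y \<longleftrightarrow> x \<in> univ M \<and> y \<in> univ M \<and> (\<forall>z. ein M z x \<longrightarrow> ein M z y)"

locale kpp =
  fixes M :: "'a eps_struct"
  assumes model: "M \<Turnstile> KPP \<union> Separation Sigma1P"

text \<open>Relations with a bounded definition, given as predicates of a model and an assignment. One formula
  has to serve all models, because definitions are transferred between two of them.\<close>

definition D0 :: "('a eps_struct \<Rightarrow> (nat \<Rightarrow> 'a) \<Rightarrow> bool) \<Rightarrow> bool" where
  "D0 R \<longleftrightarrow> (\<exists>p \<in> Delta0P. \<forall>M. kpp M \<longrightarrow>
     (\<forall>e. range e \<subseteq> univ M \<longrightarrow> (sat M e p \<longleftrightarrow> R M e)))"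

lemma D0I:
  assumes "p \<in> Delta0P"
    and "\<And>M e. kpp M \<Longrightarrow> range e \<subseteq> univ M \<Longrightarrow> sat M e p \<longleftrightarrow> R M e"
  shows "D0 R"
  using assms unfolding D0_def by blast

lemma D0_iff:
  assumes "D0 R" and "\<And>M e. kpp M \<Longrightarrow> range e \<subseteq> univ M \<Longrightarrow> R M e \<longleftrightarrow> R' M e"
  shows "D0 R'"
  using assms unfolding D0_def by (metis (no_types, lifting))

named_theorems D0_intros

lemma D0_False [D0_intros]: "D0 (\<lambda>M e. False)"
  by (rule D0I[OF Delta0P.intros(1)]) simp

lemma D0_mem [D0_intros]: "D0 (\<lambda>M e. ein M (e i) (e j))"
  by (rule D0I[OF Delta0P.intros(2)[of i j]]) (auto simp: ein_def)

lemma D0_eq [D0_intros]: "D0 (\<lambda>M e. e i = e j)"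
  by (rule D0I[OF Delta0P.intros(3)[of i j]]) simp

lemma D0_imp [D0_intros]: "D0 R \<Longrightarrow> D0 Q \<Longrightarrow> D0 (\<lambda>M e. R M e \<longrightarrow> Q M e)"
  unfolding D0_def by (elim bexE, rule_tac x = "Imp p pa" in bexI) (auto intro: Delta0P.intros)

lemma D0_and [D0_intros]: "D0 R \<Longrightarrow> D0 Q \<Longrightarrow> D0 (\<lambda>M e. R M e \<and> Q M e)"
  unfolding D0_def by (elim bexE, rule_tac x = "And p pa" in bexI) (auto intro: Delta0P.intros)

lemma D0_or [D0_intros]: "D0 R \<Longrightarrow> D0 Q \<Longrightarrow> D0 (\<lambda>M e. R M e \<or> Q M e)"
  unfolding D0_def by (elim bexE, rule_tac x = "Or p pa" in bexI) (auto intro: Delta0P.intros)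

lemma D0_not [D0_intros]: "D0 R \<Longrightarrow> D0 (\<lambda>M e. \<not> R M e)"
  using D0_imp[OF _ D0_False, of R] by simp

lemma D0_ren: "D0 R \<Longrightarrow> D0 (\<lambda>M e. R M (\<lambda>n. e (r n)))"
  unfolding D0_def
proof (elim bexE)
  fix p assume p: "p \<in> Delta0P"
    "\<forall>M. kpp M \<longrightarrow> (\<forall>e. range e \<subseteq> univ M \<longrightarrow> sat M e p = R M e)"
  have "sat M e (ren r p) = R M (\<lambda>n. e (r n))" if "kpp M" "range e \<subseteq> univ M" for M e
  proof -
    have "range (\<lambda>n. e (r n)) \<subseteq> univ M" using that by auto
    then show ?thesis using p that by (simp add: sat_ren comp_def)
  qed
  then show "\<exists>p\<in>Delta0P. \<forall>M. kpp M \<longrightarrow>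
      (\<forall>e. range e \<subseteq> univ M \<longrightarrow> sat M e p = R M (\<lambda>n. e (r n)))"
    using Delta0P_ren[OF p(1)] by blast
qed

text \<open>The quantified variable takes index 0 and pushes the others up. In this form the rules decompose
  a predicate written with ordinary quantifiers, so that definability proofs are calls of \<open>intro\<close>.\<close>

lemma D0_bounded_quantifiers:
  assumes "D0 (\<lambda>M e. R M (e 0) (\<lambda>n. e (Suc n)))"
  shows D0_ex_in [D0_intros]: "D0 (\<lambda>M e. \<exists>x. ein M x (e k) \<and> R M x e)"
    and D0_all_in [D0_intros]: "D0 (\<lambda>M e. \<forall>x. ein M x (e k) \<longrightarrow> R M x e)"
    and D0_ex_sub [D0_intros]: "D0 (\<lambda>M e. \<exists>x. sbs M x (e k) \<and> R M x e)"
    and D0_all_sub [D0_intros]: "D0 (\<lambda>M e. \<forall>x. sbs M x (e k) \<longrightarrow> R M x e)"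
proof -
  obtain p where p: "p \<in> Delta0P" and
    *: "\<And>M e. kpp M \<Longrightarrow> range e \<subseteq> univ M \<Longrightarrow> sat M e p = R M (e 0) (\<lambda>n. e (Suc n))"
    using assms unfolding D0_def by blast
  have r: "sat M (a ## e) p = R M a e" if "kpp M" "range e \<subseteq> univ M" "a \<in> univ M" for M a e
    using *[of M "a ## e"] that by (simp add: range_push)
  have k: "e k \<in> univ M" if "range e \<subseteq> univ M" for M :: "'a eps_struct" and e
    using that by auto
  show "D0 (\<lambda>M e. \<exists>x. ein M x (e k) \<and> R M x e)"
    by (rule D0I[OF Delta0P.intros(7)[OF p, of k]]) (auto simp: ein_def r k)
  show "D0 (\<lambda>M e. \<forall>x. ein M x (e k) \<longrightarrow> R M x e)"
    by (rule D0I[OF Delta0P.intros(8)[OF p, of k]]) (auto simp: ein_def r k)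
  show "D0 (\<lambda>M e. \<exists>x. sbs M x (e k) \<and> R M x e)"
    by (rule D0I[OF Delta0P.intros(9)[OF p, of k]]) (auto simp: ein_def sbs_def r k)
  show "D0 (\<lambda>M e. \<forall>x. sbs M x (e k) \<longrightarrow> R M x e)"
    by (rule D0I[OF Delta0P.intros(10)[OF p, of k]]) (auto simp: ein_def sbs_def r k)
qed

lemma D0_sbs [D0_intros]: "D0 (\<lambda>M e. sbs M (e i) (e j))"
proof (rule D0_iff)
  show "D0 (\<lambda>M e. \<forall>z. ein M z (e i) \<longrightarrow> ein M z (e j))" by (intro D0_intros)
qed (auto simp: sbs_def)

text \<open>Membership in the union of a set. Quantifying over it takes two bounded quantifiers; it is the way
  to reach the components of an ordered pair.\<close>

definition uin :: "'a eps_struct \<Rightarrow> 'a \<Rightarrow> 'a \<Rightarrow> bool" where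
  "uin M x z \<longleftrightarrow> (\<exists>y. ein M y z \<and> ein M x y)"

lemma D0_uin [D0_intros]: "D0 (\<lambda>M e. uin M (e i) (e j))"
  unfolding uin_def by (intro D0_intros)

lemma D0_uin_quantifiers:
  assumes "D0 (\<lambda>M e. R M (e 0) (\<lambda>n. e (Suc n)))"
  shows D0_ex_uin [D0_intros]: "D0 (\<lambda>M e. \<exists>x. uin M x (e k) \<and> R M x e)"
    and D0_all_uin [D0_intros]: "D0 (\<lambda>M e. \<forall>x. uin M x (e k) \<longrightarrow> R M x e)"
proof -
  have *: "D0 (\<lambda>M e. R M (e 0) (\<lambda>n. e (Suc (Suc n))))"
    using D0_ren[OF assms, of "case_nat 0 (\<lambda>n. Suc (Suc n))"] by simp
  have "D0 (\<lambda>M e. \<exists>y. ein M y (e k) \<and> (\<exists>x. ein M x y \<and> R M x e))"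
    by (intro D0_intros) (use * in simp)
  then show "D0 (\<lambda>M e. \<exists>x. uin M x (e k) \<and> R M x e)"
    by (rule D0_iff) (auto simp: uin_def)
  have "D0 (\<lambda>M e. \<forall>y. ein M y (e k) \<longrightarrow> (\<forall>x. ein M x y \<longrightarrow> R M x e))"
    by (intro D0_intros) (use * in simp)
  then show "D0 (\<lambda>M e. \<forall>x. uin M x (e k) \<longrightarrow> R M x e)"
    by (rule D0_iff) (auto simp: uin_def)
qed

section \<open>The axioms in semantic form\<close>

context kpp
begin

abbreviation U :: "'a set" where "U \<equiv> univ M"

abbreviation elem (infix "\<epsilon>" 50) where "x \<epsilon> y \<equiv> ein M x y"

lemma einU [dest]: "x \<epsilon> y \<Longrightarrow> x \<in> U \<and> y \<in> U"
  by (simp add: ein_def)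

lemma sbsU [dest]: "sbs M x y \<Longrightarrow> x \<in> U \<and> y \<in> U"
  by (simp add: sbs_def)

lemma axm: "p \<in> KPP \<Longrightarrow> range e \<subseteq> U \<Longrightarrow> sat M e p"
  using model by (auto simp: models_def)

lemma nonempty: "\<exists>x. x \<in> U"
  using model by (auto simp: models_def)

lemma const_env: "x \<in> U \<Longrightarrow> range (\<lambda>_. x) \<subseteq> U"
  by auto

lemma extensionality:
  assumes "x \<in> U" "y \<in> U" "\<And>z. z \<epsilon> x \<longleftrightarrow> z \<epsilon> y"
  shows "x = y"
proof -
  have "sat M (\<lambda>_. x) Extensionality_ax"
    by (rule axm) (auto simp: KPP_def assms)
  then show ?thesis
    using assms unfolding Extensionality_ax_def ein_def
    by (auto simp: numeral_2_eq_2)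
qed

lemma sbs_antisym: "sbs M x y \<Longrightarrow> sbs M y x \<Longrightarrow> x = y"
  by (rule extensionality) (auto simp: sbs_def)

lemma upair_exists: "x \<in> U \<Longrightarrow> y \<in> U \<Longrightarrow> \<exists>p \<in> U. \<forall>z. z \<epsilon> p \<longleftrightarrow> z = x \<or> z = y"
proof -
  assume a: "x \<in> U" "y \<in> U"
  have "sat M (\<lambda>_. x) Pairing_ax"
    by (rule axm) (auto simp: KPP_def a)
  then have "\<exists>p\<in>U. \<forall>z\<in>U. mem M z p = (z = y \<or> z = x)"
    using a unfolding Pairing_ax_def by (simp add: numeral_2_eq_2 numeral_3_eq_3)
  then show ?thesis using a by (auto simp: ein_def)
qed

lemma union_exists: "x \<in> U \<Longrightarrow> \<exists>y \<in> U. \<forall>z. z \<epsilon> y \<longleftrightarrow> uin M z x"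
proof -
  assume a: "x \<in> U"
  have "sat M (\<lambda>_. x) Union_ax"
    by (rule axm) (auto simp: KPP_def a)
  then have "\<exists>y\<in>U. \<forall>z\<in>U. mem M z y = (\<exists>b\<in>U. mem M b x \<and> mem M z b)"
    using a unfolding Union_ax_def by (simp add: numeral_2_eq_2)
  then obtain y where "y \<in> U" "\<forall>z\<in>U. mem M z y = (\<exists>b\<in>U. mem M b x \<and> mem M z b)" by blast
  then have "\<forall>z. z \<epsilon> y \<longleftrightarrow> uin M z x" using a by (auto simp: ein_def uin_def)
  then show ?thesis using \<open>y \<in> U\<close> by blast
qed

lemma powerset_exists: "x \<in> U \<Longrightarrow> \<exists>y \<in> U. \<forall>z. z \<epsilon> y \<longleftrightarrow> sbs M z x"
proof -
  assume a: "x \<in> U"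
  have "sat M (\<lambda>_. x) Powerset_ax"
    by (rule axm) (auto simp: KPP_def a)
  then have "\<exists>y\<in>U. \<forall>z\<in>U. mem M z y = (\<forall>b\<in>U. mem M b z \<longrightarrow> mem M b x)"
    using a unfolding Powerset_ax_def by (simp add: numeral_2_eq_2)
  then obtain y where "y \<in> U" "\<forall>z\<in>U. mem M z y = (\<forall>b\<in>U. mem M b z \<longrightarrow> mem M b x)" by blast
  then have "\<forall>z. z \<epsilon> y \<longleftrightarrow> sbs M z x" using a by (auto simp: ein_def sbs_def)
  then show ?thesis using \<open>y \<in> U\<close> by blast
qed

lemma shift_1_2: "(u ## y ## x ## e) \<circ> (\<lambda>n. if n < 1 then n else n + 2) = u ## e"
  by (rule ext) (simp split: nat.splits)

lemma sat_separation:
  assumes "p \<in> A" and "Separation A \<subseteq> T" and "M \<Turnstile> T" and "range e \<subseteq> U" and "x \<in> U"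
  shows "\<exists>y \<in> U. \<forall>u. u \<epsilon> y \<longleftrightarrow> u \<epsilon> x \<and> sat M (u ## e) p"
proof -
  have "sat M e (All (Ex (All (Iff (Mem 0 1) (And (Mem 0 2) (shift 1 2 p))))))"
    by (rule closures_sat[OF assms(3) assms(2)[unfolded Separation_def]]) (use assms in auto)
  then have "\<exists>y\<in>U. \<forall>u\<in>U. mem M u y = (mem M u x \<and> sat M (u ## e) p)"
    using assms(5) unfolding shift_def sat.simps sat_Iff sat_ren shift_1_2
    by (simp add: numeral_2_eq_2)
  then obtain y where "y \<in> U" "\<forall>u\<in>U. mem M u y = (mem M u x \<and> sat M (u ## e) p)" by blast
  then have "\<forall>u. u \<epsilon> y \<longleftrightarrow> u \<epsilon> x \<and> sat M (u ## e) p" using assms(5) by (auto simp: ein_def)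
  then show ?thesis using \<open>y \<in> U\<close> by blast
qed

lemma separation:
  assumes "D0 R" and "range e \<subseteq> U" and "x \<in> U"
  shows "\<exists>y \<in> U. \<forall>u. u \<epsilon> y \<longleftrightarrow> u \<epsilon> x \<and> R M (u ## e)"
proof -
  obtain p where p: "p \<in> Delta0P" "\<And>e. range e \<subseteq> U \<Longrightarrow> sat M e p = R M e"
    using assms(1) kpp_axioms unfolding D0_def by blast
  obtain y where y: "y \<in> U" "\<forall>u. u \<epsilon> y \<longleftrightarrow> u \<epsilon> x \<and> sat M (u ## e) p"
    using sat_separation[OF p(1) _ model assms(2,3)] unfolding KPP_def by auto
  have "sat M (u ## e) p = R M (u ## e)" if "u \<epsilon> x" for u
    using that assms(2) by (intro p(2)) (auto simp: range_push)
  then show ?thesis using y by blast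
qed

lemma Sigma1_separation:
  assumes "D0 R" and "range e \<subseteq> U" and "x \<in> U"
  shows "\<exists>y \<in> U. \<forall>u. u \<epsilon> y \<longleftrightarrow> u \<epsilon> x \<and> (\<exists>v \<in> U. R M (v ## u ## e))"
proof -
  obtain p where p: "p \<in> Delta0P" "\<And>e. range e \<subseteq> U \<Longrightarrow> sat M e p = R M e"
    using assms(1) kpp_axioms unfolding D0_def by blast
  obtain y where y: "y \<in> U" "\<forall>u. u \<epsilon> y \<longleftrightarrow> u \<epsilon> x \<and> sat M (u ## e) (Ex p)"
    using sat_separation[OF Delta0P_subset_Sigma1P[OF p(1)] _ model assms(2,3)] by auto
  have "sat M (v ## u ## e) p = R M (v ## u ## e)" if "u \<epsilon> x" "v \<in> U" for u v
    using that assms(2) by (intro p(2)) (auto simp: range_push)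
  then have "\<forall>u. u \<epsilon> y \<longleftrightarrow> u \<epsilon> x \<and> (\<exists>v \<in> U. R M (v ## u ## e))" using y by auto
  then show ?thesis using y by blast
qed

lemma shift_2: "(v ## u ## x ## e) \<circ> (\<lambda>n. if n < 2 then n else n + 1) = v ## u ## e"
  "(v ## u ## y ## x ## e) \<circ> (\<lambda>n. if n < 2 then n else n + 2) = v ## u ## e"
  by (rule ext, auto split: nat.splits)+

lemma collection:
  assumes "D0 R" and "range e \<subseteq> U" and "x \<in> U"
    and "\<And>u. u \<epsilon> x \<Longrightarrow> \<exists>v \<in> U. R M (v ## u ## e)"
  shows "\<exists>y \<in> U. \<forall>u. u \<epsilon> x \<longrightarrow> (\<exists>v. v \<epsilon> y \<and> R M (v ## u ## e))"
proof -
  obtain p where p: "p \<in> Delta0P" "\<And>e. range e \<subseteq> U \<Longrightarrow> sat M e p = R M e"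
    using assms(1) kpp_axioms unfolding D0_def by blast
  have r: "sat M (v ## u ## e) p = R M (v ## u ## e)" if "u \<in> U" "v \<in> U" for u v
    using that assms(2) by (intro p(2)) (auto simp: range_push)
  have "sat M e (All (Imp (AllIn 0 (Ex (shift 2 1 p)))
                    (Ex (AllIn 1 (ExIn 1 (shift 2 2 p))))))"
    by (rule closures_sat[OF model, of "((\<lambda>p. All (Imp (AllIn 0 (Ex (shift 2 1 p)))
                    (Ex (AllIn 1 (ExIn 1 (shift 2 2 p)))))) ` Delta0P)"])
      (use assms p(1) in \<open>auto simp: KPP_def Collection_def\<close>)
  then have "(\<forall>u\<in>U. mem M u x \<longrightarrow> (\<exists>v\<in>U. sat M (v ## u ## e) p)) \<longrightarrow>
      (\<exists>y\<in>U. \<forall>u\<in>U. mem M u x \<longrightarrow> (\<exists>v\<in>U. mem M v y \<and> sat M (v ## u ## e) p))"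
    using assms(3)
    unfolding shift_def sat.simps sat_AllIn sat_ExIn sat_ren shift_2 by simp
  then show ?thesis using assms(3,4) r unfolding ein_def by meson
qed

lemma shift_1_1: "(w ## x ## e) \<circ> (\<lambda>n. if n < 1 then n else n + 1) = w ## e"
  by (rule ext, auto split: nat.splits)

text \<open>Index 0 of \<open>R\<close> is the universally quantified variable and index 1 the one that is minimized.\<close>

lemma Pi1_foundation:
  assumes "D0 R" and "range e \<subseteq> U" and "x0 \<in> U" and "\<forall>y \<in> U. R M (y ## x0 ## e)"
  shows "\<exists>x \<in> U. (\<forall>y \<in> U. R M (y ## x ## e)) \<and> (\<forall>w. w \<epsilon> x \<longrightarrow> \<not> (\<forall>y \<in> U. R M (y ## w ## e)))"
proof -
  obtain p where p: "p \<in> Delta0P" "\<And>e. range e \<subseteq> U \<Longrightarrow> sat M e p = R M e"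
    using assms(1) kpp_axioms unfolding D0_def by blast
  have r: "sat M (v ## u ## e) p = R M (v ## u ## e)" if "u \<in> U" "v \<in> U" for u v
    using that assms(2) by (intro p(2)) (auto simp: range_push)
  have "All p \<in> strict_PiP 1" using p(1) by simp
  then have "sat M e (Imp (Ex (All p)) (Ex (And (All p) (AllIn 0 (Neg (shift 1 1 (All p)))))))"
    by (intro closures_sat[OF model, of "((\<lambda>p. Imp (Ex p) (Ex (And p (AllIn 0 (Neg (shift 1 1 p)))))) ` strict_PiP 1)"])
      (use assms in \<open>auto simp: KPP_def Foundation_def\<close>)
  then have "(\<exists>x\<in>U. \<forall>y\<in>U. sat M (y ## x ## e) p) \<longrightarrow>
    (\<exists>x\<in>U. (\<forall>y\<in>U. sat M (y ## x ## e) p) \<and>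
       (\<forall>w\<in>U. mem M w x \<longrightarrow> \<not> (\<forall>y\<in>U. sat M (y ## w ## e) p)))"
    unfolding shift_def sat.simps sat_AllIn sat_Neg sat_ren shift_1_1
    unfolding sat.simps by simp
  then show ?thesis using assms(3,4) r unfolding ein_def by meson
qed

lemma foundation:
  assumes "x \<epsilon> a"
  shows "\<exists>m. m \<epsilon> a \<and> (\<forall>w. w \<epsilon> a \<longrightarrow> \<not> w \<epsilon> m)"
proof -
  have "D0 (\<lambda>M e. ein M (e 1) (e 2))" by (intro D0_intros)
  from Pi1_foundation[OF this, of "\<lambda>_. a" x] assms
  obtain m where "m \<in> U" "m \<epsilon> a" "\<forall>w. w \<epsilon> m \<longrightarrow> \<not> w \<epsilon> a" by auto
  then show ?thesis by blast
qed

end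

section \<open>Elementary set constructions\<close>

definition emp :: "'a eps_struct \<Rightarrow> 'a" where
  "emp M = (THE z. z \<in> univ M \<and> (\<forall>x. \<not> ein M x z))"

definition prd :: "'a eps_struct \<Rightarrow> 'a \<Rightarrow> 'a \<Rightarrow> 'a" where
  "prd M x y = (THE p. p \<in> univ M \<and> is_opair M p x y)"

context kpp
begin

lemma emp_ex: "\<exists>!z. z \<in> U \<and> (\<forall>x. \<not> x \<epsilon> z)"
proof -
  obtain x where x: "x \<in> U" using nonempty by blast
  obtain y where "y \<in> U" "\<forall>u. u \<epsilon> y \<longleftrightarrow> u \<epsilon> x \<and> False"
    using separation[OF D0_False, of "\<lambda>_. x" x] x by auto
  then show ?thesis by (auto intro: extensionality)
qed

lemma emp_in [simp]: "emp M \<in> U" and emp_empty [simp]: "\<not> x \<epsilon> emp M"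
  using theI'[OF emp_ex] unfolding emp_def by blast+

lemma emp_unique: "z \<in> U \<Longrightarrow> (\<And>x. \<not> x \<epsilon> z) \<Longrightarrow> z = emp M"
  by (rule extensionality) auto

lemma un_exists: "x \<in> U \<Longrightarrow> y \<in> U \<Longrightarrow> \<exists>z \<in> U. \<forall>w. w \<epsilon> z \<longleftrightarrow> w \<epsilon> x \<or> w \<epsilon> y"
proof -
  assume "x \<in> U" "y \<in> U"
  then obtain p where p: "p \<in> U" "\<forall>z. z \<epsilon> p \<longleftrightarrow> z = x \<or> z = y" using upair_exists by blast
  obtain z where "z \<in> U" "\<forall>w. w \<epsilon> z \<longleftrightarrow> uin M w p" using union_exists p by blast
  then show ?thesis using p by (auto simp: uin_def)
qed

lemma insert_exists: "x \<in> U \<Longrightarrow> y \<in> U \<Longrightarrow> \<exists>z \<in> U. \<forall>w. w \<epsilon> z \<longleftrightarrow> w = x \<or> w \<epsilon> y"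
proof -
  assume a: "x \<in> U" "y \<in> U"
  then obtain p where p: "p \<in> U" "\<forall>z. z \<epsilon> p \<longleftrightarrow> z = x \<or> z = x" using upair_exists by blast
  obtain z where "z \<in> U" "\<forall>w. w \<epsilon> z \<longleftrightarrow> w \<epsilon> p \<or> w \<epsilon> y" using un_exists[OF p(1) a(2)] by metis
  then show ?thesis using p by blast
qed

lemma no_cycle3: "x \<epsilon> y \<Longrightarrow> y \<epsilon> z \<Longrightarrow> z \<epsilon> x \<Longrightarrow> False"
proof -
  assume c: "x \<epsilon> y" "y \<epsilon> z" "z \<epsilon> x"
  then obtain p where p: "p \<in> U" "\<forall>w. w \<epsilon> p \<longleftrightarrow> w = x \<or> w = y"
    using upair_exists by blast
  obtain q where q: "q \<in> U" "\<forall>w. w \<epsilon> q \<longleftrightarrow> w = z \<or> w \<epsilon> p"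
    using insert_exists[of z p] c p by force
  have q': "x \<epsilon> q" "y \<epsilon> q" "z \<epsilon> q" using p q by auto
  obtain m where m: "m \<epsilon> q" "\<forall>w. w \<epsilon> q \<longrightarrow> \<not> w \<epsilon> m" using foundation[OF q'(1)] by auto
  then have "m = x \<or> m = y \<or> m = z" using p q by auto
  then show False using m q' c by auto
qed

lemma no_self: "\<not> x \<epsilon> x"
  using no_cycle3[of x x x] by auto

lemma no_cycle2: "x \<epsilon> y \<Longrightarrow> \<not> y \<epsilon> x"
proof
  assume c: "x \<epsilon> y" "y \<epsilon> x"
  then obtain p where p: "p \<in> U" "\<forall>w. w \<epsilon> p \<longleftrightarrow> w = x \<or> w = y"
    using upair_exists by blast
  have p': "x \<epsilon> p" "y \<epsilon> p" using p by auto
  obtain m where m: "m \<epsilon> p" "\<forall>w. w \<epsilon> p \<longrightarrow> \<not> w \<epsilon> m" using foundation[OF p'(1)] by auto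
  then have "m = x \<or> m = y" using p by auto
  then show False using m p' c by auto
qed

lemma sbs_refl: "x \<in> U \<Longrightarrow> sbs M x x"
  by (simp add: sbs_def)

lemma sbs_trans: "sbs M x y \<Longrightarrow> sbs M y z \<Longrightarrow> sbs M x z"
  by (simp add: sbs_def)

lemma sbsD: "sbs M x y \<Longrightarrow> z \<epsilon> x \<Longrightarrow> z \<epsilon> y"
  by (simp add: sbs_def)

lemma is_upair_iff:
  assumes "p \<in> U" "x \<in> U" "y \<in> U"
  shows "is_upair M p x y \<longleftrightarrow> (\<forall>z. z \<epsilon> p \<longleftrightarrow> z = x \<or> z = y)"
  using assms unfolding is_upair_def ein_def by auto

lemma opair_iff:
  assumes p: "p \<in> U" and xy: "x \<in> U" "y \<in> U"
  shows "is_opair M p x y \<longleftrightarrow> (\<exists>u. u \<epsilon> p \<and> (\<exists>v. v \<epsilon> p \<and>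
      (x \<epsilon> u \<and> (\<forall>z. z \<epsilon> u \<longrightarrow> z = x)) \<and>
      (x \<epsilon> v \<and> y \<epsilon> v \<and> (\<forall>z. z \<epsilon> v \<longrightarrow> z = x \<or> z = y)) \<and>
      (\<forall>w. w \<epsilon> p \<longrightarrow> w = u \<or> w = v)))" (is "_ \<longleftrightarrow> ?R")
proof
  assume "is_opair M p x y"
  then obtain u v where uv: "u \<in> U" "v \<in> U" "is_upair M u x x" "is_upair M v x y" "is_upair M p u v"
    unfolding is_opair_def by auto
  note * = uv(3)[unfolded is_upair_iff[OF uv(1) xy(1,1)]] uv(4)[unfolded is_upair_iff[OF uv(2) xy]]
    uv(5)[unfolded is_upair_iff[OF p uv(1,2)]]
  show ?R by (rule exI[of _ u], rule conjI, simp add: *, rule exI[of _ v]) (simp add: *)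
next
  assume ?R
  then obtain u v where uv: "u \<epsilon> p" "v \<epsilon> p" "x \<epsilon> u" "\<forall>z. z \<epsilon> u \<longrightarrow> z = x"
    "x \<epsilon> v" "y \<epsilon> v" "\<forall>z. z \<epsilon> v \<longrightarrow> z = x \<or> z = y"
    "\<forall>w. w \<epsilon> p \<longrightarrow> w = u \<or> w = v" by blast
  have U: "u \<in> U" "v \<in> U" using uv(1,2) by auto
  have "is_upair M u x x" unfolding is_upair_iff[OF U(1) xy(1,1)] using uv(3,4) by metis
  moreover have "is_upair M v x y" unfolding is_upair_iff[OF U(2) xy] using uv(5-7) by metis
  moreover have "is_upair M p u v" unfolding is_upair_iff[OF p U] using uv(1,2,8) by metis
  ultimately show "is_opair M p x y" unfolding is_opair_def using U by auto
qed

lemma is_upair_ex1: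
  assumes xy: "x \<in> U" "y \<in> U"
  shows "\<exists>!p. p \<in> U \<and> is_upair M p x y"
proof -
  obtain p where p: "p \<in> U" "\<forall>z. z \<epsilon> p \<longleftrightarrow> z = x \<or> z = y" using upair_exists[OF xy] by blast
  have "is_upair M p x y" using p(2) unfolding is_upair_iff[OF p(1) xy] .
  moreover have "q = p" if q: "q \<in> U" "is_upair M q x y" for q
    using q(2) p unfolding is_upair_iff[OF q(1) xy] by (intro extensionality[OF q(1) p(1)]) simp
  ultimately show ?thesis using p(1) by blast
qed

lemma opair_ex1:
  assumes xy: "x \<in> U" "y \<in> U"
  shows "\<exists>!p. p \<in> U \<and> is_opair M p x y"
proof -
  obtain u where u: "u \<in> U" "is_upair M u x x" "\<And>q. q \<in> U \<Longrightarrow> is_upair M q x x \<Longrightarrow> q = u"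
    using is_upair_ex1[OF xy(1,1)] by blast
  obtain v where v: "v \<in> U" "is_upair M v x y" "\<And>q. q \<in> U \<Longrightarrow> is_upair M q x y \<Longrightarrow> q = v"
    using is_upair_ex1[OF xy] by blast
  obtain p where p: "p \<in> U" "is_upair M p u v" "\<And>q. q \<in> U \<Longrightarrow> is_upair M q u v \<Longrightarrow> q = p"
    using is_upair_ex1[OF u(1) v(1)] by blast
  show ?thesis
  proof (rule ex1I[of _ p])
    show "p \<in> U \<and> is_opair M p x y" using p(1,2) u(1,2) v(1,2) unfolding is_opair_def by auto
    show "q = p" if "q \<in> U \<and> is_opair M q x y" for q
      using that p(3) u(3) v(3) unfolding is_opair_def by auto
  qed
qed

lemma prd_in [simp]: "x \<in> U \<Longrightarrow> y \<in> U \<Longrightarrow> prd M x y \<in> U"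
  and prd_opair: "x \<in> U \<Longrightarrow> y \<in> U \<Longrightarrow> is_opair M (prd M x y) x y"
  using theI'[OF opair_ex1, of x y] unfolding prd_def by auto

lemma prd_iff: "p \<in> U \<Longrightarrow> x \<in> U \<Longrightarrow> y \<in> U \<Longrightarrow> is_opair M p x y \<longleftrightarrow> p = prd M x y"
  using opair_ex1[of x y] prd_opair[of x y] prd_in[of x y] by auto

lemma prd_inj:
  assumes "prd M x y = prd M x' y'" "x \<in> U" "y \<in> U" "x' \<in> U" "y' \<in> U"
  shows "x = x' \<and> y = y'"
proof -
  have "is_opair M (prd M x y) x y" "is_opair M (prd M x y) x' y'"
    using assms prd_opair[OF assms(2,3)] prd_opair[OF assms(4,5)] by simp_all
  then show ?thesis
    using assms unfolding opair_iff[OF prd_in[OF assms(2,3)] assms(2,3)]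
      opair_iff[OF prd_in[OF assms(2,3)] assms(4,5)] by (elim exE conjE) metis
qed

lemma prd_eq [simp]:
  "x \<in> U \<Longrightarrow> y \<in> U \<Longrightarrow> x' \<in> U \<Longrightarrow> y' \<in> U \<Longrightarrow> prd M x y = prd M x' y' \<longleftrightarrow> x = x' \<and> y = y'"
  using prd_inj by blast

lemma uin_prd:
  assumes "x \<in> U" "y \<in> U"
  shows uin_prd1: "uin M x (prd M x y)" and uin_prd2: "uin M y (prd M x y)"
  using prd_opair[OF assms] opair_iff[OF prd_in[OF assms] assms] unfolding uin_def by blast+

lemma prd_not_emp: "x \<in> U \<Longrightarrow> y \<in> U \<Longrightarrow> prd M x y \<noteq> emp M"
  using uin_prd1 unfolding uin_def by fastforce

end

lemma D0_prd [D0_intros]: "D0 (\<lambda>M e. e i = prd M (e j) (e k))"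
proof (rule D0_iff)
  show "D0 (\<lambda>M e. \<exists>u. ein M u (e i) \<and> (\<exists>v. ein M v (e i) \<and>
      (ein M (e j) u \<and> (\<forall>z. ein M z u \<longrightarrow> z = e j)) \<and>
      (ein M (e j) v \<and> ein M (e k) v \<and> (\<forall>z. ein M z v \<longrightarrow> z = e j \<or> z = e k)) \<and>
      (\<forall>w. ein M w (e i) \<longrightarrow> w = u \<or> w = v)))"
    by (intro D0_intros)
next
  fix M :: "'a eps_struct" and e :: "nat \<Rightarrow> 'a"
  assume M: "kpp M" and "range e \<subseteq> univ M"
  then have r: "e i \<in> univ M" "e j \<in> univ M" "e k \<in> univ M" by auto
  show "(\<exists>u. ein M u (e i) \<and> (\<exists>v. ein M v (e i) \<and>
      (ein M (e j) u \<and> (\<forall>z. ein M z u \<longrightarrow> z = e j)) \<and>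
      (ein M (e j) v \<and> ein M (e k) v \<and> (\<forall>z. ein M z v \<longrightarrow> z = e j \<or> z = e k)) \<and>
      (\<forall>w. ein M w (e i) \<longrightarrow> w = u \<or> w = v))) \<longleftrightarrow> e i = prd M (e j) (e k)"
    using kpp.opair_iff[OF M r] kpp.prd_iff[OF M r] by simp
qed

lemma D0_emp [D0_intros]: "D0 (\<lambda>M e. e i = emp M)"
proof (rule D0_iff)
  show "D0 (\<lambda>M e. \<forall>z. ein M z (e i) \<longrightarrow> False)" by (intro D0_intros)
next
  fix M :: "'a eps_struct" and e :: "nat \<Rightarrow> 'a"
  assume M: "kpp M" and "range e \<subseteq> univ M"
  then have r: "e i \<in> univ M" by auto
  show "(\<forall>z. ein M z (e i) \<longrightarrow> False) \<longleftrightarrow> e i = emp M"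
    using kpp.emp_unique[OF M r] kpp.emp_empty[OF M] by metis
qed

section \<open>Levels\<close>

text \<open>The stages of the cumulative hierarchy, after Potter and Button. A history is a set of levels that
  contains with each of them all earlier ones, and a level is the first one beyond some history. As
  this history can be found among the subsets of the level, being a level has a bounded definition.\<close>

definition hist :: "'a eps_struct \<Rightarrow> 'a \<Rightarrow> bool" where
  "hist M h \<longleftrightarrow> (\<forall>u. ein M u h \<longrightarrow>
     (\<forall>x. ein M x u \<longrightarrow> (\<exists>c. ein M c h \<and> ein M c u \<and> sbs M x c)) \<and>
     (\<forall>c. ein M c h \<longrightarrow> ein M c u \<longrightarrow> (\<forall>x. sbs M x c \<longrightarrow> ein M x u)))"

definition lvl :: "'a eps_struct \<Rightarrow> 'a \<Rightarrow> bool" where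
  "lvl M v \<longleftrightarrow> (\<exists>h. sbs M h v \<and> hist M h \<and>
     (\<forall>x. ein M x v \<longrightarrow> (\<exists>c. ein M c h \<and> sbs M x c)) \<and>
     (\<forall>c. ein M c h \<longrightarrow> (\<forall>x. sbs M x c \<longrightarrow> ein M x v)))"

definition tran :: "'a eps_struct \<Rightarrow> 'a \<Rightarrow> bool" where
  "tran M v \<longleftrightarrow> (\<forall>y. ein M y v \<longrightarrow> (\<forall>x. ein M x y \<longrightarrow> ein M x v))"

definition stran :: "'a eps_struct \<Rightarrow> 'a \<Rightarrow> bool" where
  "stran M v \<longleftrightarrow> (\<forall>y. ein M y v \<longrightarrow> (\<forall>x. sbs M x y \<longrightarrow> ein M x v))"

lemma D0_hist [D0_intros]: "D0 (\<lambda>M e. hist M (e i))"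
  unfolding hist_def by (intro D0_intros)

lemma D0_lvl [D0_intros]: "D0 (\<lambda>M e. lvl M (e i))"
  unfolding lvl_def by (intro D0_intros)

lemma D0_tran [D0_intros]: "D0 (\<lambda>M e. tran M (e i))"
  unfolding tran_def by (intro D0_intros)

lemma D0_stran [D0_intros]: "D0 (\<lambda>M e. stran M (e i))"
  unfolding stran_def by (intro D0_intros)

context kpp
begin

lemma hist_tran:
  assumes h: "hist M h" and u: "u \<epsilon> h"
  shows "tran M u"
proof (rule ccontr)
  assume n: "\<not> tran M u"
  have "D0 (\<lambda>M e. \<not> tran M (e 0))" by (intro D0_intros)
  from separation[OF this, of "\<lambda>_. h" h] u
  obtain b where b: "\<forall>u. u \<epsilon> b \<longleftrightarrow> u \<epsilon> h \<and> \<not> tran M u" by auto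
  obtain m where m: "m \<epsilon> b" "\<forall>w. w \<epsilon> b \<longrightarrow> \<not> w \<epsilon> m" using foundation[of u b] b u n by blast
  have "x \<epsilon> m" if "x \<epsilon> y" "y \<epsilon> m" for x y
  proof -
    have "m \<epsilon> h" using m b by blast
    then obtain c where c: "c \<epsilon> h" "c \<epsilon> m" "sbs M y c"
      using h \<open>y \<epsilon> m\<close> unfolding hist_def by metis
    \<comment> \<open>By minimality of \<open>m\<close>.\<close>
    have "tran M c" using m b c by blast
    moreover have "x \<epsilon> c" using c that sbsD by blast
    ultimately have "sbs M x c" using that unfolding tran_def sbs_def by blast
    then show ?thesis using h \<open>m \<epsilon> h\<close> c unfolding hist_def by blast
  qed
  then have "tran M m" unfolding tran_def by blast
  then show False using m b by blast
qed

lemma acc_tran: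
  assumes h: "hist M h"
    and "\<forall>x. x \<epsilon> v \<longrightarrow> (\<exists>c. c \<epsilon> h \<and> sbs M x c)"
    and "\<forall>c. c \<epsilon> h \<longrightarrow> (\<forall>x. sbs M x c \<longrightarrow> x \<epsilon> v)"
  shows "tran M v"
  unfolding tran_def
proof (intro allI impI)
  fix x y assume xy: "y \<epsilon> v" "x \<epsilon> y"
  then obtain c where c: "c \<epsilon> h" "sbs M y c" using assms by blast
  then have "tran M c" using hist_tran h by blast
  moreover have "x \<epsilon> c" using c xy sbsD by blast
  ultimately have "sbs M x c" using xy unfolding tran_def sbs_def by blast
  then show "x \<epsilon> v" using c assms by blast
qed

lemma lvl_in: "lvl M v \<Longrightarrow> v \<in> U"
  unfolding lvl_def by blast

lemma lvl_tran: "lvl M v \<Longrightarrow> y \<epsilon> v \<Longrightarrow> x \<epsilon> y \<Longrightarrow> x \<epsilon> v"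
proof -
  assume v: "lvl M v" and xy: "y \<epsilon> v" "x \<epsilon> y"
  from v have "tran M v" unfolding lvl_def by (elim exE conjE) (rule acc_tran)
  then show "x \<epsilon> v" using xy unfolding tran_def by blast
qed

lemma lvl_stran: "lvl M v \<Longrightarrow> y \<epsilon> v \<Longrightarrow> sbs M x y \<Longrightarrow> x \<epsilon> v"
  unfolding lvl_def using sbs_trans by metis

text \<open>The elements of \<open>h\<close> that lie in \<open>u\<close> form a history for \<open>u\<close>.\<close>

lemma hist_lvl:
  assumes h: "hist M h" and u: "u \<epsilon> h"
  shows "lvl M u"
proof -
  have "D0 (\<lambda>M e. ein M (e 0) (e 1))" by (intro D0_intros)
  from separation[OF this, of "\<lambda>_. u" h] u
  obtain k where k: "k \<in> U" "\<forall>c. c \<epsilon> k \<longleftrightarrow> c \<epsilon> h \<and> c \<epsilon> u" by auto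
  have t: "tran M u" using hist_tran assms by blast
  have "hist M k"
    unfolding hist_def
  proof (intro allI impI conjI)
    fix w x assume w: "w \<epsilon> k" "x \<epsilon> w"
    then obtain c where c: "c \<epsilon> h" "c \<epsilon> w" "sbs M x c" using h k unfolding hist_def by blast
    moreover have "c \<epsilon> u" using t c w k unfolding tran_def by blast
    ultimately show "\<exists>c. c \<epsilon> k \<and> c \<epsilon> w \<and> sbs M x c" using k by blast
  next
    fix w c x assume "w \<epsilon> k" "c \<epsilon> k" "c \<epsilon> w" "sbs M x c"
    then show "x \<epsilon> w" using h k unfolding hist_def by blast
  qed
  moreover have "sbs M k u" using k u unfolding sbs_def by blast
  moreover have "\<forall>x. x \<epsilon> u \<longrightarrow> (\<exists>c. c \<epsilon> k \<and> sbs M x c)"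
    using h u k unfolding hist_def by blast
  moreover have "\<forall>c. c \<epsilon> k \<longrightarrow> (\<forall>x. sbs M x c \<longrightarrow> x \<epsilon> u)"
    using h u k unfolding hist_def by blast
  ultimately show ?thesis unfolding lvl_def by blast
qed

lemma lvl_cover: "lvl M v \<Longrightarrow> x \<epsilon> v \<Longrightarrow> \<exists>c. lvl M c \<and> c \<epsilon> v \<and> sbs M x c"
proof -
  assume v: "lvl M v" "x \<epsilon> v"
  then obtain h where h: "hist M h" "\<forall>x. x \<epsilon> v \<longrightarrow> (\<exists>c. c \<epsilon> h \<and> sbs M x c)"
    "\<forall>c. c \<epsilon> h \<longrightarrow> (\<forall>x. sbs M x c \<longrightarrow> x \<epsilon> v)" unfolding lvl_def by blast
  then obtain c where c: "c \<epsilon> h" "sbs M x c" using v by blast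
  have "c \<epsilon> v" using h(3) c sbs_refl by blast
  then show ?thesis using c hist_lvl h(1) by blast
qed

text \<open>Take an incomparable pair that is minimal, first in \<open>u\<close>, then in \<open>v\<close>. Each element of \<open>u\<close> is
  included in a level in \<open>u\<close>, which is comparable with \<open>v\<close> and hence lies in \<open>v\<close>, and conversely; so
  \<open>u = v\<close>. The minimum is taken below the given levels to keep the conditions bounded.\<close>

lemma lvl_linear:
  assumes u0: "lvl M u0" and v0: "lvl M v0"
  shows "u0 \<epsilon> v0 \<or> u0 = v0 \<or> v0 \<epsilon> u0"
proof (rule ccontr)
  assume n: "\<not> ?thesis"
  define inc where "inc u v \<longleftrightarrow> \<not> (u \<epsilon> v \<or> u = v \<or> v \<epsilon> u)" for u v
  obtain u1 where u1: "u1 \<in> U" "\<forall>w. w \<epsilon> u1 \<longleftrightarrow> w = u0 \<or> w \<epsilon> u0"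
    using insert_exists lvl_in u0 by blast
  obtain v1 where v1: "v1 \<in> U" "\<forall>w. w \<epsilon> v1 \<longleftrightarrow> w = v0 \<or> w \<epsilon> v0"
    using insert_exists lvl_in v0 by blast
  have "D0 (\<lambda>M e. lvl M (e 0) \<and> (\<exists>v. ein M v (e 1) \<and> lvl M v \<and>
      \<not> (ein M (e 0) v \<or> e 0 = v \<or> ein M v (e 0))))" by (intro D0_intros)
  from separation[OF this, of "\<lambda>_. v1" u1] u1 v1 obtain a where
    a: "a \<in> U" "\<forall>u. u \<epsilon> a \<longleftrightarrow> u \<epsilon> u1 \<and> lvl M u \<and> (\<exists>v. v \<epsilon> v1 \<and> lvl M v \<and> inc u v)"
    unfolding inc_def by auto
  have "v0 \<epsilon> v1" "u0 \<epsilon> u1" using u1 v1 by auto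
  then have "u0 \<epsilon> a" using a u0 v0 n unfolding inc_def by blast
  then obtain u where u: "u \<epsilon> a" "\<forall>w. w \<epsilon> a \<longrightarrow> \<not> w \<epsilon> u" using foundation[of u0 a] by blast
  have ul: "lvl M u" using u a by blast
  have "D0 (\<lambda>M e. lvl M (e 0) \<and> \<not> (ein M (e 1) (e 0) \<or> e 1 = e 0 \<or> ein M (e 0) (e 1)))"
    by (intro D0_intros)
  from separation[OF this, of "\<lambda>_. u" v1] u v1 obtain b where
    b: "b \<in> U" "\<forall>v. v \<epsilon> b \<longleftrightarrow> v \<epsilon> v1 \<and> lvl M v \<and> inc u v"
    unfolding inc_def by auto
  obtain v' where "v' \<epsilon> b" using u a b by blast
  then obtain v where v: "v \<epsilon> b" "\<forall>w. w \<epsilon> b \<longrightarrow> \<not> w \<epsilon> v" using foundation[of v' b] by blast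
  have vl: "lvl M v" using v b by blast
  have "u = v"
  proof (rule extensionality)
    show "u \<in> U" "v \<in> U" using ul vl lvl_in by auto
    fix x
    have "x \<epsilon> v" if x: "x \<epsilon> u"
    proof -
      obtain c where c: "lvl M c" "c \<epsilon> u" "sbs M x c" using lvl_cover ul x by blast
      have "c \<epsilon> u1" using c u a u1 lvl_tran u0 by metis
      then have "\<not> inc c v" using u c a v b by blast
      moreover have "c \<noteq> v" "\<not> v \<epsilon> c"
        using c v b lvl_tran[OF ul] unfolding inc_def by blast+
      ultimately have "c \<epsilon> v" unfolding inc_def by blast
      then show ?thesis using lvl_stran vl c by blast
    qed
    moreover have "x \<epsilon> u" if x: "x \<epsilon> v"
    proof -
      obtain c where c: "lvl M c" "c \<epsilon> v" "sbs M x c" using lvl_cover vl x by blast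
      have "c \<epsilon> v1" using c v b v1 lvl_tran v0 by metis
      then have "\<not> inc u c" using v c b by blast
      moreover have "c \<noteq> u" "\<not> u \<epsilon> c"
        using c v b lvl_tran[OF vl] unfolding inc_def by blast+
      ultimately have "c \<epsilon> u" unfolding inc_def by blast
      then show ?thesis using lvl_stran ul c by blast
    qed
    ultimately show "x \<epsilon> u \<longleftrightarrow> x \<epsilon> v" by blast
  qed
  then show False using v b unfolding inc_def by blast
qed

text \<open>A downward closed set of levels is a history.\<close>

lemma lvl_of_levels:
  assumes h: "h \<in> U" "\<forall>u. u \<epsilon> h \<longrightarrow> lvl M u" "\<forall>u c. u \<epsilon> h \<longrightarrow> c \<epsilon> u \<longrightarrow> lvl M c \<longrightarrow> c \<epsilon> h"
  shows "\<exists>v. lvl M v \<and> (\<forall>x. x \<epsilon> v \<longleftrightarrow> (\<exists>c. c \<epsilon> h \<and> sbs M x c))"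
proof -
  obtain w where w: "w \<in> U" "\<forall>z. z \<epsilon> w \<longleftrightarrow> uin M z h" using union_exists h by blast
  obtain p where p: "p \<in> U" "\<forall>z. z \<epsilon> p \<longleftrightarrow> sbs M z w" using powerset_exists w by blast
  have "D0 (\<lambda>M e. \<exists>c. ein M c (e 1) \<and> sbs M (e 0) c)" by (intro D0_intros)
  from separation[OF this, of "\<lambda>_. h" p] p h
  obtain v where v: "v \<in> U" "\<forall>x. x \<epsilon> v \<longleftrightarrow> x \<epsilon> p \<and> (\<exists>c. c \<epsilon> h \<and> sbs M x c)" by auto
  have "x \<epsilon> p" if "c \<epsilon> h" "sbs M x c" for x c
    using that p w unfolding sbs_def uin_def by blast
  then have v: "v \<in> U" "\<forall>x. x \<epsilon> v \<longleftrightarrow> (\<exists>c. c \<epsilon> h \<and> sbs M x c)" using v by blast+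
  have "sbs M h v" using v h(1) sbs_refl unfolding sbs_def by blast
  moreover have "hist M h"
    unfolding hist_def
  proof (intro allI impI conjI)
    fix u x assume "u \<epsilon> h" "x \<epsilon> u"
    then show "\<exists>c. c \<epsilon> h \<and> c \<epsilon> u \<and> sbs M x c" using h lvl_cover by blast
  next
    fix u c x assume "u \<epsilon> h" "c \<epsilon> u" "sbs M x c"
    then show "x \<epsilon> u" using h lvl_stran by blast
  qed
  ultimately have "lvl M v" using v unfolding lvl_def by blast
  then show ?thesis using v by blast
qed

lemma power_lvl:
  assumes v: "lvl M v"
  shows "\<exists>v'. lvl M v' \<and> (\<forall>x. x \<epsilon> v' \<longleftrightarrow> sbs M x v)"
proof -
  obtain w where w: "w \<in> U" "\<forall>z. z \<epsilon> w \<longleftrightarrow> z = v \<or> z \<epsilon> v" using insert_exists lvl_in v by metis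
  have "D0 (\<lambda>M e. lvl M (e 0))" by (intro D0_intros)
  from separation[OF this, of "\<lambda>_. w" w] w
  obtain h where h: "h \<in> U" "\<forall>x. x \<epsilon> h \<longleftrightarrow> x \<epsilon> w \<and> lvl M x" by auto
  have "\<forall>u c. u \<epsilon> h \<longrightarrow> c \<epsilon> u \<longrightarrow> lvl M c \<longrightarrow> c \<epsilon> h" using h w lvl_tran v by metis
  then obtain v' where v': "lvl M v'" "\<forall>x. x \<epsilon> v' \<longleftrightarrow> (\<exists>c. c \<epsilon> h \<and> sbs M x c)"
    using lvl_of_levels[of h] h by blast
  have "sbs M x v" if "c \<epsilon> h" "sbs M x c" for x c
  proof -
    have "c = v \<or> c \<epsilon> v" using that h w by blast
    then have "sbs M c v" using lvl_tran[OF v] lvl_in[OF v] unfolding sbs_def by blast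
    then show ?thesis using that sbs_trans by blast
  qed
  moreover have "v \<epsilon> h" using h w v by blast
  ultimately have "\<forall>x. x \<epsilon> v' \<longleftrightarrow> sbs M x v" using v' by blast
  then show ?thesis using v' by blast
qed

text \<open>Every set is included in a level. A minimal counterexample would have all its elements
  in levels, and the levels up to these collect to a level including it.\<close>

lemma sub_lvl_exists:
  assumes "x0 \<in> U"
  shows "\<exists>v. lvl M v \<and> sbs M x0 v"
proof (rule ccontr)
  assume n: "\<not> ?thesis"
  have "D0 (\<lambda>M e. \<not> (lvl M (e 0) \<and> sbs M (e 1) (e 0)))" by (intro D0_intros)
  from Pi1_foundation[OF this, of "\<lambda>_. x0" x0] n assms obtain x where
    x: "x \<in> U" "\<forall>v\<in>U. \<not> (lvl M v \<and> sbs M x v)"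
    and m: "\<forall>w. w \<epsilon> x \<longrightarrow> (\<exists>v\<in>U. lvl M v \<and> sbs M w v)" by auto
  have "D0 (\<lambda>M e. lvl M (e 0) \<and> sbs M (e 1) (e 0))" by (intro D0_intros)
  from collection[OF this, of "\<lambda>_. x" x] x m obtain y where
    y: "y \<in> U" "\<forall>u. u \<epsilon> x \<longrightarrow> (\<exists>v. v \<epsilon> y \<and> lvl M v \<and> sbs M u v)" by auto
  obtain w where w: "w \<in> U" "\<forall>z. z \<epsilon> w \<longleftrightarrow> uin M z y" using union_exists y by blast
  obtain t where t: "t \<in> U" "\<forall>z. z \<epsilon> t \<longleftrightarrow> z \<epsilon> y \<or> z \<epsilon> w" using un_exists y w by blast
  have "D0 (\<lambda>M e. lvl M (e 0) \<and> (\<exists>v. ein M v (e 1) \<and> lvl M v \<and> (e 0 = v \<or> ein M (e 0) v)))"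
    by (intro D0_intros)
  from separation[OF this, of "\<lambda>_. y" t] y t obtain h where
    h: "h \<in> U" "\<forall>u. u \<epsilon> h \<longleftrightarrow> u \<epsilon> t \<and> lvl M u \<and> (\<exists>v. v \<epsilon> y \<and> lvl M v \<and> (u = v \<or> u \<epsilon> v))"
    by auto
  have h2: "u \<epsilon> h \<longleftrightarrow> lvl M u \<and> (\<exists>v. v \<epsilon> y \<and> lvl M v \<and> (u = v \<or> u \<epsilon> v))" for u
    using h t w unfolding uin_def by blast
  then have "\<forall>u c. u \<epsilon> h \<longrightarrow> c \<epsilon> u \<longrightarrow> lvl M c \<longrightarrow> c \<epsilon> h" using lvl_tran by blast
  then obtain v where v: "lvl M v" "\<forall>x. x \<epsilon> v \<longleftrightarrow> (\<exists>c. c \<epsilon> h \<and> sbs M x c)"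
    using lvl_of_levels[of h] h h2 by blast
  have "z \<epsilon> v" if "z \<epsilon> x" for z using y that v h2 by blast
  then have "sbs M x v" using x lvl_in v unfolding sbs_def by blast
  then show False using x v lvl_in by blast
qed

lemma in_lvl_exists: "x \<in> U \<Longrightarrow> \<exists>v. lvl M v \<and> x \<epsilon> v"
  using sub_lvl_exists power_lvl by blast

text \<open>Ordered pairs of elements of a level appear two levels higher. This supplies the ambient set for
  separating sets of pairs.\<close>

lemma pair_lvl:
  assumes "lvl M v"
  shows "\<exists>v'. lvl M v' \<and> sbs M v v' \<and> (\<forall>x y. x \<epsilon> v \<longrightarrow> y \<epsilon> v \<longrightarrow> prd M x y \<epsilon> v')"
proof -
  obtain v1 where v1: "lvl M v1" "\<forall>x. x \<epsilon> v1 \<longleftrightarrow> sbs M x v" using power_lvl assms by blast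
  obtain v2 where v2: "lvl M v2" "\<forall>x. x \<epsilon> v2 \<longleftrightarrow> sbs M x v1" using power_lvl v1 by blast
  have "sbs M v v1" using v1 lvl_tran[OF assms] lvl_in assms unfolding sbs_def by blast
  moreover have "sbs M v1 v2" using v1 v2 lvl_tran[OF v1(1)] lvl_in unfolding sbs_def by blast
  moreover have "prd M x y \<epsilon> v2" if "x \<epsilon> v" "y \<epsilon> v" for x y
  proof -
    have xy: "x \<in> U" "y \<in> U" using that by auto
    obtain u w where uw: "\<forall>z. z \<epsilon> u \<longrightarrow> z = x" "\<forall>z. z \<epsilon> w \<longrightarrow> z = x \<or> z = y"
      "\<forall>z. z \<epsilon> prd M x y \<longrightarrow> z = u \<or> z = w" "u \<epsilon> prd M x y" "w \<epsilon> prd M x y"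
      using prd_opair[OF xy] opair_iff[OF prd_in[OF xy] xy] by auto
    then have "u \<epsilon> v1" "w \<epsilon> v1" using v1 that unfolding sbs_def by blast+
    then have "sbs M (prd M x y) v1" using uw prd_in[OF xy] unfolding sbs_def by blast
    then show ?thesis using v2 by blast
  qed
  ultimately show ?thesis using v2 sbs_trans by blast
qed

definition lv :: "'a \<Rightarrow> 'a" where
  "lv x = (SOME v. lvl M v \<and> sbs M x v \<and> (\<forall>u. lvl M u \<longrightarrow> u \<epsilon> v \<longrightarrow> \<not> sbs M x u))"

lemma lv_spec:
  assumes "x \<in> U"
  shows lvl_lv: "lvl M (lv x)" and sbs_lv: "sbs M x (lv x)"
    and lv_min: "lvl M u \<Longrightarrow> u \<epsilon> lv x \<Longrightarrow> \<not> sbs M x u"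
proof -
  obtain v where v: "lvl M v" "sbs M x v" using sub_lvl_exists assms by blast
  obtain w where w: "w \<in> U" "\<forall>z. z \<epsilon> w \<longleftrightarrow> z = v \<or> z \<epsilon> v" using insert_exists lvl_in v by blast
  have "D0 (\<lambda>M e. lvl M (e 0) \<and> sbs M (e 1) (e 0))" by (intro D0_intros)
  from separation[OF this, of "\<lambda>_. x" w] w assms obtain h where
    h: "h \<in> U" "\<forall>u. u \<epsilon> h \<longleftrightarrow> u \<epsilon> w \<and> lvl M u \<and> sbs M x u" by auto
  then have "v \<epsilon> h" using v w by metis
  then obtain m where m: "m \<epsilon> h" "\<forall>w. w \<epsilon> h \<longrightarrow> \<not> w \<epsilon> m" using foundation[of v h] by metis
  have "\<not> sbs M x u" if "lvl M u" "u \<epsilon> m" for u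
  proof -
    have "u \<epsilon> w" using that m h w lvl_tran v by metis
    then show ?thesis using that m h by blast
  qed
  then have "\<exists>v. lvl M v \<and> sbs M x v \<and> (\<forall>u. lvl M u \<longrightarrow> u \<epsilon> v \<longrightarrow> \<not> sbs M x u)"
    using m h by blast
  from someI_ex[OF this] show "lvl M (lv x)" "sbs M x (lv x)"
    "lvl M u \<Longrightarrow> u \<epsilon> lv x \<Longrightarrow> \<not> sbs M x u" unfolding lv_def by auto
qed

lemma lv_in: "x \<in> U \<Longrightarrow> lv x \<in> U"
  using lvl_in lvl_lv by blast

lemma lv_unique:
  assumes "lvl M v" "sbs M x v" "\<forall>u. lvl M u \<longrightarrow> u \<epsilon> v \<longrightarrow> \<not> sbs M x u"
  shows "v = lv x"
  using lvl_linear[OF assms(1) lvl_lv[of x]] assms lv_spec[of x] by blast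

lemma lv_le: "lvl M u \<Longrightarrow> sbs M x u \<Longrightarrow> lv x = u \<or> lv x \<epsilon> u"
  using lvl_linear[OF _ lvl_lv[of x]] lv_min by blast

lemma lvl_mono: "lvl M v \<Longrightarrow> u \<epsilon> v \<Longrightarrow> sbs M u v"
  using lvl_tran unfolding sbs_def by blast

lemma lv_lvl: "lvl M v \<Longrightarrow> lv v = v"
  using lv_unique[of v v] sbs_refl lvl_in no_self sbsD by metis

lemma in_lvl_iff: "lvl M v \<Longrightarrow> x \<in> U \<Longrightarrow> x \<epsilon> v \<longleftrightarrow> lv x \<epsilon> v"
  using lvl_cover lv_le lvl_tran lvl_stran sbs_lv by metis

lemma lv_mono: "sbs M x y \<Longrightarrow> sbs M (lv x) (lv y)"
  using lv_le[of "lv y" x] lvl_lv sbs_lv sbs_trans lvl_mono sbs_refl lvl_in by (metis sbsU)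

lemma lv_elem: "x \<epsilon> y \<Longrightarrow> lv x \<epsilon> lv y"
  using in_lvl_iff[of "lv y" x] lvl_lv sbs_lv sbsD by blast

end

section \<open>Ordinals and rank\<close>

context kpp
begin

text \<open>Foundation provides the remaining properties of a well-order.\<close>

lemma is_ord_iff:
  "is_ord M a \<longleftrightarrow> a \<in> U \<and> tran M a \<and>
     (\<forall>x. x \<epsilon> a \<longrightarrow> (\<forall>y. y \<epsilon> a \<longrightarrow> x \<epsilon> y \<or> x = y \<or> y \<epsilon> x))" (is "_ \<longleftrightarrow> ?R")
proof
  assume "is_ord M a"
  then show ?R unfolding is_ord_def tran_def ein_def by (intro conjI) meson+
next
  assume R: ?R
  then have a: "a \<in> U" and t: "\<And>x y. x \<epsilon> y \<Longrightarrow> y \<epsilon> a \<Longrightarrow> x \<epsilon> a"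
    and l: "\<And>x y. x \<epsilon> a \<Longrightarrow> y \<epsilon> a \<Longrightarrow> x \<epsilon> y \<or> x = y \<or> y \<epsilon> x"
    unfolding tran_def by blast+
  have e: "mem M x y \<longleftrightarrow> x \<epsilon> y" if "x \<in> U" "y \<in> U" for x y using that by (simp add: ein_def)
  show "is_ord M a"
    unfolding is_ord_def
  proof (intro conjI ballI impI)
    show "a \<in> U" by (rule a)
  next
    fix x y assume "x \<in> U" "y \<in> U" "mem M x y \<and> mem M y a"
    then show "mem M x a" using t e a by metis
  next
    fix x assume "x \<in> U" then show "\<not> mem M x x" using no_self e by metis
  next
    fix x y z assume U: "x \<in> U" "y \<in> U" "z \<in> U" and za: "mem M x a \<and> mem M y a \<and> mem M z a"
      and c: "mem M x y \<and> mem M y z"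
    have "x \<epsilon> a" "z \<epsilon> a" "x \<epsilon> y" "y \<epsilon> z" using U za c a by (auto simp: ein_def)
    then have "x \<epsilon> z" using l[of x z] no_cycle2 no_cycle3[of x y z] by blast
    then show "mem M x z" by (simp add: ein_def)
  next
    fix x y assume "x \<in> U" "y \<in> U" "mem M x a \<and> mem M y a"
    then show "mem M x y \<or> x = y \<or> mem M y x" using l[of x y] e a by metis
  next
    fix b assume b: "b \<in> U" and c: "(\<forall>x\<in>U. mem M x b \<longrightarrow> mem M x a) \<and> (\<exists>x\<in>U. mem M x b)"
    then obtain x where "x \<epsilon> b" by (auto simp: ein_def)
    then obtain m where m: "m \<epsilon> b" "\<forall>w. w \<epsilon> b \<longrightarrow> \<not> w \<epsilon> m" using foundation by blast
    have s: "w \<epsilon> a" if "w \<epsilon> b" for w using that c a by (auto simp: ein_def)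
    have "m = y \<or> mem M m y" if "y \<in> U" "mem M y b" for y
    proof -
      have "y \<epsilon> b" using that b by (simp add: ein_def)
      then have "m \<epsilon> y \<or> m = y" using l[OF s[OF m(1)] s[of y]] m(2) by blast
      then show ?thesis by (auto simp: ein_def)
    qed
    then show "\<exists>x\<in>U. mem M x b \<and> (\<forall>y\<in>U. mem M y b \<longrightarrow> x = y \<or> mem M x y)"
      using m(1) unfolding ein_def by blast
  qed
qed

end

lemma D0_is_ord [D0_intros]: "D0 (\<lambda>M e. is_ord M (e i))"
proof (rule D0_iff)
  show "D0 (\<lambda>M e. tran M (e i) \<and> (\<forall>x. ein M x (e i) \<longrightarrow>
     (\<forall>y. ein M y (e i) \<longrightarrow> ein M x y \<or> x = y \<or> ein M y x)))" by (intro D0_intros)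
next
  fix M :: "'a eps_struct" and e :: "nat \<Rightarrow> 'a"
  assume M: "kpp M" and "range e \<subseteq> univ M"
  then have r: "e i \<in> univ M" by auto
  show "(tran M (e i) \<and> (\<forall>x. ein M x (e i) \<longrightarrow>
     (\<forall>y. ein M y (e i) \<longrightarrow> ein M x y \<or> x = y \<or> ein M y x))) \<longleftrightarrow> is_ord M (e i)"
    using kpp.is_ord_iff[OF M, of "e i"] r by simp
qed

text \<open>The graph of \<open>rk\<close> on a level \<open>t\<close>. Here \<open>v\<close> is the least level including \<open>y\<close>, which belongs to
  \<open>t\<close> when \<open>y\<close> does, so the definition is bounded.\<close>

definition rk_graph :: "'a eps_struct \<Rightarrow> 'a \<Rightarrow> 'a \<Rightarrow> 'a \<Rightarrow> bool" where
  "rk_graph M t y a \<longleftrightarrow> (\<exists>v. ein M v t \<and> lvl M v \<and> sbs M y v \<and>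
     (\<forall>u. ein M u v \<longrightarrow> lvl M u \<longrightarrow> \<not> sbs M y u) \<and>
     (\<forall>b. ein M b a \<longrightarrow> ein M b v \<and> is_ord M b) \<and>
     (\<forall>b. ein M b v \<longrightarrow> is_ord M b \<longrightarrow> ein M b a))"

lemma D0_rk_graph [D0_intros]: "D0 (\<lambda>M e. rk_graph M (e i) (e j) (e k))"
  unfolding rk_graph_def by (intro D0_intros)

context kpp
begin

lemma ord_in: "is_ord M a \<Longrightarrow> a \<in> U"
  by (simp add: is_ord_iff)

lemma ord_trans: "is_ord M a \<Longrightarrow> y \<epsilon> a \<Longrightarrow> x \<epsilon> y \<Longrightarrow> x \<epsilon> a"
  unfolding is_ord_iff tran_def by blast

lemma ord_trichotomy: "is_ord M a \<Longrightarrow> x \<epsilon> a \<Longrightarrow> y \<epsilon> a \<Longrightarrow> x \<epsilon> y \<or> x = y \<or> y \<epsilon> x"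
  unfolding is_ord_iff by blast

lemma ord_elem:
  assumes a: "is_ord M a" and x: "x \<epsilon> a"
  shows "is_ord M x"
  unfolding is_ord_iff tran_def
proof (intro conjI allI impI)
  show "x \<in> U" using x by auto
next
  fix y z assume yz: "y \<epsilon> x" "z \<epsilon> y"
  then have "y \<epsilon> a" "z \<epsilon> a" using ord_trans[OF a] x by blast+
  then show "z \<epsilon> x"
    using ord_trichotomy[OF a _ x, of z] no_cycle2[of z y] no_cycle3[of x z y] yz by blast
next
  fix y z assume "y \<epsilon> x" "z \<epsilon> x"
  then show "y \<epsilon> z \<or> y = z \<or> z \<epsilon> y"
    using ord_trichotomy[OF a] ord_trans[OF a x] by blast
qed

text \<open>A minimal element of \<open>b\<close> outside \<open>a\<close> equals \<open>a\<close>.\<close>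

lemma ord_sub:
  assumes a: "is_ord M a" and b: "is_ord M b" and s: "sbs M a b"
  shows "a = b \<or> a \<epsilon> b"
proof (cases "sbs M b a")
  case True
  then show ?thesis using s sbs_antisym by blast
next
  case False
  have aU: "a \<in> U" and bU: "b \<in> U" using a b ord_in by auto
  have "D0 (\<lambda>M e. \<not> ein M (e 0) (e 1))" by (intro D0_intros)
  from separation[OF this, of "\<lambda>_. a" b] aU bU obtain d where
    d: "d \<in> U" "\<forall>x. x \<epsilon> d \<longleftrightarrow> x \<epsilon> b \<and> \<not> x \<epsilon> a" by auto
  obtain x0 where "x0 \<epsilon> d" using False d aU bU unfolding sbs_def by blast
  then obtain x where x: "x \<epsilon> d" "\<forall>w. w \<epsilon> d \<longrightarrow> \<not> w \<epsilon> x" using foundation by blast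
  have xb: "x \<epsilon> b" and xa: "\<not> x \<epsilon> a" using x d by auto
  have "x = a"
  proof (rule extensionality)
    show "x \<in> U" "a \<in> U" using xb aU by auto
    fix z
    show "z \<epsilon> x \<longleftrightarrow> z \<epsilon> a"
    proof
      assume "z \<epsilon> x"
      then show "z \<epsilon> a" using ord_trans[OF b xb] x(2) d by blast
    next
      assume za: "z \<epsilon> a"
      then have "z \<epsilon> b" using s sbsD by blast
      then show "z \<epsilon> x" using ord_trichotomy[OF b _ xb, of z] za xa ord_trans[OF a za] by blast
    qed
  qed
  then show ?thesis using xb by blast
qed

lemma ord_linear:
  assumes a: "is_ord M a" and b: "is_ord M b"
  shows "a \<epsilon> b \<or> a = b \<or> b \<epsilon> a"
proof -
  have aU: "a \<in> U" and bU: "b \<in> U" using a b ord_in by auto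
  have "D0 (\<lambda>M e. ein M (e 0) (e 1))" by (intro D0_intros)
  from separation[OF this, of "\<lambda>_. a" b] aU bU obtain c where
    c: "c \<in> U" "\<forall>x. x \<epsilon> c \<longleftrightarrow> x \<epsilon> b \<and> x \<epsilon> a" by auto
  have "is_ord M c"
    unfolding is_ord_iff tran_def
  proof (intro conjI allI impI)
    show "c \<in> U" by (rule c)
  next
    fix y x assume "y \<epsilon> c" "x \<epsilon> y"
    then show "x \<epsilon> c" using c ord_trans[OF a] ord_trans[OF b] by metis
  next
    fix x y assume "x \<epsilon> c" "y \<epsilon> c"
    then show "x \<epsilon> y \<or> x = y \<or> y \<epsilon> x" using c ord_trichotomy[OF a] by metis
  qed
  moreover have "sbs M c a" "sbs M c b" using c aU bU unfolding sbs_def by auto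
  ultimately have "c = a \<or> c \<epsilon> a" "c = b \<or> c \<epsilon> b" using ord_sub a b by auto
  then show ?thesis using c no_self by metis
qed

lemma ord_of_ords:
  assumes "z \<in> U" and "tran M z" and "\<And>x. x \<epsilon> z \<Longrightarrow> is_ord M x"
  shows "is_ord M z"
  unfolding is_ord_iff using assms ord_linear by blast

lemma ord_le_iff:
  assumes a: "is_ord M a" and b: "is_ord M b"
  shows "ord_le M a b \<longleftrightarrow> sbs M a b"
proof
  assume "ord_le M a b"
  then have "a = b \<or> a \<epsilon> b" using ord_in a b unfolding ord_le_def ein_def by blast
  then show "sbs M a b" using ord_trans[OF b] ord_in[OF a] ord_in[OF b] unfolding sbs_def by blast
next
  assume "sbs M a b"
  then show "ord_le M a b" using ord_sub[OF a b] unfolding ord_le_def ein_def by blast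
qed

definition ords :: "'a \<Rightarrow> 'a" where
  "ords v = (SOME a. a \<in> U \<and> (\<forall>b. b \<epsilon> a \<longleftrightarrow> b \<epsilon> v \<and> is_ord M b))"

lemma ords_spec:
  assumes "v \<in> U"
  shows ords_in: "ords v \<in> U" and in_ords: "b \<epsilon> ords v \<longleftrightarrow> b \<epsilon> v \<and> is_ord M b"
proof -
  have "D0 (\<lambda>M e. is_ord M (e 0))" by (intro D0_intros)
  from separation[OF this, of "\<lambda>_. v" v] assms
  have "\<exists>a. a \<in> U \<and> (\<forall>b. b \<epsilon> a \<longleftrightarrow> b \<epsilon> v \<and> is_ord M b)" by auto
  from someI_ex[OF this] show "ords v \<in> U" "b \<epsilon> ords v \<longleftrightarrow> b \<epsilon> v \<and> is_ord M b"
    unfolding ords_def by auto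
qed

lemma ords_sub: "v \<in> U \<Longrightarrow> sbs M (ords v) v"
  using ords_spec unfolding sbs_def by blast

lemma ords_ord:
  assumes "lvl M v"
  shows "is_ord M (ords v)"
proof (rule ord_of_ords)
  have v: "v \<in> U" using assms lvl_in by blast
  show "ords v \<in> U" using v ords_in by blast
  show "tran M (ords v)"
    unfolding tran_def in_ords[OF v] using lvl_tran[OF assms] ord_elem by blast
  show "\<And>x. x \<epsilon> ords v \<Longrightarrow> is_ord M x" using in_ords[OF v] by blast
qed

lemma ords_mono: "lvl M u \<Longrightarrow> lvl M v \<Longrightarrow> u \<epsilon> v \<Longrightarrow> ords u \<epsilon> ords v"
  using in_ords[of v "ords u"] lvl_in lvl_stran ords_sub ords_ord by metis

text \<open>By \<open>has_rank_unique\<close> below, this is the rank of \<open>x\<close>.\<close>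

definition rk :: "'a \<Rightarrow> 'a" where
  "rk x = ords (lv x)"

lemma rk_ord: "x \<in> U \<Longrightarrow> is_ord M (rk x)"
  unfolding rk_def using ords_ord lvl_lv by blast

lemma rk_in: "x \<in> U \<Longrightarrow> rk x \<in> U"
  using rk_ord ord_in by blast

lemma rk_less: "x \<in> U \<Longrightarrow> y \<in> U \<Longrightarrow> lv x \<epsilon> lv y \<Longrightarrow> rk x \<epsilon> rk y"
  unfolding rk_def using ords_mono lvl_lv by blast

lemma rk_le_iff:
  assumes "x \<in> U" "y \<in> U"
  shows "ord_le M (rk x) (rk y) \<longleftrightarrow> sbs M (lv x) (lv y)"
proof
  assume le: "ord_le M (rk x) (rk y)"
  have "\<not> lv y \<epsilon> lv x"
  proof
    assume "lv y \<epsilon> lv x"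
    then have "rk y \<epsilon> rk x" using rk_less assms by blast
    moreover have "sbs M (rk x) (rk y)" using le ord_le_iff rk_ord assms by blast
    ultimately show False using sbsD no_self by blast
  qed
  then have "lv x \<epsilon> lv y \<or> lv x = lv y" using lvl_linear lvl_lv assms by blast
  then show "sbs M (lv x) (lv y)" using lvl_mono lvl_lv sbs_refl lv_in assms by metis
next
  assume s: "sbs M (lv x) (lv y)"
  have "sbs M (rk x) (rk y)"
    unfolding rk_def sbs_def
    using s ords_spec lv_in assms unfolding sbs_def by auto
  then show "ord_le M (rk x) (rk y)" using ord_le_iff rk_ord assms by blast
qed

text \<open>If \<open>b\<close> is an ordinal in the least level including \<open>y\<close>, then \<open>b\<close> is included in a lower level
  \<open>u\<close>. As \<open>u\<close> does not include \<open>y\<close>, some \<open>z \<in> y\<close> is not in \<open>u\<close>, so the least level for \<open>z\<close>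
  includes \<open>u\<close> and thus \<open>b\<close>.\<close>

lemma rk_rec:
  assumes y: "y \<in> U" and b: "b \<in> U"
  shows "b \<epsilon> rk y \<longleftrightarrow> (\<exists>z. z \<epsilon> y \<and> ord_le M b (rk z))"
proof
  assume "b \<epsilon> rk y"
  then have bb: "b \<epsilon> lv y" "is_ord M b" unfolding rk_def using in_ords lv_in y by auto
  then obtain u where u: "lvl M u" "u \<epsilon> lv y" "sbs M b u" using lvl_cover[OF lvl_lv[OF y]] by blast
  then have "\<not> sbs M y u" using lv_min y by blast
  then obtain z where z: "z \<epsilon> y" "\<not> z \<epsilon> u" using y u lvl_in unfolding sbs_def by blast
  have zU: "z \<in> U" using z by auto
  have "\<not> lv z \<epsilon> u" using in_lvl_iff[OF u(1) zU] z by blast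
  then have "u = lv z \<or> u \<epsilon> lv z" using lvl_linear[OF u(1) lvl_lv[OF zU]] by blast
  then have "sbs M u (lv z)" using lvl_mono[OF lvl_lv[OF zU]] sbs_refl lvl_in u by blast
  then have "sbs M b (lv z)" using u sbs_trans by blast
  then have "sbs M b (rk z)"
    unfolding rk_def sbs_def using ords_spec[OF lv_in[OF zU]] ord_elem[OF bb(2)] b by auto
  then show "\<exists>z. z \<epsilon> y \<and> ord_le M b (rk z)" using z ord_le_iff[OF bb(2) rk_ord[OF zU]] by blast
next
  assume "\<exists>z. z \<epsilon> y \<and> ord_le M b (rk z)"
  then obtain z where z: "z \<epsilon> y" "ord_le M b (rk z)" by blast
  have zU: "z \<in> U" using z by auto
  have "rk z \<epsilon> rk y" using rk_less[OF zU y] lv_elem z by blast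
  moreover have "b = rk z \<or> b \<epsilon> rk z" using z(2) b rk_in[OF zU] unfolding ord_le_def ein_def by blast
  ultimately show "b \<epsilon> rk y" using ord_trans rk_ord[OF y] by blast
qed

lemma rk_graph_iff:
  assumes t: "lvl M t" and y: "y \<epsilon> t" and a: "a \<in> U"
  shows "rk_graph M t y a \<longleftrightarrow> a = rk y"
proof
  have yU: "y \<in> U" using y by auto
  { assume "rk_graph M t y a"
    then obtain v where v: "lvl M v" "sbs M y v" "\<forall>u. u \<epsilon> v \<longrightarrow> lvl M u \<longrightarrow> \<not> sbs M y u"
      "\<forall>b. b \<epsilon> a \<longrightarrow> b \<epsilon> v \<and> is_ord M b" "\<forall>b. b \<epsilon> v \<longrightarrow> is_ord M b \<longrightarrow> b \<epsilon> a"
      unfolding rk_graph_def by blast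
    have "v = lv y" using lv_unique v(1-3) by blast
    then show "a = rk y"
      unfolding rk_def using v(4,5) ords_spec[OF lv_in[OF yU]] a
      by (intro extensionality) auto }
  { assume "a = rk y"
    then show "rk_graph M t y a"
      unfolding rk_graph_def rk_def
      using in_lvl_iff[OF t yU] y lv_spec[OF yU] ords_spec[OF lv_in[OF yU]]
      by (intro exI[of _ "lv y"]) auto }
qed

lemma maps_to_iff: "f \<in> U \<Longrightarrow> x \<in> U \<Longrightarrow> y \<in> U \<Longrightarrow> maps_to M f x y \<longleftrightarrow> prd M x y \<epsilon> f"
  unfolding maps_to_def ein_def using prd_iff prd_in by auto

text \<open>The function \<open>rk\<close> on a level satisfies the rank recursion there, by \<open>rk_rec\<close>.\<close>

lemma has_rank_rk:
  assumes x: "x \<in> U"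
  shows "has_rank M x (rk x)"
proof -
  obtain t where t: "lvl M t" "x \<epsilon> t" using in_lvl_exists x by blast
  obtain q where q: "lvl M q" "\<forall>x y. x \<epsilon> t \<longrightarrow> y \<epsilon> t \<longrightarrow> prd M x y \<epsilon> q"
    using pair_lvl[OF t(1)] by blast
  have tU: "t \<in> U" and qU: "q \<in> U" using t q lvl_in by auto
  have rt: "rk y \<epsilon> t" if "y \<epsilon> t" for y
  proof -
    have y: "y \<in> U" using that by auto
    then have "lv y \<epsilon> t" using in_lvl_iff[OF t(1)] that by blast
    then show ?thesis using lvl_stran[OF t(1)] ords_sub[OF lv_in[OF y]] unfolding rk_def by blast
  qed
  have "D0 (\<lambda>M e. \<exists>y. uin M y (e 0) \<and> (\<exists>a. uin M a (e 0) \<and> e 0 = prd M y a \<and>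
      ein M y (e 1) \<and> rk_graph M (e 1) y a))" by (intro D0_intros)
  from separation[OF this, of "\<lambda>_. t" q] tU qU obtain f where
    f: "f \<in> U" "\<forall>p. p \<epsilon> f \<longleftrightarrow> p \<epsilon> q \<and> (\<exists>y. uin M y p \<and> (\<exists>a. uin M a p \<and> p = prd M y a \<and>
      y \<epsilon> t \<and> rk_graph M t y a))" by auto
  have f2: "p \<epsilon> f \<longleftrightarrow> (\<exists>y. y \<epsilon> t \<and> p = prd M y (rk y))" for p
  proof
    assume "p \<epsilon> f"
    then obtain y a where "uin M a p" "p = prd M y a" "y \<epsilon> t" "rk_graph M t y a" using f(2) by blast
    moreover have "a \<in> U" using \<open>uin M a p\<close> unfolding uin_def by blast
    ultimately show "\<exists>y. y \<epsilon> t \<and> p = prd M y (rk y)" using rk_graph_iff[OF t(1)] by blast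
  next
    assume "\<exists>y. y \<epsilon> t \<and> p = prd M y (rk y)"
    then obtain y where y: "y \<epsilon> t" "p = prd M y (rk y)" by blast
    have yU: "y \<in> U" using y by auto
    have "p \<epsilon> q" using q(2) y rt by blast
    moreover have "uin M y p" "uin M (rk y) p" using uin_prd[OF yU rk_in[OF yU]] y by auto
    moreover have "rk_graph M t y (rk y)" using rk_graph_iff[OF t(1) y(1) rk_in[OF yU]] by blast
    ultimately show "p \<epsilon> f" using f(2) y by blast
  qed
  have m: "maps_to M f y a \<longleftrightarrow> y \<epsilon> t \<and> a = rk y" if "y \<in> U" "a \<in> U" for y a
  proof -
    have "prd M y a = prd M y' (rk y') \<longleftrightarrow> y' = y \<and> a = rk y" if "y' \<epsilon> t" for y'
      using prd_eq[OF \<open>y \<in> U\<close> \<open>a \<in> U\<close>, of y' "rk y'"] rk_in[of y'] that by auto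
    then show ?thesis unfolding maps_to_iff[OF f(1) that] f2 by auto
  qed
  have "is_rank_function M f t"
    unfolding is_rank_function_def is_function_def
  proof (intro conjI ballI impI)
    fix x y assume "x \<in> U" "y \<in> U" "mem M x y \<and> mem M y t"
    then show "mem M x t" using lvl_tran[OF t(1), of y x] tU by (simp add: ein_def)
  next
    fix p assume "p \<in> U" "mem M p f"
    then have "p \<epsilon> f" using f(1) by (simp add: ein_def)
    then obtain y where y: "y \<epsilon> t" "p = prd M y (rk y)" using f2 by blast
    have yU: "y \<in> U" using y by auto
    show "\<exists>x\<in>U. \<exists>y\<in>U. mem M x t \<and> is_opair M p x y"
      using prd_opair[OF yU rk_in[OF yU]] y yU rk_in[OF yU] unfolding ein_def by blast
  next
    fix y assume y: "y \<in> U" "mem M y t"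
    then have "y \<epsilon> t" using tU by (simp add: ein_def)
    then show "\<exists>!a. a \<in> U \<and> maps_to M f y a" using m y(1) rk_in[OF y(1)] by metis
  next
    fix y a assume "y \<in> U" "a \<in> U" "mem M y t \<and> maps_to M f y a"
    then show "is_ord M a" using m rk_ord by blast
  next
    fix y a b assume yU: "y \<in> U" and a: "a \<in> U" and ya: "mem M y t \<and> maps_to M f y a" and b: "b \<in> U"
    have a2: "a = rk y" and yt: "y \<epsilon> t" using m yU a ya by blast+
    have "mem M b a \<longleftrightarrow> b \<epsilon> rk y" using a2 a b by (simp add: ein_def)
    also have "\<dots> \<longleftrightarrow> (\<exists>z. z \<epsilon> y \<and> ord_le M b (rk z))" by (rule rk_rec[OF yU b])
    also have "\<dots> \<longleftrightarrow> (\<exists>z\<in>U. mem M z y \<and> (\<exists>c\<in>U. maps_to M f z c \<and> ord_le M b c))"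
    proof
      assume "\<exists>z. z \<epsilon> y \<and> ord_le M b (rk z)"
      then obtain z where z: "z \<epsilon> y" "ord_le M b (rk z)" by blast
      have zU: "z \<in> U" using z by auto
      have "z \<epsilon> t" using lvl_tran[OF t(1) yt z(1)] .
      then have "maps_to M f z (rk z)" using m[OF zU rk_in[OF zU]] by blast
      then show "\<exists>z\<in>U. mem M z y \<and> (\<exists>c\<in>U. maps_to M f z c \<and> ord_le M b c)"
        using z zU rk_in[OF zU] unfolding ein_def by blast
    next
      assume "\<exists>z\<in>U. mem M z y \<and> (\<exists>c\<in>U. maps_to M f z c \<and> ord_le M b c)"
      then obtain z c where zc: "z \<in> U" "mem M z y" "c \<in> U" "maps_to M f z c" "ord_le M b c" by blast
      then have "c = rk z" using m by blast
      then show "\<exists>z. z \<epsilon> y \<and> ord_le M b (rk z)" using zc yU unfolding ein_def by blast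
    qed
    finally show "mem M b a \<longleftrightarrow> (\<exists>z\<in>U. mem M z y \<and> (\<exists>c\<in>U. maps_to M f z c \<and> ord_le M b c))" .
  qed
  moreover have "maps_to M f x (rk x)" using m[OF x rk_in[OF x]] t by blast
  ultimately show ?thesis unfolding has_rank_def using f(1) tU t(2) rk_in[OF x] by (auto simp: ein_def)
qed

text \<open>A rank function cannot differ from \<open>rk\<close>: consider a minimal place where it does.\<close>

lemma has_rank_unique:
  assumes "has_rank M x a" and "x \<in> U"
  shows "a = rk x"
proof -
  obtain f t where f: "f \<in> U" and t: "t \<in> U" and xt: "mem M x t" and mx: "maps_to M f x a"
    and aU: "a \<in> U" and rf: "is_rank_function M f t"
    using assms unfolding has_rank_def by blast
  obtain w where w: "lvl M w" "sbs M t w" using sub_lvl_exists t by blast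
  have wU: "w \<in> U" using w lvl_in by blast
  have tr: "z \<epsilon> t" if "z \<epsilon> y" "y \<epsilon> t" for z y
    using rf that t unfolding is_rank_function_def ein_def by blast
  have fu: "\<exists>!c. c \<in> U \<and> maps_to M f y c" if "y \<epsilon> t" for y
    using rf that unfolding is_rank_function_def is_function_def ein_def by blast
  have rec: "b \<epsilon> c \<longleftrightarrow> (\<exists>z. z \<epsilon> y \<and> (\<exists>d\<in>U. maps_to M f z d \<and> ord_le M b d))"
    if "y \<epsilon> t" "c \<in> U" "maps_to M f y c" "b \<in> U" for b c y
  proof -
    have "mem M b c \<longleftrightarrow> (\<exists>z\<in>U. mem M z y \<and> (\<exists>d\<in>U. maps_to M f z d \<and> ord_le M b d))"
      using rf that unfolding is_rank_function_def ein_def by blast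
    moreover have "y \<in> U" using that by auto
    ultimately show ?thesis using that unfolding ein_def by auto
  qed
  have main: "c = rk y" if "y \<epsilon> t" "c \<in> U" "maps_to M f y c" for y c
  proof (rule ccontr)
    assume n: "c \<noteq> rk y"
    have "D0 (\<lambda>M e. \<exists>p. ein M p (e 1) \<and> (\<exists>a. uin M a p \<and> p = prd M (e 0) a \<and>
        \<not> rk_graph M (e 2) (e 0) a))" by (intro D0_intros)
    from separation[OF this, of "f ## (\<lambda>_. w)" t] f wU t obtain h where
      h: "h \<in> U" "\<forall>y. y \<epsilon> h \<longleftrightarrow> y \<epsilon> t \<and> (\<exists>p. p \<epsilon> f \<and> (\<exists>a. uin M a p \<and> p = prd M y a \<and> \<not> rk_graph M w y a))"
      by (auto simp: range_push)
    have h2: "y \<epsilon> h \<longleftrightarrow> y \<epsilon> t \<and> (\<exists>a\<in>U. maps_to M f y a \<and> a \<noteq> rk y)" for y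
    proof (cases "y \<epsilon> t")
      case True
      then have yU: "y \<in> U" and yw: "y \<epsilon> w" using w(2) sbsD by auto
      have "(\<exists>p. p \<epsilon> f \<and> (\<exists>a. uin M a p \<and> p = prd M y a \<and> \<not> rk_graph M w y a)) \<longleftrightarrow>
        (\<exists>a\<in>U. maps_to M f y a \<and> a \<noteq> rk y)"
      proof
        assume "\<exists>p. p \<epsilon> f \<and> (\<exists>a. uin M a p \<and> p = prd M y a \<and> \<not> rk_graph M w y a)"
        then obtain a where a: "uin M a (prd M y a)" "prd M y a \<epsilon> f" "\<not> rk_graph M w y a" by blast
        have "a \<in> U" using a(1) unfolding uin_def by blast
        then show "\<exists>a\<in>U. maps_to M f y a \<and> a \<noteq> rk y"
          using a maps_to_iff[OF f yU] rk_graph_iff[OF w(1) yw] by blast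
      next
        assume "\<exists>a\<in>U. maps_to M f y a \<and> a \<noteq> rk y"
        then obtain a where "a \<in> U" "maps_to M f y a" "a \<noteq> rk y" by blast
        then show "\<exists>p. p \<epsilon> f \<and> (\<exists>a. uin M a p \<and> p = prd M y a \<and> \<not> rk_graph M w y a)"
          using maps_to_iff[OF f yU] rk_graph_iff[OF w(1) yw] uin_prd2[OF yU] by blast
      qed
      then show ?thesis using True h(2) by blast
    next
      case False
      then show ?thesis using h(2) by blast
    qed
    have "y \<epsilon> h" using h2 that n by blast
    then obtain m where m: "m \<epsilon> h" "\<forall>w. w \<epsilon> h \<longrightarrow> \<not> w \<epsilon> m" using foundation by blast
    then obtain d where d: "m \<epsilon> t" "d \<in> U" "maps_to M f m d" "d \<noteq> rk m" using h2 by blast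
    have mU: "m \<in> U" using d by auto
    have z: "maps_to M f z c \<longleftrightarrow> c = rk z" if "z \<epsilon> m" "c \<in> U" for z c
    proof -
      have zt: "z \<epsilon> t" using tr that d(1) by blast
      have "\<not> z \<epsilon> h" using m(2) that by blast
      then have "\<And>a. a \<in> U \<Longrightarrow> maps_to M f z a \<Longrightarrow> a = rk z" using h2 zt by blast
      then show ?thesis using fu[OF zt] that(2) by metis
    qed
    have "d = rk m"
    proof (rule extensionality)
      show "d \<in> U" "rk m \<in> U" using d rk_in mU by auto
      fix b
      show "b \<epsilon> d \<longleftrightarrow> b \<epsilon> rk m"
      proof (cases "b \<in> U")
        case True
        have "(\<exists>z. z \<epsilon> m \<and> (\<exists>c\<in>U. maps_to M f z c \<and> ord_le M b c)) \<longleftrightarrow>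
            (\<exists>z. z \<epsilon> m \<and> ord_le M b (rk z))" using z rk_in by (metis einU)
        then show ?thesis using rec[OF d(1-3) True] rk_rec[OF mU True] by simp
      next
        case False
        then show ?thesis by auto
      qed
    qed
    then show False using d by blast
  qed
  have "x \<epsilon> t" using assms(2) xt t by (simp add: ein_def)
  then show ?thesis using main aU mx by blast
qed

lemma rank_eq: "x \<in> U \<Longrightarrow> rank M x = rk x"
  unfolding rank_def using has_rank_rk has_rank_unique by blast

lemma rank_le_iff:
  "x \<in> U \<Longrightarrow> y \<in> U \<Longrightarrow> ord_le M (rank M x) (rank M y) \<longleftrightarrow> sbs M (lv x) (lv y)"
  using rank_eq rk_le_iff by simp

end

section \<open>Absoluteness of bounded formulae\<close>

text \<open>The witnesses of bounded quantifiers are elements or subsets of parameters, hence in the image.\<close>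

lemma Delta0P_absolute:
  assumes emb: "embedding A B i"
    and tr: "\<And>n m. n \<in> univ B \<Longrightarrow> m \<in> univ A \<Longrightarrow> mem B n (i m) \<Longrightarrow> n \<in> i ` univ A"
    and st: "\<And>n m. n \<in> univ B \<Longrightarrow> m \<in> univ A \<Longrightarrow>
      \<forall>z \<in> univ B. mem B z n \<longrightarrow> mem B z (i m) \<Longrightarrow> n \<in> i ` univ A"
    and "p \<in> Delta0P" and "range e \<subseteq> univ A"
  shows "sat A e p \<longleftrightarrow> sat B (\<lambda>n. i (e n)) p"
proof -
  have iU: "i x \<in> univ B" if "x \<in> univ A" for x using emb that unfolding embedding_def by blast
  have inj: "i x = i y \<longleftrightarrow> x = y" if "x \<in> univ A" "y \<in> univ A" for x y
    using emb that unfolding embedding_def inj_on_def by blast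
  have mem: "mem A x y \<longleftrightarrow> mem B (i x) (i y)" if "x \<in> univ A" "y \<in> univ A" for x y
    using emb that unfolding embedding_def by blast
  have push: "i x ## (\<lambda>n. i (e n)) = (\<lambda>n. i ((x ## e) n))" for x e
    by (rule ext) (simp split: nat.splits)
  have eU: "e n \<in> univ A" if "range e \<subseteq> univ A" for e :: "nat \<Rightarrow> _" and n using that by auto
  have sub: "(\<forall>z \<in> univ A. mem A z x \<longrightarrow> mem A z y) \<longleftrightarrow>
      (\<forall>z \<in> univ B. mem B z (i x) \<longrightarrow> mem B z (i y))" if "x \<in> univ A" "y \<in> univ A" for x y
  proof
    assume *: "\<forall>z \<in> univ A. mem A z x \<longrightarrow> mem A z y"
    show "\<forall>z \<in> univ B. mem B z (i x) \<longrightarrow> mem B z (i y)"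
    proof (intro ballI impI)
      fix z assume z: "z \<in> univ B" "mem B z (i x)"
      then obtain w where "w \<in> univ A" "z = i w" using tr \<open>x \<in> univ A\<close> by blast
      then show "mem B z (i y)" using * z mem that by blast
    qed
  next
    assume "\<forall>z \<in> univ B. mem B z (i x) \<longrightarrow> mem B z (i y)"
    then show "\<forall>z \<in> univ A. mem A z x \<longrightarrow> mem A z y" using mem iU that by blast
  qed
  have ex: "(\<exists>a \<in> univ B. mem B a (i y) \<and> Q a) \<longleftrightarrow> (\<exists>a \<in> univ A. mem A a y \<and> Q (i a))"
    if "y \<in> univ A" for y Q
    using tr mem iU that by blast
  have exs: "(\<exists>a \<in> univ B. (\<forall>z \<in> univ B. mem B z a \<longrightarrow> mem B z (i y)) \<and> Q a) \<longleftrightarrow>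
      (\<exists>a \<in> univ A. (\<forall>z \<in> univ A. mem A z a \<longrightarrow> mem A z y) \<and> Q (i a))"
    if y: "y \<in> univ A" for y Q
  proof
    assume "\<exists>a \<in> univ B. (\<forall>z \<in> univ B. mem B z a \<longrightarrow> mem B z (i y)) \<and> Q a"
    then obtain a where a: "a \<in> univ B" "\<forall>z \<in> univ B. mem B z a \<longrightarrow> mem B z (i y)" "Q a" by blast
    then obtain b where b: "b \<in> univ A" "a = i b" using st[OF a(1) y a(2)] by blast
    then show "\<exists>a \<in> univ A. (\<forall>z \<in> univ A. mem A z a \<longrightarrow> mem A z y) \<and> Q (i a)"
      using a sub[OF b(1) y] by blast
  next
    assume "\<exists>a \<in> univ A. (\<forall>z \<in> univ A. mem A z a \<longrightarrow> mem A z y) \<and> Q (i a)"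
    then obtain a where "a \<in> univ A" "\<forall>z \<in> univ A. mem A z a \<longrightarrow> mem A z y" "Q (i a)" by blast
    then show "\<exists>a \<in> univ B. (\<forall>z \<in> univ B. mem B z a \<longrightarrow> mem B z (i y)) \<and> Q a"
      using sub[OF _ y] iU by blast
  qed
  show ?thesis
    using assms(4,5)
  proof (induction arbitrary: e rule: Delta0P.induct)
    case (7 p y)
    have "sat B (i a ## (\<lambda>n. i (e n))) p \<longleftrightarrow> sat A (a ## e) p" if "a \<in> univ A" for a
      unfolding push by (rule 7(2)[symmetric]) (use 7(3) that in \<open>simp add: range_push\<close>)
    then show ?case using ex[of "e y" "\<lambda>a. sat B (a ## (\<lambda>n. i (e n))) p"] eU[OF 7(3)] by auto
  next
    case (8 p y)
    have "sat B (i a ## (\<lambda>n. i (e n))) p \<longleftrightarrow> sat A (a ## e) p" if "a \<in> univ A" for a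
      unfolding push by (rule 8(2)[symmetric]) (use 8(3) that in \<open>simp add: range_push\<close>)
    then show ?case using ex[of "e y" "\<lambda>a. \<not> sat B (a ## (\<lambda>n. i (e n))) p"] eU[OF 8(3)] by auto
  next
    case (9 p y)
    have "sat B (i a ## (\<lambda>n. i (e n))) p \<longleftrightarrow> sat A (a ## e) p" if "a \<in> univ A" for a
      unfolding push by (rule 9(2)[symmetric]) (use 9(3) that in \<open>simp add: range_push\<close>)
    then show ?case using exs[of "e y" "\<lambda>a. sat B (a ## (\<lambda>n. i (e n))) p"] eU[OF 9(3)] by auto
  next
    case (10 p y)
    have "sat B (i a ## (\<lambda>n. i (e n))) p \<longleftrightarrow> sat A (a ## e) p" if "a \<in> univ A" for a
      unfolding push by (rule 10(2)[symmetric]) (use 10(3) that in \<open>simp add: range_push\<close>)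
    then show ?case using exs[of "e y" "\<lambda>a. \<not> sat B (a ## (\<lambda>n. i (e n))) p"] eU[OF 10(3)] by auto
  qed (auto simp: mem inj eU)
qed

section \<open>Cuts\<close>

context kpp
begin

lemma rk_ordinal:
  assumes a: "is_ord M a"
  shows "rk a = a"
proof (rule extensionality)
  have aU: "a \<in> U" using a ord_in by blast
  show "rk a \<in> U" "a \<in> U" using aU rk_in by auto
  have n: "\<not> a \<epsilon> lv a"
    using lvl_cover[OF lvl_lv[OF aU], of a] lv_min[OF aU] by blast
  fix b
  show "b \<epsilon> rk a \<longleftrightarrow> b \<epsilon> a"
    unfolding rk_def in_ords[OF lv_in[OF aU]]
  proof
    assume b: "b \<epsilon> lv a \<and> is_ord M b"
    then have "b \<noteq> a" "\<not> a \<epsilon> b" using n lvl_tran[OF lvl_lv[OF aU]] by blast+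
    then show "b \<epsilon> a" using ord_linear[OF a] b by blast
  next
    assume "b \<epsilon> a"
    then show "b \<epsilon> lv a \<and> is_ord M b" using sbs_lv[OF aU] sbsD ord_elem[OF a] by blast
  qed
qed

lemma lv_less_iff:
  assumes "x \<in> U" "y \<in> U"
  shows "rk x \<epsilon> rk y \<longleftrightarrow> lv x \<epsilon> lv y"
proof
  assume r: "rk x \<epsilon> rk y"
  have "\<not> sbs M (lv y) (lv x)"
    using rk_le_iff[OF assms(2,1)] ord_le_iff[OF rk_ord rk_ord, OF assms(2,1)] sbsD[OF _ r] no_self
    by blast
  moreover have "sbs M (lv y) (lv x)" if "lv x = lv y \<or> lv y \<epsilon> lv x"
    using that sbs_refl lv_in lvl_mono[OF lvl_lv] assms by metis
  ultimately show "lv x \<epsilon> lv y"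
    using lvl_linear[OF lvl_lv lvl_lv, OF assms] by blast
qed (use rk_less assms in blast)

text \<open>The level is the least one including the omitted ordinal \<open>a\<close>: a lower level fails to contain some
  element of \<open>a\<close>, which belongs to \<open>I\<close>, and so lies below a level in \<open>I\<close>.\<close>

lemma least_ordinal_level:
  assumes tr: "\<And>x y. x \<epsilon> y \<Longrightarrow> y \<in> I \<Longrightarrow> x \<in> I"
    and st: "\<And>x y. sbs M x y \<Longrightarrow> y \<in> I \<Longrightarrow> x \<in> I"
    and cov: "\<And>y. y \<in> I \<Longrightarrow> \<exists>l \<in> I. lvl M l \<and> y \<epsilon> l"
    and a: "is_ord M a" "a \<notin> I" "\<And>b. is_ord M b \<Longrightarrow> b \<notin> I \<Longrightarrow> ord_le M a b"
  shows "\<exists>l. lvl M l \<and> (\<forall>x. x \<epsilon> l \<longleftrightarrow> x \<in> I)"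
proof -
  have aU: "a \<in> U" using a ord_in by blast
  have "x \<in> I" if x: "x \<epsilon> lv a" for x
  proof -
    obtain u where u: "lvl M u" "u \<epsilon> lv a" "sbs M x u" using lvl_cover[OF lvl_lv[OF aU] x] by blast
    have "\<not> sbs M a u" using lv_min[OF aU] u by blast
    then obtain b where b: "b \<epsilon> a" "\<not> b \<epsilon> u" using aU lvl_in u unfolding sbs_def by blast
    have bo: "is_ord M b" using ord_elem a b by blast
    have "b \<in> I"
    proof (rule ccontr)
      assume "b \<notin> I"
      then have "sbs M a b" using a(3)[OF bo] ord_le_iff[OF a(1) bo] by blast
      then show False using b sbsD no_self by blast
    qed
    then obtain l where l: "l \<in> I" "lvl M l" "b \<epsilon> l" using cov by blast
    have "u \<epsilon> l" using lvl_linear[OF u(1) l(2)] l(3) b(2) lvl_tran[OF u(1)] by blast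
    then show ?thesis using tr st u(3) l(1) by blast
  qed
  moreover have "x \<epsilon> lv a" if x: "x \<in> I" for x
  proof -
    obtain l where l: "l \<in> I" "lvl M l" "x \<epsilon> l" using cov x by blast
    have "\<not> lv a \<epsilon> l" using lvl_stran[OF l(2)] sbs_lv[OF aU] tr l(1) a(2) by blast
    moreover have "lv a \<noteq> l" using sbs_lv[OF aU] st l(1) a(2) by blast
    ultimately have "l \<epsilon> lv a" using lvl_linear[OF l(2) lvl_lv[OF aU]] by blast
    then show ?thesis using lvl_tran[OF lvl_lv[OF aU]] l by blast
  qed
  ultimately show ?thesis using lvl_lv[OF aU] by blast
qed

end

text \<open>A rank-initial topless substructure is used through the following consequences: it is closed
  under elements, subsets and levels, some level includes it, and it is not itself a level.\<close>

locale cut = kpp +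
  fixes S :: "'a eps_struct"
  assumes substr: "substructure S M"
    and init: "rank_initial S M (\<lambda>x. x)"
    and topl: "topless S M (\<lambda>x. x)"
begin

lemma SU: "x \<in> univ S \<Longrightarrow> x \<in> U"
  using substr unfolding substructure_def by blast

lemma S_mem: "x \<in> univ S \<Longrightarrow> y \<in> univ S \<Longrightarrow> mem S x y \<longleftrightarrow> x \<epsilon> y"
  using substr unfolding substructure_def ein_def by blast

lemma S_down: "y \<in> univ S \<Longrightarrow> x \<in> U \<Longrightarrow> sbs M (lv x) (lv y) \<Longrightarrow> x \<in> univ S"
  using init rank_le_iff[of x y] SU[of y] unfolding rank_initial_def by auto

lemma S_trans: "x \<epsilon> y \<Longrightarrow> y \<in> univ S \<Longrightarrow> x \<in> univ S"
  using S_down[of y x] lvl_mono[OF lvl_lv lv_elem] by blast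

lemma S_sub: "sbs M x y \<Longrightarrow> y \<in> univ S \<Longrightarrow> x \<in> univ S"
  using S_down lv_mono by blast

lemma S_lv: "y \<in> univ S \<Longrightarrow> lv y \<in> univ S"
  using S_down[of y "lv y"] lv_lvl[OF lvl_lv] lv_in sbs_refl SU by metis

lemma S_bounded: "\<exists>w. lvl M w \<and> (\<forall>s \<in> univ S. s \<epsilon> w)"
proof -
  obtain a where a: "is_ord M a" "\<forall>m \<in> univ S. mem M (rank M m) a"
    using topl unfolding topless_def Ord_def by auto
  have aU: "a \<in> U" using a ord_in by blast
  have "s \<epsilon> lv a" if s: "s \<in> univ S" for s
  proof -
    have "rk s \<epsilon> rk a" using a s rank_eq rk_ordinal rk_in SU aU unfolding ein_def by metis
    then show ?thesis using lv_less_iff in_lvl_iff lvl_lv aU SU s by blast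
  qed
  then show ?thesis using lvl_lv aU by blast
qed

text \<open>If \<open>S\<close> were a level \<open>l\<close>, then the set of ordinals in \<open>l\<close> would be the least ordinal outside \<open>S\<close>.\<close>

lemma S_not_level: "lvl M l \<Longrightarrow> (\<And>x. x \<epsilon> l \<longleftrightarrow> x \<in> univ S) \<Longrightarrow> False"
proof -
  assume l: "lvl M l" and eq: "\<And>x. x \<epsilon> l \<longleftrightarrow> x \<in> univ S"
  have lU: "l \<in> U" using l lvl_in by blast
  have o: "is_ord M (ords l)" using ords_ord l by blast
  have n: "ords l \<notin> univ S" using eq in_ords[OF lU] o no_self by blast
  have "ord_le M (ords l) b" if "is_ord M b" "b \<notin> univ S" for b
  proof -
    have "\<not> b \<epsilon> ords l" using that in_ords[OF lU] eq by blast
    then show ?thesis using ord_linear[OF o that(1)] unfolding ord_le_def ein_def by blast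
  qed
  then show False using topl o n unfolding topless_def Ord_def by auto
qed

text \<open>Otherwise the level after the least one including \<open>y\<close> would be all of \<open>S\<close>.\<close>

lemma S_in_level: "y \<in> univ S \<Longrightarrow> \<exists>l \<in> univ S. lvl M l \<and> y \<epsilon> l"
proof (rule ccontr)
  assume y: "y \<in> univ S" and n: "\<not> (\<exists>l \<in> univ S. lvl M l \<and> y \<epsilon> l)"
  have yU: "y \<in> U" using y SU by blast
  obtain v where v: "lvl M v" "\<forall>x. x \<epsilon> v \<longleftrightarrow> sbs M x (lv y)" using power_lvl lvl_lv yU by blast
  have vS: "v \<notin> univ S" using n v sbs_lv[OF yU] by blast
  have "x \<epsilon> v \<longleftrightarrow> x \<in> univ S" for x
  proof
    assume "x \<epsilon> v" then show "x \<in> univ S" using v S_sub S_lv y by blast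
  next
    assume x: "x \<in> univ S"
    have xU: "x \<in> U" using x SU by blast
    have "\<not> lv y \<epsilon> lv x"
    proof
      assume "lv y \<epsilon> lv x"
      then have "sbs M v (lv x)"
        using v lvl_stran[OF lvl_lv[OF xU]] lvl_in lv_in[OF xU] unfolding sbs_def[of M v] by blast
      then show False using S_sub S_lv x vS by blast
    qed
    then have "lv x = lv y \<or> lv x \<epsilon> lv y" using lvl_linear lvl_lv xU yU by blast
    then have "sbs M (lv x) (lv y)" using lvl_mono[OF lvl_lv[OF yU]] sbs_refl lv_in[OF xU] by metis
    then show "x \<epsilon> v" using v sbs_lv[OF xU] sbs_trans by blast
  qed
  then show False using S_not_level v by blast
qed

lemma S_below: "lvl M u \<Longrightarrow> u \<notin> univ S \<Longrightarrow> s \<in> univ S \<Longrightarrow> s \<epsilon> u"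
  using S_in_level[of s] lvl_linear[of u] S_trans lvl_tran by metis

text \<open>The first level \<open>u\<close> missing from \<open>X\<close> includes \<open>S\<close>, but it is not \<open>S\<close>. So it has an element
  outside \<open>S\<close>, and the levels in \<open>u\<close> that include this element are in \<open>X\<close>.\<close>

lemma overspill:
  assumes X: "X \<in> U" and all: "\<And>u. u \<in> univ S \<Longrightarrow> lvl M u \<Longrightarrow> u \<epsilon> X"
  shows "\<exists>u. lvl M u \<and> u \<notin> univ S \<and> u \<epsilon> X"
proof -
  obtain w where w: "lvl M w" "\<forall>s \<in> univ S. s \<epsilon> w" using S_bounded by blast
  have wU: "w \<in> U" using w lvl_in by blast
  have wS: "w \<notin> univ S" using w no_self by blast
  show ?thesis
  proof (cases "w \<epsilon> X")
    case True
    then show ?thesis using w wS by blast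
  next
    case False
    obtain w' where w': "w' \<in> U" "\<forall>z. z \<epsilon> w' \<longleftrightarrow> z = w \<or> z \<epsilon> w"
      using insert_exists[OF wU wU] by blast
    have "D0 (\<lambda>M e. lvl M (e 0) \<and> \<not> ein M (e 0) (e 1))" by (intro D0_intros)
    from separation[OF this, of "\<lambda>_. X" w'] X w' obtain y where
      y: "y \<in> U" "\<forall>u. u \<epsilon> y \<longleftrightarrow> u \<epsilon> w' \<and> lvl M u \<and> \<not> u \<epsilon> X" by auto
    have "w \<epsilon> y" using y w' w(1) False by metis
    then obtain u where u: "u \<epsilon> y" "\<forall>z. z \<epsilon> y \<longrightarrow> \<not> z \<epsilon> u" using foundation by blast
    have ul: "lvl M u" "\<not> u \<epsilon> X" using u y by blast+
    then have uS: "u \<notin> univ S" using all by blast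
    then obtain z where z: "z \<epsilon> u" "z \<notin> univ S"
      using S_not_level[OF ul(1)] S_below[OF ul(1) uS] by blast
    obtain c where c: "lvl M c" "c \<epsilon> u" "sbs M z c" using lvl_cover[OF ul(1) z(1)] by blast
    have "c \<notin> univ S" using c z S_sub by blast
    moreover have "u = w \<or> u \<epsilon> w" using u(1) y(2) w'(2) by metis
    then have "c \<epsilon> w'" using lvl_tran[OF w(1)] c(2) w'(2) by metis
    then have "c \<epsilon> X" using u(2) c y(2) by blast
    ultimately show ?thesis using c by blast
  qed
qed

lemma S_emp: "emp M \<in> univ S"
proof -
  obtain x where "x \<in> univ S" using substr unfolding substructure_def by blast
  moreover have "sbs M (emp M) x" using calculation SU unfolding sbs_def by auto
  ultimately show ?thesis using S_sub by blast
qed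

lemma S_prd:
  assumes "x \<in> univ S" "y \<in> univ S"
  shows "prd M x y \<in> univ S"
proof -
  obtain w where w: "lvl M w" "\<forall>s \<in> univ S. s \<epsilon> w" using S_bounded by blast
  obtain l where l: "l \<in> univ S" "lvl M l" "x \<epsilon> l" using S_in_level assms by blast
  obtain k where k: "k \<in> univ S" "lvl M k" "y \<epsilon> k" using S_in_level assms by blast
  have "\<exists>n \<in> univ S. lvl M n \<and> x \<epsilon> n \<and> y \<epsilon> n"
    using lvl_linear[OF l(2) k(2)] l k lvl_tran[OF l(2)] lvl_tran[OF k(2)] by metis
  then obtain n where n: "n \<in> univ S" "lvl M n" "x \<epsilon> n" "y \<epsilon> n" by blast
  obtain n1 where n1: "n1 \<in> univ S" "lvl M n1" "n \<epsilon> n1" using S_in_level n by blast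
  obtain n2 where n2: "n2 \<in> univ S" "lvl M n2" "n1 \<epsilon> n2" using S_in_level n1 by blast
  have xy: "x \<in> U" "y \<in> U" using assms SU by auto
  obtain u v where uv: "\<forall>z. z \<epsilon> u \<longrightarrow> z = x" "\<forall>z. z \<epsilon> v \<longrightarrow> z = x \<or> z = y"
      "\<forall>z. z \<epsilon> prd M x y \<longrightarrow> z = u \<or> z = v" "u \<epsilon> prd M x y" "v \<epsilon> prd M x y"
    using prd_opair[OF xy] opair_iff[OF prd_in[OF xy] xy] by auto
  have "sbs M u n" "sbs M v n" using uv n unfolding sbs_def by blast+
  then have "u \<epsilon> n1" "v \<epsilon> n1" using lvl_stran[OF n1(2) n1(3)] by blast+
  then have "sbs M (prd M x y) n1" using uv prd_in[OF xy] unfolding sbs_def by blast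
  then show ?thesis using S_sub n1 by blast
qed

lemma S_sat: "p \<in> Delta0P \<Longrightarrow> range e \<subseteq> univ S \<Longrightarrow> sat S e p \<longleftrightarrow> sat M e p"
proof -
  assume p: "p \<in> Delta0P" and e: "range e \<subseteq> univ S"
  have "sat S e p \<longleftrightarrow> sat M (\<lambda>n. e n) p"
  proof (rule Delta0P_absolute[OF _ _ _ p e])
    show "embedding S M (\<lambda>x. x)" using init unfolding rank_initial_def by blast
  next
    fix n m assume "n \<in> U" "m \<in> univ S" "mem M n m"
    then have "n \<epsilon> m" using SU by (simp add: ein_def)
    then show "n \<in> (\<lambda>x. x) ` univ S" using S_trans \<open>m \<in> univ S\<close> by auto
  next
    fix n m assume "n \<in> U" "m \<in> univ S" "\<forall>z \<in> U. mem M z n \<longrightarrow> mem M z m"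
    then have "sbs M n m" using SU unfolding sbs_def ein_def by auto
    then show "n \<in> (\<lambda>x. x) ` univ S" using S_sub \<open>m \<in> univ S\<close> by auto
  qed
  then show ?thesis by (simp add: comp_def)
qed

end

text \<open>Bounded formulae are absolute between \<open>S\<close> and either model.\<close>

lemma cut_agree:
  assumes "cut M S" and "cut N S" and "D0 R" and e: "range e \<subseteq> univ S"
  shows "R M e \<longleftrightarrow> R N e"
proof -
  interpret M: cut M S by fact
  interpret N: cut N S by fact
  obtain p where p: "p \<in> Delta0P" "\<And>M e. kpp M \<Longrightarrow> range e \<subseteq> univ M \<Longrightarrow> sat M e p = R M e"
    using assms(3) unfolding D0_def by blast
  have "range e \<subseteq> univ M" "range e \<subseteq> univ N" using e M.SU N.SU by auto
  then have "sat M e p = R M e" "sat N e p = R N e"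
    using p(2) M.kpp_axioms N.kpp_axioms by blast+
  then show ?thesis using M.S_sat[OF p(1) e] N.S_sat[OF p(1) e] by blast
qed

section \<open>A universal formula\<close>

text \<open>A variable-free notation for first-order definable relations on a set \<open>T\<close>; the value of a term is a
  set of tuples of one fixed length. Variables are handled by position, so a truth definition inside a
  model has no assignments to update. \<open>One\<close> is the set of the empty tuple. In terms of their arguments,
  operation 0 prefixes an arbitrary entry, operation 1 inserts an arbitrary second entry, operations 2
  and 3 prefix two entries that are related by membership in either direction, and operation 4 is the
  combination of negated conjunction and quantification \<open>\<not> \<exists>x. p \<and> r\<close>, which by itself generates
  the connectives and quantifiers. The argument \<open>f\<close> supplies the range of the remaining entries.\<close>

datatype tm = One | Op nat tm tm tm

primrec wf_tm :: "tm \<Rightarrow> bool" where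
  "wf_tm One = True"
| "wf_tm (Op n f p r) = (n < 5 \<and> wf_tm f \<and> wf_tm p \<and> wf_tm r)"

primrec ev :: "'a eps_struct \<Rightarrow> 'a \<Rightarrow> tm \<Rightarrow> 'a list set" where
  "ev M T One = {[]}"
| "ev M T (Op n f p r) =
    (if n = 0 then {x # l | x l. ein M x T \<and> l \<in> ev M T f}
     else if n = 4 then {l \<in> ev M T f. \<not> (\<exists>x. ein M x T \<and> x # l \<in> ev M T p \<and> x # l \<in> ev M T r)}
     else {x # y # l | x y l. ein M x T \<and> ein M y T \<and> l \<in> ev M T f \<and>
       (if n = 1 then x # l \<in> ev M T p else if n = 2 then ein M x y else ein M y x)})"

text \<open>Tuples are nested pairs ending in the empty set, both as elements of relations on \<open>T\<close> and for the
  finite partial maps later on.\<close>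

primrec tup :: "'a eps_struct \<Rightarrow> 'a list \<Rightarrow> 'a" where
  "tup M [] = emp M"
| "tup M (x # xs) = prd M x (tup M xs)"

definition tag :: "'a eps_struct \<Rightarrow> nat \<Rightarrow> 'a" where
  "tag M n = tup M (replicate n (emp M))"

primrec code :: "'a eps_struct \<Rightarrow> tm \<Rightarrow> 'a" where
  "code M One = emp M"
| "code M (Op n f p r) = prd M (tag M n) (prd M (code M f) (prd M (code M p) (code M r)))"

text \<open>The clauses of \<open>ev\<close> read inside a model: \<open>opm\<close> says that \<open>e\<close> belongs to the result of operation
  \<open>n\<close> on relations \<open>F\<close>, \<open>P\<close>, \<open>R\<close>, and \<open>opr\<close> that \<open>X\<close> is this result. The detour through bounded
  quantifiers over the components of pairs makes both definable.\<close>

definition opm :: "'a eps_struct \<Rightarrow> nat \<Rightarrow> 'a \<Rightarrow> 'a \<Rightarrow> 'a \<Rightarrow> 'a \<Rightarrow> 'a \<Rightarrow> bool" where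
  "opm M n T F P R e \<longleftrightarrow>
    (if n = 0 then (\<exists>x. ein M x T \<and> (\<exists>l. ein M l F \<and> e = prd M x l))
     else if n = 4 then ein M e F \<and> \<not> (\<exists>x. ein M x T \<and> (\<exists>g. ein M g P \<and> g = prd M x e \<and> ein M g R))
     else (\<exists>x. ein M x T \<and> (\<exists>y. ein M y T \<and> (\<exists>l. ein M l F \<and> (\<exists>h. uin M h e \<and>
       h = prd M y l \<and> e = prd M x h \<and>
       (if n = 1 then \<exists>g. ein M g P \<and> g = prd M x l else if n = 2 then ein M x y else ein M y x))))))"

definition opr :: "'a eps_struct \<Rightarrow> nat \<Rightarrow> 'a \<Rightarrow> 'a \<Rightarrow> 'a \<Rightarrow> 'a \<Rightarrow> 'a \<Rightarrow> bool" where
  "opr M n T F P R X \<longleftrightarrow> (\<forall>e. ein M e X \<longrightarrow> opm M n T F P R e) \<and>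
    (if n = 0 then (\<forall>x. ein M x T \<longrightarrow> (\<forall>l. ein M l F \<longrightarrow> (\<exists>e. ein M e X \<and> e = prd M x l)))
     else if n = 4 then (\<forall>l. ein M l F \<longrightarrow>
       \<not> (\<exists>x. ein M x T \<and> (\<exists>g. ein M g P \<and> g = prd M x l \<and> ein M g R)) \<longrightarrow> ein M l X)
     else (\<forall>x. ein M x T \<longrightarrow> (\<forall>y. ein M y T \<longrightarrow> (\<forall>l. ein M l F \<longrightarrow>
       (if n = 1 then \<exists>g. ein M g P \<and> g = prd M x l else if n = 2 then ein M x y else ein M y x) \<longrightarrow>
       (\<exists>e. ein M e X \<and> (\<exists>h. uin M h e \<and> h = prd M y l \<and> e = prd M x h))))))"

lemma D0_if [D0_intros]: "(b \<Longrightarrow> D0 R) \<Longrightarrow> (\<not> b \<Longrightarrow> D0 Q) \<Longrightarrow> D0 (\<lambda>M e. if b then R M e else Q M e)"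
  by (cases b) auto

lemma D0_ex_less [D0_intros]: "(\<And>n. D0 (\<lambda>M e. R n M e)) \<Longrightarrow> D0 (\<lambda>M e. \<exists>n<(k::nat). R n M e)"
proof (induction k)
  case 0
  then show ?case using D0_False by simp
next
  case (Suc k)
  then show ?case using D0_or[OF Suc.IH[OF Suc.prems] Suc.prems[of k]] by (simp add: less_Suc_eq ex_disj_distrib conj_disj_distribR disj_commute)
qed

lemma D0_opm [D0_intros]: "D0 (\<lambda>M e. opm M n (e i) (e j) (e k) (e l) (e m))"
  unfolding opm_def by (intro D0_intros)

lemma D0_opr [D0_intros]: "D0 (\<lambda>M e. opr M n (e i) (e j) (e k) (e l) (e m))"
  unfolding opr_def by (intro D0_intros)

lemma D0_tag [D0_intros]: "D0 (\<lambda>(M :: 'a eps_struct) e. e i = tag M n)"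
proof (induction n arbitrary: i)
  case 0
  then show ?case using D0_emp by (simp add: tag_def)
next
  case (Suc n)
  have "D0 (\<lambda>(M :: 'a eps_struct) e. \<exists>z. uin M z (e i) \<and> (\<exists>t. uin M t (e i) \<and> z = emp M \<and> t = tag M n \<and> e i = prd M z t))"
    by (intro D0_intros Suc.IH)
  then show ?case
  proof (rule D0_iff)
    fix M :: "'a eps_struct" and e :: "nat \<Rightarrow> 'a"
    assume M: "kpp M"
    interpret kpp M by fact
    have "tup M xs \<in> univ M" if "set xs \<subseteq> univ M" for xs using that by (induction xs) auto
    then have "tag M n \<in> univ M" unfolding tag_def by (auto simp: set_replicate_conv_if)
    then show "(\<exists>z. uin M z (e i) \<and> (\<exists>t. uin M t (e i) \<and> z = emp M \<and> t = tag M n \<and> e i = prd M z t)) \<longleftrightarrow>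
        e i = tag M (Suc n)"
      using uin_prd[of "emp M" "tag M n"] unfolding tag_def by auto
  qed
qed

text \<open>A partial truth definition is a set \<open>W\<close> of pairs of a code and a relation, each of which arises by
  the clause for its code from other pairs in \<open>W\<close>. The condition is positive in \<open>W\<close>, so unions of
  partial truth definitions are partial truth definitions; on codes of actual terms they all agree.\<close>

definition justified :: "'a eps_struct \<Rightarrow> 'a \<Rightarrow> 'a \<Rightarrow> 'a \<Rightarrow> 'a \<Rightarrow> bool" where
  "justified M T W q X \<longleftrightarrow>
    (q = emp M \<and> (\<forall>e. ein M e X \<longrightarrow> e = emp M) \<and> (\<exists>e. ein M e X \<and> e = emp M)) \<or>
    (\<exists>wf. ein M wf W \<and> (\<exists>f. uin M f wf \<and> (\<exists>F. uin M F wf \<and> wf = prd M f F \<and>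
    (\<exists>wp. ein M wp W \<and> (\<exists>p. uin M p wp \<and> (\<exists>P. uin M P wp \<and> wp = prd M p P \<and>
    (\<exists>wr. ein M wr W \<and> (\<exists>r. uin M r wr \<and> (\<exists>R. uin M R wr \<and> wr = prd M r R \<and>
      (\<exists>n<5. (\<exists>t. uin M t q \<and> (\<exists>h. uin M h q \<and> (\<exists>k. uin M k h \<and>
        t = tag M n \<and> k = prd M p r \<and> h = prd M f k \<and> q = prd M t h))) \<and> opr M n T F P R X))))))))))"

definition correct :: "'a eps_struct \<Rightarrow> 'a \<Rightarrow> 'a \<Rightarrow> bool" where
  "correct M T W \<longleftrightarrow> (\<forall>w. ein M w W \<longrightarrow>
     (\<exists>q. uin M q w \<and> (\<exists>X. uin M X w \<and> w = prd M q X \<and> justified M T W q X)))"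

text \<open>The last entry of the tuple, the empty set, stands for all further variables of a formula.\<close>

definition tup4 :: "'a eps_struct \<Rightarrow> 'a \<Rightarrow> 'a \<Rightarrow> 'a \<Rightarrow> 'a \<Rightarrow> 'a \<Rightarrow> bool" where
  "tup4 M T e x s a \<longleftrightarrow> (\<exists>z. ein M z T \<and> z = emp M \<and>
     (\<exists>h1. uin M h1 e \<and> (\<exists>h2. uin M h2 h1 \<and> (\<exists>h3. uin M h3 h2 \<and>
       h3 = prd M z z \<and> h2 = prd M a h3 \<and> h1 = prd M s h2 \<and> e = prd M x h1))))"

definition holds :: "'a eps_struct \<Rightarrow> 'a \<Rightarrow> 'a \<Rightarrow> 'a \<Rightarrow> 'a \<Rightarrow> 'a \<Rightarrow> bool" where
  "holds M T W c s a \<longleftrightarrow> tran M T \<and> stran M T \<and> ein M s T \<and> ein M a T \<and> correct M T W \<and>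
     (\<exists>w. ein M w W \<and> (\<exists>X. uin M X w \<and> w = prd M c X \<and>
     (\<exists>e. ein M e X \<and> (\<exists>x. ein M x T \<and> tup4 M T e x s a))))"

text \<open>The universal formula: \<open>d\<close> is the pair of the code of a formula and a parameter \<open>s\<close>, and \<open>v\<close> contains
  a set \<open>T\<close> with a partial truth definition for it, according to which the formula holds of some \<open>x\<close> in
  \<open>T\<close>, of \<open>s\<close> and of \<open>a\<close>. With \<open>T\<close> closed under elements and subsets, truth in \<open>T\<close> is truth in the
  model for bounded formulae. The relation is monotone in \<open>v\<close>, which makes witnesses easy to collect.\<close>

definition Psi :: "'a eps_struct \<Rightarrow> 'a \<Rightarrow> 'a \<Rightarrow> 'a \<Rightarrow> bool" where
  "Psi M v d a \<longleftrightarrow> (\<exists>T. ein M T v \<and> (\<exists>W. ein M W v \<and> (\<exists>c. uin M c d \<and> (\<exists>s. uin M s d \<and>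
     d = prd M c s \<and> holds M T W c s a))))"

lemma D0_justified [D0_intros]: "D0 (\<lambda>M e. justified M (e i) (e j) (e k) (e l))"
  unfolding justified_def by (intro D0_intros)

lemma D0_correct [D0_intros]: "D0 (\<lambda>M e. correct M (e i) (e j))"
  unfolding correct_def by (intro D0_intros)

lemma D0_tup4 [D0_intros]: "D0 (\<lambda>M e. tup4 M (e i) (e j) (e k) (e l) (e m))"
  unfolding tup4_def by (intro D0_intros)

lemma D0_holds [D0_intros]: "D0 (\<lambda>M e. holds M (e i) (e j) (e k) (e l) (e m))"
  unfolding holds_def by (intro D0_intros)

lemma D0_Psi [D0_intros]: "D0 (\<lambda>M e. Psi M (e i) (e j) (e k))"
  unfolding Psi_def by (intro D0_intros)

context kpp
begin

lemma tup_in: "set xs \<subseteq> U \<Longrightarrow> tup M xs \<in> U"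
  by (induction xs) auto

lemma tup_inj: "set xs \<subseteq> U \<Longrightarrow> set ys \<subseteq> U \<Longrightarrow> tup M xs = tup M ys \<Longrightarrow> xs = ys"
proof (induction xs arbitrary: ys)
  case Nil
  then show ?case using prd_not_emp[OF _ tup_in] by (cases ys) force+
next
  case (Cons x xs)
  then obtain y zs where y: "ys = y # zs" using prd_not_emp[OF _ tup_in, of x xs] by (cases ys) auto
  then have "x = y \<and> tup M xs = tup M zs"
    using prd_inj[of x "tup M xs" y "tup M zs"] Cons.prems tup_in by auto
  then show ?case using Cons y by auto
qed

lemma tag_in [simp]: "tag M n \<in> U"
  unfolding tag_def by (rule tup_in) auto

lemma tag_inj: "tag M n = tag M m \<Longrightarrow> n = m"
proof -
  assume "tag M n = tag M m"
  then have "replicate n (emp M) = replicate m (emp M)"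
    unfolding tag_def by (intro tup_inj) auto
  then show "n = m" by (metis length_replicate)
qed

lemma code_in [simp]: "code M t \<in> U"
  by (induction t) auto

lemma opm_iff:
  assumes "e \<in> U"
  shows "opm M n T F P R e \<longleftrightarrow>
    (if n = 0 then (\<exists>x l. x \<epsilon> T \<and> l \<epsilon> F \<and> e = prd M x l)
     else if n = 4 then e \<epsilon> F \<and> \<not> (\<exists>x. x \<epsilon> T \<and> prd M x e \<epsilon> P \<and> prd M x e \<epsilon> R)
     else (\<exists>x y l. x \<epsilon> T \<and> y \<epsilon> T \<and> l \<epsilon> F \<and> e = prd M x (prd M y l) \<and>
       (if n = 1 then prd M x l \<epsilon> P else if n = 2 then x \<epsilon> y else y \<epsilon> x)))"
proof -
  have "(\<exists>h. uin M h e \<and> h = prd M y l \<and> e = prd M x h \<and> Q) \<longleftrightarrow> e = prd M x (prd M y l) \<and> Q"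
    if "x \<epsilon> T" "y \<epsilon> T" "l \<epsilon> F" for x y l Q
    using uin_prd2[of x "prd M y l"] prd_in[of y l] that by blast
  then have "(\<exists>x. x \<epsilon> T \<and> (\<exists>y. y \<epsilon> T \<and> (\<exists>l. l \<epsilon> F \<and> (\<exists>h. uin M h e \<and>
       h = prd M y l \<and> e = prd M x h \<and> Q x y l)))) \<longleftrightarrow>
     (\<exists>x y l. x \<epsilon> T \<and> y \<epsilon> T \<and> l \<epsilon> F \<and> e = prd M x (prd M y l) \<and> Q x y l)" for Q
    by metis
  then show ?thesis unfolding opm_def by auto
qed

lemma opr_iff:
  assumes U: "T \<in> U" "F \<in> U" "P \<in> U" "R \<in> U" "X \<in> U"
  shows "opr M n T F P R X \<longleftrightarrow> (\<forall>e. e \<epsilon> X \<longleftrightarrow> e \<in> U \<and> opm M n T F P R e)"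
proof -
  have conv: "(if n = 0 then (\<forall>x. x \<epsilon> T \<longrightarrow> (\<forall>l. l \<epsilon> F \<longrightarrow> (\<exists>e. e \<epsilon> X \<and> e = prd M x l)))
     else if n = 4 then (\<forall>l. l \<epsilon> F \<longrightarrow>
       \<not> (\<exists>x. x \<epsilon> T \<and> (\<exists>g. g \<epsilon> P \<and> g = prd M x l \<and> g \<epsilon> R)) \<longrightarrow> l \<epsilon> X)
     else (\<forall>x. x \<epsilon> T \<longrightarrow> (\<forall>y. y \<epsilon> T \<longrightarrow> (\<forall>l. l \<epsilon> F \<longrightarrow>
       (if n = 1 then \<exists>g. g \<epsilon> P \<and> g = prd M x l else if n = 2 then x \<epsilon> y else y \<epsilon> x) \<longrightarrow>
       (\<exists>e. e \<epsilon> X \<and> (\<exists>h. uin M h e \<and> h = prd M y l \<and> e = prd M x h)))))) \<longleftrightarrow>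
     (\<forall>e \<in> U. opm M n T F P R e \<longrightarrow> e \<epsilon> X)"
  proof -
    have "(\<exists>e. e \<epsilon> X \<and> (\<exists>h. uin M h e \<and> h = prd M y l \<and> e = prd M x h)) \<longleftrightarrow>
        prd M x (prd M y l) \<epsilon> X"
      if "x \<epsilon> T" "y \<epsilon> T" "l \<epsilon> F" for x y l
      using uin_prd2[of x "prd M y l"] prd_in[of y l] that by blast
    then have 3: "(\<forall>x. x \<epsilon> T \<longrightarrow> (\<forall>y. y \<epsilon> T \<longrightarrow> (\<forall>l. l \<epsilon> F \<longrightarrow> Q x y l \<longrightarrow>
       (\<exists>e. e \<epsilon> X \<and> (\<exists>h. uin M h e \<and> h = prd M y l \<and> e = prd M x h))))) \<longleftrightarrow>
      (\<forall>e \<in> U. (\<exists>x y l. x \<epsilon> T \<and> y \<epsilon> T \<and> l \<epsilon> F \<and> e = prd M x (prd M y l) \<and> Q x y l) \<longrightarrow> e \<epsilon> X)" for Q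
      by (metis einU prd_in)
    have 1: "(\<forall>x. x \<epsilon> T \<longrightarrow> (\<forall>l. l \<epsilon> F \<longrightarrow> (\<exists>e. e \<epsilon> X \<and> e = prd M x l))) \<longleftrightarrow>
      (\<forall>e \<in> U. (\<exists>x l. x \<epsilon> T \<and> l \<epsilon> F \<and> e = prd M x l) \<longrightarrow> e \<epsilon> X)" by (metis einU prd_in)
    have 2: "(\<forall>l. l \<epsilon> F \<longrightarrow> \<not> (\<exists>x. x \<epsilon> T \<and> (\<exists>g. g \<epsilon> P \<and> g = prd M x l \<and> g \<epsilon> R)) \<longrightarrow> l \<epsilon> X) \<longleftrightarrow>
      (\<forall>e \<in> U. e \<epsilon> F \<and> \<not> (\<exists>x. x \<epsilon> T \<and> prd M x e \<epsilon> P \<and> prd M x e \<epsilon> R) \<longrightarrow> e \<epsilon> X)" by (metis einU)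
    have g: "(\<exists>g. g \<epsilon> P \<and> g = prd M x l) \<longleftrightarrow> prd M x l \<epsilon> P" for x l by blast
    show ?thesis
      using 1 2 3[of "\<lambda>x y l. if n = 1 then prd M x l \<epsilon> P else if n = 2 then x \<epsilon> y else y \<epsilon> x"]
      unfolding g by (cases "n = 0"; cases "n = 4") (simp_all add: opm_iff)
  qed
  show ?thesis unfolding opr_def conv by blast
qed

lemma justified_iff:
  assumes U: "T \<in> U" "q \<in> U" "X \<in> U"
  shows "justified M T W q X \<longleftrightarrow> (q = emp M \<and> (\<forall>e. e \<epsilon> X \<longleftrightarrow> e = emp M)) \<or>
    (\<exists>n f p r F P R. n < 5 \<and> f \<in> U \<and> p \<in> U \<and> r \<in> U \<and> F \<in> U \<and> P \<in> U \<and> R \<in> U \<and>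
      prd M f F \<epsilon> W \<and> prd M p P \<epsilon> W \<and> prd M r R \<epsilon> W \<and>
      q = prd M (tag M n) (prd M f (prd M p r)) \<and> (\<forall>e. e \<epsilon> X \<longleftrightarrow> e \<in> U \<and> opm M n T F P R e))"
    (is "_ \<longleftrightarrow> ?B \<or> ?S")
proof
  assume "justified M T W q X"
  then consider "q = emp M" "\<forall>e. e \<epsilon> X \<longrightarrow> e = emp M" "\<exists>e. e \<epsilon> X \<and> e = emp M"
    | f F p P r R n where "prd M f F \<epsilon> W" "uin M f (prd M f F)" "uin M F (prd M f F)"
      "prd M p P \<epsilon> W" "uin M p (prd M p P)" "uin M P (prd M p P)"
      "prd M r R \<epsilon> W" "uin M r (prd M r R)" "uin M R (prd M r R)"
      "n < 5" "q = prd M (tag M n) (prd M f (prd M p r))" "opr M n T F P R X"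
    unfolding justified_def by blast
  then show "?B \<or> ?S"
  proof cases
    case 1
    then show ?thesis by blast
  next
    case 2
    then have "f \<in> U" "F \<in> U" "p \<in> U" "P \<in> U" "r \<in> U" "R \<in> U" unfolding uin_def by auto
    then show ?thesis using 2 opr_iff[of T F P R X n] U by metis
  qed
next
  assume "?B \<or> ?S"
  then show "justified M T W q X"
  proof
    assume ?B
    then show ?thesis unfolding justified_def by auto
  next
    assume ?S
    then obtain n f p r F P R where *: "n < 5" "f \<in> U" "p \<in> U" "r \<in> U" "F \<in> U" "P \<in> U" "R \<in> U"
      "prd M f F \<epsilon> W" "prd M p P \<epsilon> W" "prd M r R \<epsilon> W"
      "q = prd M (tag M n) (prd M f (prd M p r))" "\<forall>e. e \<epsilon> X \<longleftrightarrow> e \<in> U \<and> opm M n T F P R e" by auto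
    have o: "opr M n T F P R X" using opr_iff[of T F P R X n] * U by blast
    have u: "uin M (tag M n) q" "uin M (prd M f (prd M p r)) q" "uin M (prd M p r) (prd M f (prd M p r))"
      using * uin_prd by simp_all
    have "\<exists>n<5. (\<exists>t. uin M t q \<and> (\<exists>h. uin M h q \<and> (\<exists>k. uin M k h \<and>
        t = tag M n \<and> k = prd M p r \<and> h = prd M f k \<and> q = prd M t h))) \<and> opr M n T F P R X"
      using o u *(1,11) by blast
    then show ?thesis
      unfolding justified_def using *(8-10) uin_prd[OF *(2,5)] uin_prd[OF *(3,6)] uin_prd[OF *(4,7)] by auto
  qed
qed

lemma justified_mono:
  assumes "T \<in> U" "q \<in> U" "X \<in> U" "justified M T W q X" "\<And>w. w \<epsilon> W \<Longrightarrow> w \<epsilon> W'"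
  shows "justified M T W' q X"
  using assms(4,5) unfolding justified_iff[OF assms(1-3)] by metis

lemma correct_iff:
  "correct M T W \<longleftrightarrow> (\<forall>w. w \<epsilon> W \<longrightarrow> (\<exists>q \<in> U. \<exists>X \<in> U. w = prd M q X \<and> justified M T W q X))"
proof -
  have "(\<exists>q. uin M q w \<and> (\<exists>X. uin M X w \<and> w = prd M q X \<and> Q q X)) \<longleftrightarrow>
    (\<exists>q \<in> U. \<exists>X \<in> U. w = prd M q X \<and> Q q X)" for w Q
  proof
    assume "\<exists>q. uin M q w \<and> (\<exists>X. uin M X w \<and> w = prd M q X \<and> Q q X)"
    then obtain q X where *: "uin M q w" "uin M X w" "w = prd M q X" "Q q X" by blast
    then have "q \<in> U" "X \<in> U" unfolding uin_def by auto
    then show "\<exists>q \<in> U. \<exists>X \<in> U. w = prd M q X \<and> Q q X" using *(3,4) by auto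
  next
    assume "\<exists>q \<in> U. \<exists>X \<in> U. w = prd M q X \<and> Q q X"
    then obtain q X where *: "q \<in> U" "X \<in> U" "w = prd M q X" "Q q X" by auto
    then show "\<exists>q. uin M q w \<and> (\<exists>X. uin M X w \<and> w = prd M q X \<and> Q q X)"
      using uin_prd[OF *(1,2)] by auto
  qed
  then show ?thesis unfolding correct_def by simp
qed

lemma ev_elems: "l \<in> ev M T t \<Longrightarrow> x \<in> set l \<Longrightarrow> x \<epsilon> T"
proof (induction t arbitrary: l x)
  case (Op n f p r)
  then show ?case by (auto split: if_splits)
qed simp

lemma ev_U: "l \<in> ev M T t \<Longrightarrow> set l \<subseteq> U"
  using ev_elems by blast

lemma tup_ev_iff:
  assumes "set l \<subseteq> U"
  shows "(\<exists>l' \<in> ev M T t. tup M l = tup M l') \<longleftrightarrow> l \<in> ev M T t"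
  using tup_inj[OF assms ev_U] by blast

lemma opm_ev:
  assumes F: "\<And>e. e \<epsilon> F \<longleftrightarrow> (\<exists>l \<in> ev M T f. e = tup M l)"
    and P: "\<And>e. e \<epsilon> P \<longleftrightarrow> (\<exists>l \<in> ev M T p. e = tup M l)"
    and R: "\<And>e. e \<epsilon> R \<longleftrightarrow> (\<exists>l \<in> ev M T r. e = tup M l)"
  shows "e \<in> U \<and> opm M n T F P R e \<longleftrightarrow> (\<exists>l \<in> ev M T (Op n f p r). e = tup M l)"
proof -
  have P': "prd M x (tup M l) \<epsilon> P \<longleftrightarrow> x # l \<in> ev M T p" if "x \<epsilon> T" "l \<in> ev M T f" for x l
    using tup_ev_iff[of "x # l" T p] that ev_U[OF that(2)] unfolding P by auto
  have R': "prd M x (tup M l) \<epsilon> R \<longleftrightarrow> x # l \<in> ev M T r" if "x \<epsilon> T" "l \<in> ev M T f" for x l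
    using tup_ev_iff[of "x # l" T r] that ev_U[OF that(2)] unfolding R by auto
  have tU: "tup M l \<in> U" if "l \<in> ev M T t" for l t using tup_in ev_U that by blast
  consider "n = 0" | "n = 4" | "n \<noteq> 0" "n \<noteq> 4" by blast
  then show ?thesis
  proof cases
    case 1
    have "opm M n T F P R e \<longleftrightarrow> (\<exists>x l. x \<epsilon> T \<and> l \<in> ev M T f \<and> e = prd M x (tup M l))"
      if "e \<in> U"
      unfolding opm_iff[OF that] F using 1 by auto
    moreover have "prd M x (tup M l) \<in> U" if "x \<epsilon> T" "l \<in> ev M T f" for x l
      using that tU by auto
    ultimately have "e \<in> U \<and> opm M n T F P R e \<longleftrightarrow> (\<exists>x l. x \<epsilon> T \<and> l \<in> ev M T f \<and> e = prd M x (tup M l))"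
      by blast
    also have "\<dots> \<longleftrightarrow> (\<exists>l \<in> ev M T (Op n f p r). e = tup M l)" using 1 by force
    finally show ?thesis .
  next
    case 2
    have "opm M n T F P R e \<longleftrightarrow> (\<exists>l \<in> ev M T f. e = tup M l \<and>
        \<not> (\<exists>x. x \<epsilon> T \<and> prd M x e \<epsilon> P \<and> prd M x e \<epsilon> R))" if "e \<in> U"
      unfolding opm_iff[OF that] F using 2 by auto
    then have "e \<in> U \<and> opm M n T F P R e \<longleftrightarrow> (\<exists>l \<in> ev M T f. e = tup M l \<and>
        \<not> (\<exists>x. x \<epsilon> T \<and> prd M x e \<epsilon> P \<and> prd M x e \<epsilon> R))"
      using tU by blast
    also have "\<dots> \<longleftrightarrow> (\<exists>l \<in> ev M T f. e = tup M l \<and>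
        \<not> (\<exists>x. x \<epsilon> T \<and> x # l \<in> ev M T p \<and> x # l \<in> ev M T r))"
      using P' R' by metis
    also have "\<dots> \<longleftrightarrow> (\<exists>l \<in> ev M T (Op n f p r). e = tup M l)" using 2 by auto
    finally show ?thesis .
  next
    case 3
    have "e \<in> U \<and> opm M n T F P R e \<longleftrightarrow> (\<exists>x y l. x \<epsilon> T \<and> y \<epsilon> T \<and> l \<in> ev M T f \<and>
        e = prd M x (prd M y (tup M l)) \<and>
       (if n = 1 then prd M x (tup M l) \<epsilon> P else if n = 2 then x \<epsilon> y else y \<epsilon> x))"
    proof -
      have "e \<in> U" if "x \<epsilon> T" "y \<epsilon> T" "l \<in> ev M T f" "e = prd M x (prd M y (tup M l))" for x y l
        using that tU by (metis einU prd_in)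
      then show ?thesis using 3 opm_iff[of e n T F P R] unfolding F by (simp only: if_False) blast
    qed
    also have "\<dots> \<longleftrightarrow> (\<exists>x y l. x \<epsilon> T \<and> y \<epsilon> T \<and> l \<in> ev M T f \<and>
        e = prd M x (prd M y (tup M l)) \<and>
       (if n = 1 then x # l \<in> ev M T p else if n = 2 then x \<epsilon> y else y \<epsilon> x))"
      by (intro ex_cong1) (use P' in auto)
    also have "\<dots> \<longleftrightarrow> (\<exists>l \<in> ev M T (Op n f p r). e = tup M l)"
    proof
      assume "\<exists>x y l. x \<epsilon> T \<and> y \<epsilon> T \<and> l \<in> ev M T f \<and> e = prd M x (prd M y (tup M l)) \<and>
       (if n = 1 then x # l \<in> ev M T p else if n = 2 then x \<epsilon> y else y \<epsilon> x)"
      then obtain x y l where *: "x \<epsilon> T" "y \<epsilon> T" "l \<in> ev M T f" "e = prd M x (prd M y (tup M l))"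
       "if n = 1 then x # l \<in> ev M T p else if n = 2 then x \<epsilon> y else y \<epsilon> x" by blast
      then have "x # y # l \<in> ev M T (Op n f p r)" using 3 by simp
      then show "\<exists>l \<in> ev M T (Op n f p r). e = tup M l" using *(4) by (intro bexI[of _ "x # y # l"]) simp_all
    next
      assume "\<exists>l \<in> ev M T (Op n f p r). e = tup M l"
      then obtain l' where l': "l' \<in> ev M T (Op n f p r)" "e = tup M l'" by blast
      then obtain x y l where "l' = x # y # l" "x \<epsilon> T" "y \<epsilon> T" "l \<in> ev M T f"
        "if n = 1 then x # l \<in> ev M T p else if n = 2 then x \<epsilon> y else y \<epsilon> x" using 3 by auto
      then show "\<exists>x y l. x \<epsilon> T \<and> y \<epsilon> T \<and> l \<in> ev M T f \<and> e = prd M x (prd M y (tup M l)) \<and>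
       (if n = 1 then x # l \<in> ev M T p else if n = 2 then x \<epsilon> y else y \<epsilon> x)"
        using l'(2) by (intro exI[of _ x] exI[of _ y] exI[of _ l]) simp
    qed
    finally show ?thesis .
  qed
qed

text \<open>Tags and codes are injective, so the clause that justifies a pair is the one for its term; the rest
  is induction on the term outside the model.\<close>

lemma correct_ev:
  assumes T: "T \<in> U" and W: "correct M T W"
  shows "X \<in> U \<Longrightarrow> prd M (code M t) X \<epsilon> W \<Longrightarrow> e \<epsilon> X \<longleftrightarrow> (\<exists>l \<in> ev M T t. e = tup M l)"
proof (induction t arbitrary: X e)
  case One
  then have "justified M T W (emp M) X" using W prd_inj[of "emp M" X] unfolding correct_iff by force
  then have "\<forall>e. e \<epsilon> X \<longleftrightarrow> e = emp M"
    using prd_not_emp One(1) unfolding justified_iff[OF T emp_in One(1)] by (metis prd_in tag_in)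
  then show ?case by simp
next
  case (Op n f p r)
  let ?q = "code M (Op n f p r)"
  obtain q' X' where "q' \<in> U" "X' \<in> U" "prd M ?q X = prd M q' X'" "justified M T W q' X'"
    using W Op.prems(2) unfolding correct_iff by blast
  then have "justified M T W ?q X" using prd_inj[of ?q X q' X'] Op.prems(1) code_in by metis
  moreover have "?q \<noteq> emp M" using prd_not_emp by simp
  ultimately obtain n' f' p' r' F P R where *: "n' < 5" "f' \<in> U" "p' \<in> U" "r' \<in> U" "F \<in> U" "P \<in> U" "R \<in> U"
      "prd M f' F \<epsilon> W" "prd M p' P \<epsilon> W" "prd M r' R \<epsilon> W"
      "?q = prd M (tag M n') (prd M f' (prd M p' r'))" "\<forall>e. e \<epsilon> X \<longleftrightarrow> e \<in> U \<and> opm M n' T F P R e"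
    unfolding justified_iff[OF T code_in Op.prems(1)] by auto
  have "tag M n = tag M n'" and eq: "f' = code M f" "p' = code M p" "r' = code M r"
    using *(11) *(2-4) by simp_all
  then have n: "n' = n" using tag_inj by metis
  show ?case
    unfolding *(12)[rule_format] n
  proof (rule opm_ev)
    show "\<And>e. e \<epsilon> F \<longleftrightarrow> (\<exists>l \<in> ev M T f. e = tup M l)" using Op.IH(1) * eq by simp
    show "\<And>e. e \<epsilon> P \<longleftrightarrow> (\<exists>l \<in> ev M T p. e = tup M l)" using Op.IH(2) * eq by simp
    show "\<And>e. e \<epsilon> R \<longleftrightarrow> (\<exists>l \<in> ev M T r. e = tup M l)" using Op.IH(3) * eq by simp
  qed
qed

lemma op_exists:
  assumes U: "T \<in> U" "F \<in> U" "P \<in> U" "R \<in> U"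
  shows "\<exists>X \<in> U. \<forall>e. e \<epsilon> X \<longleftrightarrow> e \<in> U \<and> opm M n T F P R e"
proof -
  obtain l1 l2 where l: "lvl M l1" "T \<epsilon> l1" "lvl M l2" "F \<epsilon> l2" using in_lvl_exists U by meson
  obtain l0 where l0: "lvl M l0" "T \<epsilon> l0" "F \<epsilon> l0"
    using lvl_linear[OF l(1,3)] l lvl_tran by metis
  obtain k1 where k1: "lvl M k1" "sbs M l0 k1" "\<forall>x y. x \<epsilon> l0 \<longrightarrow> y \<epsilon> l0 \<longrightarrow> prd M x y \<epsilon> k1"
    using pair_lvl[OF l0(1)] by blast
  obtain k2 where k2: "lvl M k2" "sbs M k1 k2" "\<forall>x y. x \<epsilon> k1 \<longrightarrow> y \<epsilon> k1 \<longrightarrow> prd M x y \<epsilon> k2"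
    using pair_lvl[OF k1(1)] by blast
  have T0: "x \<epsilon> l0" if "x \<epsilon> T" for x using lvl_tran[OF l0(1) l0(2)] that .
  have F0: "x \<epsilon> l0" if "x \<epsilon> F" for x using lvl_tran[OF l0(1) l0(3)] that .
  \<comment> \<open>All possible results of an operation lie within two pairing steps of \<open>T\<close> and \<open>F\<close>.\<close>
  have b: "e \<epsilon> k2" if "e \<in> U" "opm M n T F P R e" for e
    using that(2) unfolding opm_iff[OF that(1)]
    using T0 F0 k1(3) k2(3) sbsD[OF k1(2)] sbsD[OF k2(2)] by (auto split: if_splits)
  have "D0 (\<lambda>M e. opm M n (e 1) (e 2) (e 3) (e 4) (e 0))"
    by (intro D0_intros)
  from separation[OF this, of "T ## F ## P ## (\<lambda>_. R)" k2] U lvl_in[OF k2(1)] obtain X where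
    X: "X \<in> U" "\<forall>e. e \<epsilon> X \<longleftrightarrow> e \<epsilon> k2 \<and> opm M n T F P R e" by (auto simp: range_push)
  then have "\<forall>e. e \<epsilon> X \<longleftrightarrow> e \<in> U \<and> opm M n T F P R e" using b by blast
  then show ?thesis using X by blast
qed

lemma correct_un:
  assumes "T \<in> U" "correct M T V" "correct M T W" "Z \<in> U" "\<forall>w. w \<epsilon> Z \<longleftrightarrow> w \<epsilon> V \<or> w \<epsilon> W"
  shows "correct M T Z"
  unfolding correct_iff
proof (intro allI impI)
  fix w assume "w \<epsilon> Z"
  then have "w \<epsilon> V \<or> w \<epsilon> W" using assms(5) by metis
  then obtain q X where "q \<in> U" "X \<in> U" "w = prd M q X" "justified M T V q X \<or> justified M T W q X"
    using assms(2,3) unfolding correct_iff by metis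
  then show "\<exists>q\<in>U. \<exists>X\<in>U. w = prd M q X \<and> justified M T Z q X"
    using justified_mono[of T q X V Z] justified_mono[of T q X W Z] assms(1,5) by metis
qed

lemma correct_exists:
  assumes T: "T \<in> U"
  shows "wf_tm t \<Longrightarrow> \<exists>W \<in> U. \<exists>X \<in> U. correct M T W \<and> prd M (code M t) X \<epsilon> W"
proof (induction t)
  case One
  obtain X where X: "X \<in> U" "\<forall>w. w \<epsilon> X \<longleftrightarrow> w = emp M \<or> w \<epsilon> emp M"
    using insert_exists[OF emp_in emp_in] by metis
  obtain W where W: "W \<in> U" "\<forall>w. w \<epsilon> W \<longleftrightarrow> w = prd M (emp M) X \<or> w \<epsilon> emp M"
    using insert_exists[OF prd_in[OF emp_in X(1)] emp_in] by metis
  have "justified M T W (emp M) X" unfolding justified_iff[OF T emp_in X(1)] using X(2) by simp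
  then have "correct M T W" unfolding correct_iff using W(2) X(1) emp_in emp_empty by metis
  then show ?case using W X(1) by auto
next
  case (Op n f p r)
  then obtain Wf F Wp P Wr R where
    f: "Wf \<in> U" "F \<in> U" "correct M T Wf" "prd M (code M f) F \<epsilon> Wf" and
    p: "Wp \<in> U" "P \<in> U" "correct M T Wp" "prd M (code M p) P \<epsilon> Wp" and
    r: "Wr \<in> U" "R \<in> U" "correct M T Wr" "prd M (code M r) R \<epsilon> Wr" by auto
  obtain V where V: "V \<in> U" "\<forall>w. w \<epsilon> V \<longleftrightarrow> w \<epsilon> Wf \<or> w \<epsilon> Wp" using un_exists[OF f(1) p(1)] by metis
  obtain Z where Z: "Z \<in> U" "\<forall>w. w \<epsilon> Z \<longleftrightarrow> w \<epsilon> V \<or> w \<epsilon> Wr" using un_exists[OF V(1) r(1)] by metis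
  have "correct M T Z" using correct_un T f(3) p(3) r(3) V Z by metis
  obtain X where X: "X \<in> U" "\<forall>e. e \<epsilon> X \<longleftrightarrow> e \<in> U \<and> opm M n T F P R e"
    using op_exists[OF T f(2) p(2) r(2)] by metis
  let ?q = "code M (Op n f p r)"
  obtain W where W: "W \<in> U" "\<forall>w. w \<epsilon> W \<longleftrightarrow> w = prd M ?q X \<or> w \<epsilon> Z"
    using insert_exists[OF prd_in[OF code_in X(1)] Z(1)] by metis
  have "prd M (code M f) F \<epsilon> W" "prd M (code M p) P \<epsilon> W" "prd M (code M r) R \<epsilon> W"
    using f p r V(2) Z(2) W(2) by metis+
  then have "justified M T W ?q X"
    unfolding justified_iff[OF T code_in X(1)] using Op.prems X(2) f(2) p(2) r(2)
    by (intro disjI2 exI[of _ n] exI[of _ "code M f"] exI[of _ "code M p"] exI[of _ "code M r"]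
        exI[of _ F] exI[of _ P] exI[of _ R]) simp
  moreover have "\<exists>q \<in> U. \<exists>X \<in> U. w = prd M q X \<and> justified M T W q X" if "w \<epsilon> Z" for w
    using \<open>correct M T Z\<close> that justified_mono[OF T, of _ _ Z W] W(2) unfolding correct_iff by metis
  ultimately have "correct M T W" unfolding correct_iff using W(2) X(1) code_in by metis
  then show ?case using W X(1) by auto
qed

lemma tup4_iff:
  assumes U: "x \<in> U" "s \<in> U" "a \<in> U"
  shows "tup4 M T e x s a \<longleftrightarrow> emp M \<epsilon> T \<and> e = tup M [x, s, a, emp M]"
proof
  assume "tup4 M T e x s a"
  then show "emp M \<epsilon> T \<and> e = tup M [x, s, a, emp M]" unfolding tup4_def by auto
next
  assume *: "emp M \<epsilon> T \<and> e = tup M [x, s, a, emp M]"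
  let ?h3 = "prd M (emp M) (emp M)" let ?h2 = "prd M a ?h3" let ?h1 = "prd M s ?h2"
  have "uin M ?h1 e" "uin M ?h2 ?h1" "uin M ?h3 ?h2"
    using * U uin_prd2 by simp_all
  then show "tup4 M T e x s a"
    unfolding tup4_def using * by (intro exI[of _ "emp M"] conjI exI[of _ ?h1] exI[of _ ?h2] exI[of _ ?h3]) simp_all
qed

lemma holds_iff:
  assumes U: "c \<in> U"
  shows "holds M T W c s a \<longleftrightarrow> tran M T \<and> stran M T \<and> emp M \<epsilon> T \<and> s \<epsilon> T \<and> a \<epsilon> T \<and> correct M T W \<and>
    (\<exists>X x. x \<epsilon> T \<and> X \<in> U \<and> prd M c X \<epsilon> W \<and> tup M [x, s, a, emp M] \<epsilon> X)" (is "_ \<longleftrightarrow> ?R")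
proof
  assume "holds M T W c s a"
  then obtain X e x where *: "tran M T" "stran M T" "s \<epsilon> T" "a \<epsilon> T" "correct M T W"
    "prd M c X \<epsilon> W" "uin M X (prd M c X)" "e \<epsilon> X" "x \<epsilon> T" "tup4 M T e x s a"
    unfolding holds_def by auto
  have "x \<in> U" "s \<in> U" "a \<in> U" using *(3,4,9) by auto
  then have "emp M \<epsilon> T" "e = tup M [x, s, a, emp M]" using *(10) tup4_iff by auto
  moreover have "X \<in> U" using *(7) unfolding uin_def by auto
  ultimately show ?R using * by auto
next
  assume ?R
  then obtain X x where *: "tran M T" "stran M T" "emp M \<epsilon> T" "s \<epsilon> T" "a \<epsilon> T" "correct M T W"
    "x \<epsilon> T" "X \<in> U" "prd M c X \<epsilon> W" "tup M [x, s, a, emp M] \<epsilon> X" by auto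
  have "x \<in> U" "s \<in> U" "a \<in> U" using *(4,5,7) by auto
  then have "tup4 M T (tup M [x, s, a, emp M]) x s a" using *(3) tup4_iff by blast
  then show "holds M T W c s a"
    unfolding holds_def using * uin_prd2[OF U *(8)] by blast
qed

lemma Psi_iff:
  assumes c: "c \<in> U" and s: "s \<in> U"
  shows "Psi M v (prd M c s) a \<longleftrightarrow> (\<exists>T W. T \<epsilon> v \<and> W \<epsilon> v \<and> holds M T W c s a)"
proof
  assume "Psi M v (prd M c s) a"
  then obtain T W c' s' where *: "T \<epsilon> v" "W \<epsilon> v" "uin M c' (prd M c s)" "uin M s' (prd M c s)"
    "prd M c s = prd M c' s'" "holds M T W c' s' a"
    unfolding Psi_def by blast
  have "c' \<in> U" "s' \<in> U" using *(3,4) unfolding uin_def by auto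
  then have "c' = c" "s' = s" using prd_inj[OF *(5) c s] by auto
  then show "\<exists>T W. T \<epsilon> v \<and> W \<epsilon> v \<and> holds M T W c s a" using * by blast
next
  assume "\<exists>T W. T \<epsilon> v \<and> W \<epsilon> v \<and> holds M T W c s a"
  then show "Psi M v (prd M c s) a" unfolding Psi_def using uin_prd[OF c s] by blast
qed

end

definition good :: "'a eps_struct \<Rightarrow> 'a \<Rightarrow> bool" where
  "good M T \<longleftrightarrow> kpp M \<and> tran M T \<and> stran M T \<and> ein M (emp M) T"

definition tuples :: "'a eps_struct \<Rightarrow> 'a \<Rightarrow> nat \<Rightarrow> 'a list set" where
  "tuples M T k = {l. length l = k \<and> (\<forall>x \<in> set l. ein M x T)}"

text \<open>A single term has to work for all models, since codes are to mean the same in \<open>M\<close> and in \<open>N\<close>.\<close>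

definition tdef :: "nat \<Rightarrow> ('a eps_struct \<Rightarrow> 'a \<Rightarrow> 'a list \<Rightarrow> bool) \<Rightarrow> bool" where
  "tdef k R \<longleftrightarrow> (\<exists>t. wf_tm t \<and> (\<forall>M T. good M T \<longrightarrow> ev M T t = {l \<in> tuples M T k. R M T l}))"

lemma tdefI:
  assumes "wf_tm t" and "\<And>M T. good M T \<Longrightarrow> ev M T t = {l \<in> tuples M T k. R M T l}"
  shows "tdef k R"
  using assms unfolding tdef_def by blast

lemma tdefE:
  assumes "tdef k R"
  obtains t where "wf_tm t" and "\<And>M T. good M T \<Longrightarrow> ev M T t = {l \<in> tuples M T k. R M T l}"
  using assms unfolding tdef_def by blast

lemma tdef_cong:
  assumes "tdef k R" and "\<And>M T l. good M T \<Longrightarrow> l \<in> tuples M T k \<Longrightarrow> R M T l \<longleftrightarrow> Q M T l"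
  shows "tdef k Q"
  using assms(1)
proof (rule tdefE)
  fix t assume t: "wf_tm t" "\<And>M T. good M T \<Longrightarrow> ev M T t = {l \<in> tuples M T k. R M T l}"
  show ?thesis
    by (rule tdefI[OF t(1)]) (use t(2) assms(2) in auto)
qed

lemma tuples_Suc: "l \<in> tuples M T (Suc k) \<longleftrightarrow> (\<exists>x l'. l = x # l' \<and> ein M x T \<and> l' \<in> tuples M T k)"
  unfolding tuples_def by (cases l) auto

lemma tuples_0: "l \<in> tuples M T 0 \<longleftrightarrow> l = []"
  unfolding tuples_def by auto

lemma tuples_Cons: "x # l \<in> tuples M T (Suc k) \<longleftrightarrow> ein M x T \<and> l \<in> tuples M T k"
  unfolding tuples_def by auto

lemma tdef_pad: "tdef k R \<Longrightarrow> tdef (Suc k) (\<lambda>M T l. R M T (tl l))"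
proof (erule tdefE)
  fix t assume t: "wf_tm t" "\<And>M T :: 'a. good M T \<Longrightarrow> ev M T t = {l \<in> tuples M T k. R M T l}"
  show ?thesis
    by (rule tdefI[of "Op 0 t One One"]) (use t in \<open>auto simp: tuples_Suc\<close>)
qed

lemma tdef_True: "tdef k (\<lambda>(M :: 'a eps_struct) T l. True)"
proof (induction k)
  case 0
  show ?case by (rule tdefI[of One]) (auto simp: tuples_0)
next
  case (Suc k)
  then show ?case by (rule tdef_pad)
qed

text \<open>The quantifier of operation 4 is vacuous over the padded terms, as \<open>T\<close> is not empty.\<close>

lemma tdef_nand:
  assumes "tdef k R" "tdef k Q"
  shows "tdef k (\<lambda>(M :: 'a eps_struct) T l. \<not> (R M T l \<and> Q M T l))"
proof -
  obtain f where f: "wf_tm f" "\<And>M T :: 'a. good M T \<Longrightarrow> ev M T f = tuples M T k"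
    using tdef_True by (rule tdefE) auto
  obtain t where t: "wf_tm t" "\<And>M T. good M T \<Longrightarrow> ev M T t = {l \<in> tuples M T k. R M T l}"
    using assms(1) unfolding tdef_def by auto
  obtain u where u: "wf_tm u" "\<And>M T. good M T \<Longrightarrow> ev M T u = {l \<in> tuples M T k. Q M T l}"
    using assms(2) unfolding tdef_def by auto
  show ?thesis
  proof (rule tdefI[of "Op 4 f (Op 0 t One One) (Op 0 u One One)"])
    fix M :: "'a eps_struct" and T assume g: "good M T"
    then have "ein M (emp M) T" unfolding good_def by blast
    then show "ev M T (Op 4 f (Op 0 t One One) (Op 0 u One One)) =
        {l \<in> tuples M T k. \<not> (R M T l \<and> Q M T l)}" using f(2)[OF g] t(2)[OF g] u(2)[OF g] by auto
  qed (use f t u in auto)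
qed

lemma tdef_not: "tdef k R \<Longrightarrow> tdef k (\<lambda>M T l. \<not> R M T l)"
  using tdef_nand[of k R R] by simp

lemma tdef_and: "tdef k R \<Longrightarrow> tdef k Q \<Longrightarrow> tdef k (\<lambda>M T l. R M T l \<and> Q M T l)"
  using tdef_not[OF tdef_nand[of k R Q]] by simp

lemma tdef_or: "tdef k R \<Longrightarrow> tdef k Q \<Longrightarrow> tdef k (\<lambda>M T l. R M T l \<or> Q M T l)"
  using tdef_nand[OF tdef_not[of k R] tdef_not[of k Q]] by simp

lemma tdef_imp: "tdef k R \<Longrightarrow> tdef k Q \<Longrightarrow> tdef k (\<lambda>M T l. R M T l \<longrightarrow> Q M T l)"
  using tdef_nand[OF _ tdef_not[of k Q], of R] by simp

lemma tdef_ex: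
  assumes "tdef (Suc k) R"
  shows "tdef k (\<lambda>(M :: 'a eps_struct) T l. \<exists>x. ein M x T \<and> R M T (x # l))"
proof -
  obtain f where f: "wf_tm f" "\<And>M T :: 'a. good M T \<Longrightarrow> ev M T f = tuples M T k"
    using tdef_True by (rule tdefE) auto
  obtain t where t: "wf_tm t" "\<And>M T. good M T \<Longrightarrow> ev M T t = {l \<in> tuples M T (Suc k). R M T l}"
    using assms unfolding tdef_def by auto
  have "tdef k (\<lambda>M T l. \<not> (\<exists>x. ein M x T \<and> R M T (x # l)))"
    by (rule tdefI[of "Op 4 f t t"]) (use f t in \<open>auto simp: tuples_Cons\<close>)
  then show ?thesis using tdef_not by fastforce
qed

lemma tdef_mem0:
  assumes "Suc j < k"
  shows "tdef k (\<lambda>(M :: 'a eps_struct) T l. ein M (l ! 0) (l ! Suc j))"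
    and "tdef k (\<lambda>(M :: 'a eps_struct) T l. ein M (l ! Suc j) (l ! 0))"
  using assms
proof (induction j arbitrary: k)
  case 0
  { case 1
    then have "k = Suc (Suc (k - 2))" by simp
    then obtain m where m: "k = Suc (Suc m)" ..
    obtain f where f: "wf_tm f" "\<And>M T :: 'a. good M T \<Longrightarrow> ev M T f = tuples M T m"
      using tdef_True by (rule tdefE) auto
    show ?case
      by (rule tdefI[of "Op 2 f One One"]) (use f m in \<open>auto simp: tuples_Suc\<close>)
  next
    case 2
    then have "k = Suc (Suc (k - 2))" by simp
    then obtain m where m: "k = Suc (Suc m)" ..
    obtain f where f: "wf_tm f" "\<And>M T :: 'a. good M T \<Longrightarrow> ev M T f = tuples M T m"
      using tdef_True by (rule tdefE) auto
    show ?case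
      by (rule tdefI[of "Op 3 f One One"]) (use f m in \<open>auto simp: tuples_Suc\<close>) }
next
  case (Suc j)
  have step: "tdef (Suc (Suc m)) (\<lambda>(M :: 'a eps_struct) T l. R M (l ! 0) (l ! Suc (Suc j)))"
    if st: "tdef (Suc m) (\<lambda>(M :: 'a eps_struct) T l. R M (l ! 0) (l ! Suc j))" for m and R
  proof -
    obtain f where f: "wf_tm f" "\<And>M T :: 'a. good M T \<Longrightarrow> ev M T f = tuples M T m"
      using tdef_True by (rule tdefE) auto
    obtain t where t: "wf_tm t"
      "\<And>M T. good M T \<Longrightarrow> ev M T t = {l \<in> tuples M T (Suc m). R M (l ! 0) (l ! Suc j)}"
      using st unfolding tdef_def by auto
    show ?thesis
      by (rule tdefI[of "Op 1 f t One"]) (use f t in \<open>auto simp: tuples_Suc\<close>)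
  qed
  { case 1
    then have "k = Suc (Suc (k - 2))" by simp
    then obtain m where m: "k = Suc (Suc m)" ..
    then show ?case using step[OF Suc.IH(1)[of "Suc m"]] 1 by simp
  next
    case 2
    then have "k = Suc (Suc (k - 2))" by simp
    then obtain m where m: "k = Suc (Suc m)" ..
    then show ?case using step[of m "\<lambda>M x y. ein M y x", OF Suc.IH(2)[of "Suc m"]] 2 by simp }
qed

text \<open>By padding, one of the two positions may be taken to be the first; no set is an element of itself.\<close>

lemma tdef_mem:
  "i < k \<Longrightarrow> j < k \<Longrightarrow> tdef k (\<lambda>(M :: 'a eps_struct) T l. ein M (l ! i) (l ! j))"
proof (induction i arbitrary: j k)
  case 0
  show ?case
  proof (cases j)
    case 0
    show ?thesis
      by (rule tdef_cong[OF tdef_not[OF tdef_True]]) (use 0 in \<open>auto simp: good_def kpp.no_self\<close>)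
  next
    case (Suc j')
    then show ?thesis using tdef_mem0(1) 0 by blast
  qed
next
  case (Suc i)
  show ?case
  proof (cases j)
    case 0
    then show ?thesis using tdef_mem0(2) Suc.prems by blast
  next
    case (Suc j')
    then obtain m where m: "k = Suc m" using Suc.prems by (cases k) auto
    have "tdef m (\<lambda>(M :: 'a eps_struct) T l. ein M (l ! i) (l ! j'))"
      using Suc.IH Suc.prems m Suc by simp
    from tdef_pad[OF this] show ?thesis
      unfolding m by (rule tdef_cong) (auto simp: tuples_Suc Suc)
  qed
qed

text \<open>Equality is definable by extensionality, as \<open>T\<close> is transitive.\<close>

lemma tdef_eq:
  assumes "i < k" "j < k"
  shows "tdef k (\<lambda>(M :: 'a eps_struct) T l. l ! i = l ! j)"
proof -
  have "tdef (Suc k) (\<lambda>(M :: 'a eps_struct) T l. ein M (l ! 0) (l ! Suc i))"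
    "tdef (Suc k) (\<lambda>(M :: 'a eps_struct) T l. ein M (l ! 0) (l ! Suc j))"
    using tdef_mem assms by blast+
  then have "tdef (Suc k) (\<lambda>(M :: 'a eps_struct) T l. \<not> ((ein M (l ! 0) (l ! Suc i) \<longrightarrow> ein M (l ! 0) (l ! Suc j)) \<and>
      (ein M (l ! 0) (l ! Suc j) \<longrightarrow> ein M (l ! 0) (l ! Suc i))))"
    by (intro tdef_nand tdef_imp)
  from tdef_not[OF tdef_ex[OF this]] show ?thesis
  proof (rule tdef_cong)
    fix M :: "'a eps_struct" and T l assume g: "good M T" and l: "l \<in> tuples M T k"
    interpret kpp M using g unfolding good_def by blast
    have ij: "ein M (l ! i) T" "ein M (l ! j) T" using l assms unfolding tuples_def by auto
    then have "ein M x T" if "ein M x (l ! i) \<or> ein M x (l ! j)" for x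
      using g that unfolding good_def tran_def by blast
    then show "(\<not> (\<exists>x. ein M x T \<and> \<not> ((ein M ((x # l) ! 0) ((x # l) ! Suc i) \<longrightarrow> ein M ((x # l) ! 0) ((x # l) ! Suc j)) \<and>
      (ein M ((x # l) ! 0) ((x # l) ! Suc j) \<longrightarrow> ein M ((x # l) ! 0) ((x # l) ! Suc i))))) \<longleftrightarrow> l ! i = l ! j"
      using extensionality[of "l ! i" "l ! j"] ij by auto
  qed
qed

definition restr :: "'a eps_struct \<Rightarrow> 'a \<Rightarrow> 'a eps_struct" where
  "restr M T = \<lparr>univ = {x. ein M x T}, mem = mem M\<rparr>"

lemma nth_push: "(\<lambda>n. (x # l) ! n) = x ## (\<lambda>n. l ! n)"
  by (rule ext) (simp split: nat.splits)

lemma tdef_sat: "fv p \<subseteq> {..<k} \<Longrightarrow> tdef k (\<lambda>(M :: 'a eps_struct) T l. sat (restr M T) (\<lambda>n. l ! n) p)"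
proof (induction p arbitrary: k)
  case Fls
  show ?case using tdef_not[OF tdef_True] by simp
next
  case (Mem i j)
  have "tdef k (\<lambda>(M :: 'a eps_struct) T l. ein M (l ! i) (l ! j))" using Mem by (auto intro: tdef_mem)
  then show ?case
    by (rule tdef_cong) (use Mem in \<open>auto simp: restr_def tuples_def ein_def\<close>)
next
  case (Eql i j)
  then show ?case by (auto intro: tdef_eq)
next
  case (Imp p q)
  then show ?case by (auto intro: tdef_imp)
next
  case (And p q)
  then show ?case by (auto intro: tdef_and)
next
  case (Or p q)
  then show ?case by (auto intro: tdef_or)
next
  case (Ex p)
  have "fv p \<subseteq> {..<Suc k}"
  proof
    fix n assume "n \<in> fv p" then show "n \<in> {..<Suc k}" using Ex.prems by (cases n) auto
  qed
  from tdef_ex[OF Ex.IH[OF this]] show ?case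
    by (rule tdef_cong) (simp add: nth_push restr_def)
next
  case (All p)
  have "fv p \<subseteq> {..<Suc k}"
  proof
    fix n assume "n \<in> fv p" then show "n \<in> {..<Suc k}" using All.prems by (cases n) auto
  qed
  from tdef_not[OF tdef_ex[OF tdef_not[OF All.IH[OF this]]]] show ?case
    by (rule tdef_cong) (simp add: nth_push restr_def)
qed

lemma restr_sat:
  assumes "good M T" and "p \<in> Delta0P" and e: "\<And>n. ein M (e n) T"
  shows "sat (restr M T) e p \<longleftrightarrow> sat M e p"
proof -
  interpret kpp M using assms unfolding good_def by blast
  have "sat (restr M T) e p \<longleftrightarrow> sat M (\<lambda>n. e n) p"
  proof (rule Delta0P_absolute[OF _ _ _ assms(2)])
    show "embedding (restr M T) M (\<lambda>x. x)" unfolding embedding_def restr_def by auto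
    show "range e \<subseteq> univ (restr M T)" using e unfolding restr_def by auto
  next
    fix n m assume "n \<in> univ M" "m \<in> univ (restr M T)" "mem M n m"
    then show "n \<in> (\<lambda>x. x) ` univ (restr M T)"
      using assms(1) unfolding good_def tran_def restr_def ein_def by auto
  next
    fix n m assume "n \<in> univ M" and m: "m \<in> univ (restr M T)" and "\<forall>z\<in>univ M. mem M z n \<longrightarrow> mem M z m"
    then have "sbs M n m" unfolding restr_def sbs_def ein_def by auto
    then show "n \<in> (\<lambda>x. x) ` univ (restr M T)"
      using assms(1) m unfolding good_def stran_def restr_def by auto
  qed
  then show ?thesis by simp
qed

lemma fv_ren: "fv (ren r p) \<subseteq> r ` fv p"
proof (induction p arbitrary: r)
  case (Ex p)
  show ?case
  proof
    fix n assume "n \<in> fv (ren r (fm.Ex p))"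
    then have "Suc n \<in> lift r ` fv p" using Ex[of "lift r"] by auto
    then show "n \<in> r ` fv (fm.Ex p)" by (auto simp: lift_def split: nat.splits)
  qed
next
  case (All p)
  show ?case
  proof
    fix n assume "n \<in> fv (ren r (fm.All p))"
    then have "Suc n \<in> lift r ` fv p" using All[of "lift r"] by auto
    then show "n \<in> r ` fv (fm.All p)" by (auto simp: lift_def split: nat.splits)
  qed
qed (simp_all, blast+)

text \<open>All variables from 3 on take the value \<open>\<emptyset>\<close>, so they can be merged into variable 3. This leaves
  formulae in four variables, whose codes are evaluated at the tuples in \<open>Psi\<close>.\<close>

lemma universal:
  assumes "p \<in> Delta0P"
  shows "\<exists>t. \<forall>M :: 'a eps_struct. kpp M \<longrightarrow> (\<forall>s \<in> univ M. \<forall>a \<in> univ M.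
     (\<forall>v. Psi M v (prd M (code M t) s) a \<longrightarrow>
        (\<exists>T x. ein M T v \<and> ein M x T \<and> sat M (x ## s ## a ## (\<lambda>_. emp M)) p)) \<and>
     (\<forall>x \<in> univ M. sat M (x ## s ## a ## (\<lambda>_. emp M)) p \<longrightarrow>
        (\<exists>v \<in> univ M. Psi M v (prd M (code M t) s) a)))"
proof -
  define q where "q = ren (\<lambda>n. min n 3) p"
  have q: "q \<in> Delta0P" unfolding q_def using Delta0P_ren assms by blast
  have "fv q \<subseteq> (\<lambda>n. min n 3) ` fv p" unfolding q_def by (rule fv_ren)
  then have fq: "fv q \<subseteq> {..<4}" by (auto simp: min_def)
  obtain t where t: "wf_tm t"
    "\<And>(M :: 'a eps_struct) T. good M T \<Longrightarrow> ev M T t = {l \<in> tuples M T 4. sat (restr M T) (\<lambda>n. l ! n) q}"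
    using tdef_sat[OF fq] unfolding tdef_def by auto
  show ?thesis
  proof (rule exI[of _ t], intro allI impI ballI)
    fix M :: "'a eps_struct" and s a assume M: "kpp M" and s: "s \<in> univ M" and a: "a \<in> univ M"
    interpret kpp M by fact
    have env: "(\<lambda>n. (x ## s ## a ## (\<lambda>_. emp M)) (min n 3)) = x ## s ## a ## (\<lambda>_. emp M)" for x
      by (rule ext) (auto simp: min_def numeral_3_eq_3 split: nat.splits)
    have q_sat: "sat M (x ## s ## a ## (\<lambda>_. emp M)) q \<longleftrightarrow> sat M (x ## s ## a ## (\<lambda>_. emp M)) p" for x
      unfolding q_def sat_ren comp_def env ..
    have main: "[x, s, a, emp M] \<in> ev M T t \<longleftrightarrow> sat M (x ## s ## a ## (\<lambda>_. emp M)) p"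
      if g: "good M T" and T: "ein M s T" "ein M a T" "ein M x T" for x T
    proof -
      have e: "ein M (emp M) T" using g unfolding good_def by blast
      have "sat (restr M T) (\<lambda>n. [x, s, a, emp M] ! n) q \<longleftrightarrow>
          sat (restr M T) (x ## s ## a ## (\<lambda>_. emp M)) q"
      proof (rule sat_fv)
        fix n assume "n \<in> fv q"
        then have "n < 4" using fq by auto
        then show "[x, s, a, emp M] ! n = (x ## s ## a ## (\<lambda>_. emp M)) n"
          by (auto simp: nth_Cons split: nat.splits)
      qed
      also have "\<dots> \<longleftrightarrow> sat M (x ## s ## a ## (\<lambda>_. emp M)) q"
        by (rule restr_sat[OF g q]) (use T e in \<open>auto split: nat.splits\<close>)
      finally show ?thesis
        unfolding t(2)[OF g] q_sat using T e by (simp add: tuples_def)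
    qed
    let ?d = "prd M (code M t) s"
    show "(\<forall>v. Psi M v ?d a \<longrightarrow> (\<exists>T x. ein M T v \<and> ein M x T \<and> sat M (x ## s ## a ## (\<lambda>_. emp M)) p)) \<and>
      (\<forall>x \<in> univ M. sat M (x ## s ## a ## (\<lambda>_. emp M)) p \<longrightarrow> (\<exists>v \<in> univ M. Psi M v ?d a))"
    proof (intro conjI allI ballI impI)
      fix v assume "Psi M v ?d a"
      then obtain T W X x where *: "ein M T v" "tran M T" "stran M T" "ein M (emp M) T" "ein M s T" "ein M a T"
        "ein M x T" "correct M T W" "X \<in> univ M" "ein M (prd M (code M t) X) W" "ein M (tup M [x, s, a, emp M]) X"
        unfolding Psi_iff[OF code_in s] holds_iff[OF code_in] by blast
      have g: "good M T" using * M unfolding good_def by blast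
      have "\<exists>l \<in> ev M T t. tup M [x, s, a, emp M] = tup M l"
        using correct_ev[OF _ *(8) *(9,10)] *(1,11) by blast
      then have "[x, s, a, emp M] \<in> ev M T t" using tup_ev_iff[of "[x, s, a, emp M]"] *(7) s a by auto
      then show "\<exists>T x. ein M T v \<and> ein M x T \<and> sat M (x ## s ## a ## (\<lambda>_. emp M)) p"
        using main[OF g *(5-7)] * by blast
    next
      fix x assume x: "x \<in> univ M" and sx: "sat M (x ## s ## a ## (\<lambda>_. emp M)) p"
      \<comment> \<open>Finitely many sets lie in a common level.\<close>
      have "\<exists>T. lvl M T \<and> (\<forall>z \<in> set l. ein M z T)" if "set l \<subseteq> univ M" for l
        using that
      proof (induction l)
        case Nil
        then show ?case using in_lvl_exists[OF emp_in] by auto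
      next
        case (Cons y l)
        then obtain T1 T2 where *: "lvl M T1" "ein M y T1" "lvl M T2" "\<forall>z \<in> set l. ein M z T2"
          using in_lvl_exists[of y] by auto
        then show ?case using lvl_linear[OF *(1,3)] lvl_tran[OF *(1)] lvl_tran[OF *(3)]
          by (metis set_ConsD)
      qed
      from this[of "[x, s, a, emp M]"] obtain T where
        T: "lvl M T" "ein M x T" "ein M s T" "ein M a T" "ein M (emp M) T" using x s a by auto
      have ts: "tran M T" "stran M T"
        using lvl_tran[OF T(1)] lvl_stran[OF T(1)] unfolding tran_def stran_def by blast+
      have g: "good M T" using T ts M unfolding good_def by blast
      have TU: "T \<in> univ M" using T lvl_in by blast
      obtain W X where W: "W \<in> univ M" "X \<in> univ M" "correct M T W" "ein M (prd M (code M t) X) W"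
        using correct_exists[OF TU t(1)] by blast
      have "[x, s, a, emp M] \<in> ev M T t" using main[OF g T(3,4,2)] sx by blast
      then have "ein M (tup M [x, s, a, emp M]) X" using correct_ev[OF TU W(3) W(2,4)] by blast
      moreover obtain v where v: "v \<in> univ M" "\<forall>z. ein M z v \<longleftrightarrow> z = T \<or> z = W" using upair_exists[OF TU W(1)] by blast
      then have "ein M T v" "ein M W v" by auto
      ultimately have "Psi M v ?d a" unfolding Psi_iff[OF code_in s] holds_iff[OF code_in] using T ts W by blast
      then show "\<exists>v \<in> univ M. Psi M v ?d a" using v by blast
    qed
  qed
qed

section \<open>Extending partial embeddings\<close>

text \<open>\<open>l\<close> is entry \<open>j\<close> of the tuple \<open>a\<close>.\<close>

primrec Comp :: "nat \<Rightarrow> 'a eps_struct \<Rightarrow> 'a \<Rightarrow> 'a \<Rightarrow> bool" where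
  "Comp 0 M l a = (uin M l a \<and> (\<exists>r. uin M r a \<and> a = prd M l r))"
| "Comp (Suc j) M l a = (\<exists>x. uin M x a \<and> (\<exists>r. uin M r a \<and> a = prd M x r \<and> Comp j M l r))"

lemma D0_ex_Comp:
  "D0 (\<lambda>M e. Q M (e 0) (\<lambda>n. e (Suc n))) \<Longrightarrow> D0 (\<lambda>M e. \<exists>l. Comp j M l (e k) \<and> Q M l e)"
proof (induction j arbitrary: Q k)
  case 0
  have "D0 (\<lambda>M e. \<exists>l. uin M l (e k) \<and> (\<exists>r. uin M r (e k) \<and> e k = prd M l r) \<and> Q M l e)"
    by (intro D0_intros 0)
  then show ?case by (simp add: conj_assoc)
next
  case (Suc j)
  have "D0 (\<lambda>M e. Q M (e 0) (\<lambda>n. e (Suc (Suc (Suc n)))))"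
    using D0_ren[OF Suc.prems, of "case_nat 0 (\<lambda>n. Suc (Suc (Suc n)))"] by simp
  then have "D0 (\<lambda>M e. \<exists>l. Comp j M l (e 0) \<and> Q M l (\<lambda>n. e (Suc (Suc n))))"
    by (rule Suc.IH[of "\<lambda>M l e. Q M l (\<lambda>n. e (Suc (Suc n)))"])
  then have "D0 (\<lambda>M e. \<exists>x. uin M x (e k) \<and> (\<exists>r. uin M r (e k) \<and> e k = prd M x r \<and>
      (\<exists>l. Comp j M l r \<and> Q M l e)))"
    by (intro D0_intros)
  then show ?case by (rule D0_iff) auto
qed

lemma D0_Comp [D0_intros]: "D0 (\<lambda>(M :: 'a eps_struct) e. Comp j M (e i) (e k))"
proof -
  have "D0 (\<lambda>(M :: 'a eps_struct) e. \<exists>l. Comp j M l (e k) \<and> l = e i)" by (intro D0_ex_Comp D0_intros)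
  then show ?thesis by simp
qed

context kpp
begin

lemma Comp_tup: "set xs \<subseteq> U \<Longrightarrow> Comp j M l (tup M xs) \<longleftrightarrow> j < length xs \<and> l = xs ! j"
proof (induction j arbitrary: xs)
  case 0
  show ?case
  proof (cases xs)
    case Nil
    then show ?thesis by (simp add: uin_def)
  next
    case (Cons y ys)
    then have y: "y \<in> U" "tup M ys \<in> U" using 0 tup_in by auto
    have "Comp 0 M l (prd M y (tup M ys)) \<longleftrightarrow> l = y"
    proof
      assume "Comp 0 M l (prd M y (tup M ys))"
      then obtain r where r: "uin M l (prd M y (tup M ys))" "uin M r (prd M y (tup M ys))"
        "prd M y (tup M ys) = prd M l r" by auto
      have "l \<in> U" "r \<in> U" using r(1,2) unfolding uin_def by auto
      then show "l = y" using prd_inj[OF r(3) y] by blast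
    next
      assume "l = y"
      then show "Comp 0 M l (prd M y (tup M ys))" using uin_prd[OF y] by auto
    qed
    then show ?thesis using Cons by simp
  qed
next
  case (Suc j)
  show ?case
  proof (cases xs)
    case Nil
    then show ?thesis by (simp add: uin_def)
  next
    case (Cons y ys)
    then have y: "y \<in> U" "tup M ys \<in> U" using Suc tup_in by auto
    have "Comp (Suc j) M l (prd M y (tup M ys)) \<longleftrightarrow> Comp j M l (tup M ys)"
    proof
      assume "Comp (Suc j) M l (prd M y (tup M ys))"
      then obtain x r where r: "uin M x (prd M y (tup M ys))" "uin M r (prd M y (tup M ys))"
        "prd M y (tup M ys) = prd M x r" "Comp j M l r" by auto
      have "x \<in> U" "r \<in> U" using r(1,2) unfolding uin_def by auto
      then show "Comp j M l (tup M ys)" using prd_inj[OF r(3) y] r(4) by blast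
    next
      assume "Comp j M l (tup M ys)"
      then show "Comp (Suc j) M l (prd M y (tup M ys))" using uin_prd[OF y] by auto
    qed
    then have "Comp (Suc j) M l (tup M xs) \<longleftrightarrow> Comp j M l (tup M ys)" using Cons by simp
    then show ?thesis using Suc Cons by simp
  qed
qed

lemma Psi_mono: "Psi M v d a \<Longrightarrow> (\<And>z. z \<epsilon> v \<Longrightarrow> z \<epsilon> v') \<Longrightarrow> Psi M v' d a"
  unfolding Psi_def by blast

lemma Psi_collect:
  assumes D: "D \<in> U" and a: "a \<in> U" and ex: "\<And>d. d \<epsilon> D \<Longrightarrow> \<exists>v \<in> U. Psi M v d a"
  shows "\<exists>v \<in> U. \<forall>d. d \<epsilon> D \<longrightarrow> Psi M v d a"
proof -
  have "D0 (\<lambda>M e. Psi M (e 0) (e 1) (e 2))" by (intro D0_intros)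
  from collection[OF this, of "\<lambda>_. a" D] a D ex obtain y where
    y: "y \<in> U" "\<forall>d. d \<epsilon> D \<longrightarrow> (\<exists>v. v \<epsilon> y \<and> Psi M v d a)" by auto
  obtain v where v: "v \<in> U" "\<forall>z. z \<epsilon> v \<longleftrightarrow> uin M z y" using union_exists[OF y(1)] by blast
  have "Psi M v d a" if "d \<epsilon> D" for d
  proof -
    obtain v' where v': "v' \<epsilon> y" "Psi M v' d a" using y(2) \<open>d \<epsilon> D\<close> by blast
    have "z \<epsilon> v" if "z \<epsilon> v'" for z using v(2) v'(1) that unfolding uin_def by blast
    then show ?thesis by (rule Psi_mono[OF v'(2)])
  qed
  then show ?thesis using v(1) by blast
qed

end

context cut
begin

text \<open>This is the use of \<open>\<Sigma>\<^sub>1\<^sup>P\<close>-Separation: the true codes in \<open>S\<close> are the trace of a set.\<close>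

lemma Psi_coded:
  assumes a: "a \<in> U"
  shows "\<exists>C \<in> U. \<forall>d \<in> univ S. d \<epsilon> C \<longleftrightarrow> (\<exists>v \<in> U. Psi M v d a)"
proof -
  obtain w where w: "lvl M w" "\<forall>s \<in> univ S. s \<epsilon> w" using S_bounded by blast
  have "D0 (\<lambda>M e. Psi M (e 0) (e 1) (e 2))" by (intro D0_intros)
  from Sigma1_separation[OF this, of "\<lambda>_. a" w] a lvl_in[OF w(1)] obtain C where
    C: "C \<in> U" "\<forall>d. d \<epsilon> C \<longleftrightarrow> d \<epsilon> w \<and> (\<exists>v \<in> U. Psi M v d a)" by auto
  have "d \<epsilon> C \<longleftrightarrow> (\<exists>v \<in> U. Psi M v d a)" if "d \<in> univ S" for d using C(2) w(2) that by simp
  then show ?thesis using C(1) by blast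
qed

lemma S_inter:
  assumes u: "u \<in> univ S" and C: "C \<in> U"
  shows "\<exists>D \<in> univ S. \<forall>d. d \<epsilon> D \<longleftrightarrow> d \<epsilon> u \<and> d \<epsilon> C"
proof -
  have uU: "u \<in> U" using u SU by blast
  have "D0 (\<lambda>M e. ein M (e 0) (e 1))" by (intro D0_intros)
  from separation[OF this, of "\<lambda>_. C" u] C uU obtain D where
    D: "D \<in> U" "\<forall>d. d \<epsilon> D \<longleftrightarrow> d \<epsilon> u \<and> d \<epsilon> C" by auto
  have "sbs M D u" using D uU unfolding sbs_def by simp
  then show ?thesis using S_sub u D by blast
qed

end

locale cut_pair = M: cut M S + N: cut N S for M N S :: "'a eps_struct" +
  assumes SSy_eq: "SSy S M = SSy S N"
begin

lemma S_elem_agree: "y \<in> univ S \<Longrightarrow> ein M x y \<longleftrightarrow> ein N x y"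
  using M.S_trans[of x y] N.S_trans[of x y] M.S_mem[of x y] N.S_mem[of x y] by blast

lemma emp_agree: "emp M = emp N"
proof -
  have "emp M = emp N \<longleftrightarrow> emp M = emp M"
    using cut_agree[OF N.cut_axioms M.cut_axioms D0_emp[of 0], of "\<lambda>_. emp M"] M.S_emp by auto
  then show ?thesis by simp
qed

lemma prd_agree:
  assumes "x \<in> univ S" "y \<in> univ S"
  shows "prd M x y = prd N x y"
proof -
  have "D0 (\<lambda>(M :: 'a eps_struct) e. e 0 = prd M (e 1) (e 2))" by (intro D0_intros)
  from cut_agree[OF M.cut_axioms N.cut_axioms this, of "prd M x y ## x ## (\<lambda>_. y)"] show ?thesis
    using assms M.S_prd[OF assms] by (auto simp: range_push)
qed

lemma code_S: "code M t \<in> univ S" and code_agree: "code M t = code N t"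
proof -
  have tup: "tup M xs \<in> univ S \<and> tup M xs = tup N xs" if "set xs \<subseteq> univ S" for xs
    using that
  proof (induction xs)
    case Nil
    show ?case using M.S_emp emp_agree by simp
  next
    case (Cons x xs)
    then have *: "x \<in> univ S" "tup M xs \<in> univ S" "tup M xs = tup N xs" by auto
    show ?case using M.S_prd[OF *(1,2)] prd_agree[OF *(1,2)] *(3) by simp
  qed
  have tag: "tag M n \<in> univ S" "tag M n = tag N n" for n
  proof -
    have "set (replicate n (emp M)) \<subseteq> univ S" using M.S_emp by auto
    from tup[OF this] show "tag M n \<in> univ S" "tag M n = tag N n"
      unfolding tag_def emp_agree by blast+
  qed
  have "code M t \<in> univ S \<and> code M t = code N t"
  proof (induction t)
    case One
    show ?case using M.S_emp emp_agree by simp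
  next
    case (Op n f p r)
    then have *: "code M f \<in> univ S" "code M p \<in> univ S" "code M r \<in> univ S"
      "code M f = code N f" "code M p = code N p" "code M r = code N r" by auto
    note 1 = M.S_prd[OF *(2,3)] prd_agree[OF *(2,3)]
    note 2 = M.S_prd[OF *(1) 1(1)] prd_agree[OF *(1) 1(1)]
    note 3 = M.S_prd[OF tag(1) 2(1)] prd_agree[OF tag(1) 2(1)]
    show ?case using 1(2) 2(2) 3 tag(2) *(4-6) by simp
  qed
  then show "code M t \<in> univ S" "code M t = code N t" by auto
qed

lemma SSy_code:
  shows MN_code: "c \<in> univ M \<Longrightarrow> \<exists>c' \<in> univ N. \<forall>x \<in> univ S. ein M x c \<longleftrightarrow> ein N x c'"
    and NM_code: "c \<in> univ N \<Longrightarrow> \<exists>c' \<in> univ M. \<forall>x \<in> univ S. ein N x c \<longleftrightarrow> ein M x c'"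
proof -
  have eq: "{{x \<in> univ S. mem M x c} | c. c \<in> univ M} = {{x \<in> univ S. mem N x c} | c. c \<in> univ N}"
    using SSy_eq unfolding SSy_def by simp
  { assume c: "c \<in> univ M"
    then have "{x \<in> univ S. mem M x c} \<in> {{x \<in> univ S. mem N x c} | c. c \<in> univ N}"
      unfolding eq[symmetric] by blast
    then obtain c' where c': "c' \<in> univ N" "{x \<in> univ S. mem M x c} = {x \<in> univ S. mem N x c'}" by blast
    have "ein M x c \<longleftrightarrow> ein N x c'" if "x \<in> univ S" for x
      using that c'(2) c c'(1) M.SU[OF that] N.SU[OF that] unfolding ein_def by blast
    then show "\<exists>c' \<in> univ N. \<forall>x \<in> univ S. ein M x c \<longleftrightarrow> ein N x c'" using c'(1) by blast }
  { assume c: "c \<in> univ N"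
    then have "{x \<in> univ S. mem N x c} \<in> {{x \<in> univ S. mem M x c} | c. c \<in> univ M}"
      unfolding eq by blast
    then obtain c' where c': "c' \<in> univ M" "{x \<in> univ S. mem N x c} = {x \<in> univ S. mem M x c'}" by blast
    have "ein N x c \<longleftrightarrow> ein M x c'" if "x \<in> univ S" for x
      using that c'(2) c c'(1) M.SU[OF that] N.SU[OF that] unfolding ein_def by blast
    then show "\<exists>c' \<in> univ M. \<forall>x \<in> univ S. ein N x c \<longleftrightarrow> ein M x c'" using c'(1) by blast }
qed

text \<open>The tuple \<open>b\<close> is a possible image of \<open>a\<close>, with all images to be found in \<open>v\<close>.\<close>

definition tr :: "'a \<Rightarrow> 'a \<Rightarrow> 'a \<Rightarrow> bool" where
  "tr a b v \<longleftrightarrow> (\<forall>p \<in> Delta0P. \<forall>s \<in> univ S.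
     (\<exists>x \<in> univ M. sat M (x ## s ## a ## (\<lambda>_. emp M)) p) \<longrightarrow>
     (\<exists>x. ein N x v \<and> sat N (x ## s ## b ## (\<lambda>_. emp N)) p))"

lemma tr_D0:
  assumes t: "tr a b v" and R: "D0 R" and s: "s \<in> univ S" and a: "a \<in> univ M" and b: "b \<in> univ N"
    and x: "x \<in> univ M" "R M (x ## s ## a ## (\<lambda>_. emp M))"
  shows "\<exists>x. ein N x v \<and> R N (x ## s ## b ## (\<lambda>_. emp N))"
proof -
  obtain p where p: "p \<in> Delta0P" "\<And>M e. kpp M \<Longrightarrow> range e \<subseteq> univ M \<Longrightarrow> sat M e p = R M e"
    using R unfolding D0_def by blast
  have "sat M (x ## s ## a ## (\<lambda>_. emp M)) p"
    using p(2)[OF M.kpp_axioms, of "x ## s ## a ## (\<lambda>_. emp M)"] x a M.SU[OF s] M.const_env[OF M.emp_in]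
    unfolding range_push by blast
  then obtain y where y: "ein N y v" "sat N (y ## s ## b ## (\<lambda>_. emp N)) p"
    using t p(1) s x(1) unfolding tr_def by blast
  have "y \<in> univ N" using y(1) by auto
  then have "R N (y ## s ## b ## (\<lambda>_. emp N))"
    using p(2)[OF N.kpp_axioms, of "y ## s ## b ## (\<lambda>_. emp N)"] y b N.SU[OF s] N.const_env[OF N.emp_in]
    unfolding range_push by blast
  then show ?thesis using y(1) by blast
qed

text \<open>Bounded relations are even reflected, because their negations are preserved.\<close>

lemma tr_iff:
  assumes t: "tr a b v" and R: "D0 R" and s: "s \<in> univ S" and a: "a \<in> univ M" and b: "b \<in> univ N"
  shows "R M (s ## a ## (\<lambda>_. emp M)) \<longleftrightarrow> R N (s ## b ## (\<lambda>_. emp N))"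
proof
  have R': "D0 (\<lambda>M e. R M (\<lambda>n. e (Suc n)))" using D0_ren[OF R] .
  { assume "R M (s ## a ## (\<lambda>_. emp M))"
    then show "R N (s ## b ## (\<lambda>_. emp N))" using tr_D0[OF t R' s a b a] by simp }
  { assume "R N (s ## b ## (\<lambda>_. emp N))"
    then show "R M (s ## a ## (\<lambda>_. emp M))" using tr_D0[OF t D0_not[OF R'] s a b a] by auto }
qed

text \<open>The universal formula reduces \<open>tr\<close> to codes. The witness that \<open>Psi N v1 d b\<close> provides is an
  element of an element of \<open>v1\<close>, whence in \<open>v\<close>.\<close>

lemma tr_of_codes:
  assumes a: "a \<in> univ M" and b: "b \<in> univ N" and v: "tran N v"
    and v1: "\<And>z. ein N z v1 \<Longrightarrow> ein N z v"
    and codes: "\<And>d v'. d \<in> univ S \<Longrightarrow> v' \<in> univ M \<Longrightarrow> Psi M v' d a \<Longrightarrow> Psi N v1 d b"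
  shows "tr a b v"
  unfolding tr_def
proof (intro ballI impI)
  fix p s assume p: "p \<in> Delta0P" and s: "s \<in> univ S"
    and ex: "\<exists>x \<in> univ M. sat M (x ## s ## a ## (\<lambda>_. emp M)) p"
  obtain t where t: "\<forall>M :: 'a eps_struct. kpp M \<longrightarrow> (\<forall>s \<in> univ M. \<forall>a \<in> univ M.
     (\<forall>v. Psi M v (prd M (code M t) s) a \<longrightarrow>
        (\<exists>T x. ein M T v \<and> ein M x T \<and> sat M (x ## s ## a ## (\<lambda>_. emp M)) p)) \<and>
     (\<forall>x \<in> univ M. sat M (x ## s ## a ## (\<lambda>_. emp M)) p \<longrightarrow>
        (\<exists>v \<in> univ M. Psi M v (prd M (code M t) s) a)))"
    using universal[OF p] by blast
  let ?d = "prd M (code M t) s"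
  have d: "?d \<in> univ S" "?d = prd N (code N t) s"
    using M.S_prd[OF code_S s] prd_agree[OF code_S s] code_agree by auto
  obtain v' where "v' \<in> univ M" "Psi M v' ?d a"
    using t M.kpp_axioms M.SU[OF s] a ex by blast
  then have "Psi N v1 (prd N (code N t) s) b" using codes d by metis
  then obtain T x where *: "ein N T v1" "ein N x T" "sat N (x ## s ## b ## (\<lambda>_. emp N)) p"
    using t N.kpp_axioms N.SU[OF s] b by blast
  have "ein N x v" using v v1[OF *(1)] *(2) unfolding tran_def by blast
  then show "\<exists>x. ein N x v \<and> sat N (x ## s ## b ## (\<lambda>_. emp N)) p" using *(3) by blast
qed

lemma lvl_trN: "lvl N v \<Longrightarrow> tran N v"
  using N.lvl_tran unfolding tran_def by blast

text \<open>The common part of the three lemmas that follow. The relation \<open>Adm\<close> describes the admissible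
  choices of a bound and a tuple in \<open>N\<close>. If for each set \<open>D \<in> S\<close> of codes that are true of \<open>a\<close> there is a choice that makes
  the codes in \<open>D\<close> true, then one choice works for all of \<open>S\<close>: \<open>N\<close> has a set \<open>C\<close> with the same trace
  on \<open>S\<close> as the true codes, and by overspill the part of \<open>C\<close> in some level including \<open>S\<close> can be
  treated like its part in a level in \<open>S\<close>.\<close>

lemma overspill_codes:
  assumes a: "a \<in> univ M"
    and approx: "\<And>D v. D \<in> univ S \<Longrightarrow> v \<in> univ M \<Longrightarrow> \<forall>d. ein M d D \<longrightarrow> Psi M v d a \<Longrightarrow>
      \<exists>v b. Adm v b \<and> (\<forall>d. ein N d D \<longrightarrow> Psi N v d b)"
    and sep: "\<And>C w. C \<in> univ N \<Longrightarrow> w \<in> univ N \<Longrightarrow> \<exists>X \<in> univ N. \<forall>u. ein N u X \<longleftrightarrow> ein N u w \<and>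
      (\<exists>v b. Adm v b \<and> (\<forall>d. ein N d u \<longrightarrow> ein N d C \<longrightarrow> Psi N v d b))"
  obtains v b where "Adm v b"
    "\<And>d v'. d \<in> univ S \<Longrightarrow> v' \<in> univ M \<Longrightarrow> Psi M v' d a \<Longrightarrow> Psi N v d b"
proof -
  obtain C where C: "C \<in> univ M" "\<forall>d \<in> univ S. ein M d C \<longleftrightarrow> (\<exists>v \<in> univ M. Psi M v d a)"
    using M.Psi_coded[OF a] by blast
  obtain C' where C': "C' \<in> univ N" "\<forall>x \<in> univ S. ein M x C \<longleftrightarrow> ein N x C'" using MN_code[OF C(1)] by blast
  obtain w where w: "lvl N w" "\<forall>s \<in> univ S. ein N s w" using N.S_bounded by blast
  obtain X where X: "X \<in> univ N" "\<forall>u. ein N u X \<longleftrightarrow> ein N u w \<and>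
      (\<exists>v b. Adm v b \<and> (\<forall>d. ein N d u \<longrightarrow> ein N d C' \<longrightarrow> Psi N v d b))"
    using sep[OF C'(1) N.lvl_in[OF w(1)]] by blast
  have "ein N u X" if u: "u \<in> univ S" for u
  proof -
    obtain D where D: "D \<in> univ S" "\<forall>d. ein M d D \<longleftrightarrow> ein M d u \<and> ein M d C"
      using M.S_inter[OF u C(1)] by blast
    have "\<exists>v \<in> univ M. Psi M v d a" if "ein M d D" for d
      using that D C(2) M.S_trans[OF that D(1)] by blast
    then obtain v1 where "v1 \<in> univ M" "\<forall>d. ein M d D \<longrightarrow> Psi M v1 d a"
      using M.Psi_collect[OF M.SU[OF D(1)] a] by blast
    then obtain v b where v: "Adm v b" "\<forall>d. ein N d D \<longrightarrow> Psi N v d b"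
      using approx[OF D(1)] by blast
    have "ein N d D" if "ein N d u" "ein N d C'" for d
    proof -
      have "d \<in> univ S" using N.S_trans that u by blast
      then have "ein M d D" using D(2) C'(2) that S_elem_agree[OF u] by blast
      then show ?thesis using S_elem_agree[OF D(1)] by blast
    qed
    then show ?thesis using X(2) w(2) u v by blast
  qed
  then obtain u where u: "lvl N u" "u \<notin> univ S" "ein N u X" using N.overspill[OF X(1)] by blast
  then obtain v b where v: "Adm v b" "\<forall>d. ein N d u \<longrightarrow> ein N d C' \<longrightarrow> Psi N v d b"
    using X(2) by blast
  have "Psi N v d b" if "d \<in> univ S" "v' \<in> univ M" "Psi M v' d a" for d v'
    using v(2) N.S_below[OF u(1,2) that(1)] C(2) C'(2) that by blast
  then show thesis using that v(1) by blast
qed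

text \<open>Without a bound to start from, separating the good levels is an instance of
  \<open>\<Sigma>\<^sub>1\<^sup>P\<close>-Separation in \<open>N\<close>.\<close>

lemma tr_init:
  assumes Th: "\<And>p s. p \<in> Delta0P \<Longrightarrow> s \<in> univ S \<Longrightarrow>
      \<exists>x \<in> univ M. sat M (x ## s ## (\<lambda>_. emp M)) p \<Longrightarrow>
      \<exists>x \<in> univ N. sat N (x ## s ## (\<lambda>_. emp N)) p"
  shows "\<exists>v. lvl N v \<and> tr (emp M) (emp N) v"
proof -
  obtain v b where v: "v \<in> univ N \<and> b = emp N"
    "\<And>d v'. d \<in> univ S \<Longrightarrow> v' \<in> univ M \<Longrightarrow> Psi M v' d (emp M) \<Longrightarrow> Psi N v d b"
  proof (rule overspill_codes[OF M.emp_in, of "\<lambda>v b. v \<in> univ N \<and> b = emp N"])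
    fix D v assume D: "D \<in> univ S" "v \<in> univ M" "\<forall>d. ein M d D \<longrightarrow> Psi M v d (emp M)"
    have "D0 (\<lambda>(M :: 'a eps_struct) e. \<forall>d. ein M d (e 1) \<longrightarrow> Psi M (e 0) d (e 2))"
      by (intro D0_intros)
    then obtain p where p: "p \<in> Delta0P" "\<And>(M :: 'a eps_struct) e. kpp M \<Longrightarrow> range e \<subseteq> univ M \<Longrightarrow>
      sat M e p = (\<forall>d. ein M d (e 1) \<longrightarrow> Psi M (e 0) d (e 2))"
      unfolding D0_def by blast
    have "sat M (v ## D ## (\<lambda>_. emp M)) p"
      using p(2)[OF M.kpp_axioms, of "v ## D ## (\<lambda>_. emp M)"] D(1-3) M.SU M.const_env[OF M.emp_in]
      by (simp add: range_push)
    then obtain v' where v': "v' \<in> univ N" "sat N (v' ## D ## (\<lambda>_. emp N)) p"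
      using Th[OF p(1) D(1)] D(2) by blast
    then have "\<forall>d. ein N d D \<longrightarrow> Psi N v' d (emp N)"
      using p(2)[OF N.kpp_axioms, of "v' ## D ## (\<lambda>_. emp N)"] N.SU[OF D(1)] N.const_env[OF N.emp_in]
      by (simp add: range_push)
    then show "\<exists>v b. (v \<in> univ N \<and> b = emp N) \<and> (\<forall>d. ein N d D \<longrightarrow> Psi N v d b)" using v'(1) by blast
  next
    fix C w assume C: "C \<in> univ N" "w \<in> univ N"
    then have r: "range (C ## (\<lambda>_. emp N)) \<subseteq> univ N" by (auto simp: range_push)
    have "D0 (\<lambda>M e. \<forall>d. ein M d (e 1) \<longrightarrow> ein M d (e 2) \<longrightarrow> Psi M (e 0) d (e 3))"
      by (intro D0_intros)
    from N.Sigma1_separation[OF this r C(2)]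
    show "\<exists>X \<in> univ N. \<forall>u. ein N u X \<longleftrightarrow> ein N u w \<and>
      (\<exists>v b. (v \<in> univ N \<and> b = emp N) \<and> (\<forall>d. ein N d u \<longrightarrow> ein N d C \<longrightarrow> Psi N v d b))"
      by (simp add: conj_assoc Bex_def)
  qed blast
  obtain v0 where v0: "lvl N v0" "sbs N v v0" using N.sub_lvl_exists v(1) by blast
  have "tr (emp M) (emp N) v0"
    by (rule tr_of_codes[OF M.emp_in N.emp_in lvl_trN[OF v0(1)] N.sbsD[OF v0(2)]]) (use v in blast)+
  then show ?thesis using v0(1) by blast
qed

text \<open>The statement that is transferred for \<open>D \<in> S\<close> is that some \<open>m\<close> makes the codes in \<open>D\<close> true of
  \<open>a\<close> extended by \<open>m\<close>.\<close>

lemma tr_forth: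
  assumes t: "tr a b v" and v: "lvl N v" and a: "a \<in> univ M" and b: "b \<in> univ N" and m: "m \<in> univ M"
  shows "\<exists>n. ein N n v \<and> tr (prd M m a) (prd N n b) v"
proof -
  let ?a2 = "prd M m a"
  let ?Adm = "\<lambda>v2 b2. ein N v2 v \<and> ein N b2 v2 \<and> (\<exists>n. uin N n b2 \<and> b2 = prd N n b)"
  have a2: "?a2 \<in> univ M" using a m by simp
  have vN: "v \<in> univ N" using N.lvl_in[OF v] .
  obtain v2 b2 where v2: "?Adm v2 b2"
    "\<And>d v'. d \<in> univ S \<Longrightarrow> v' \<in> univ M \<Longrightarrow> Psi M v' d ?a2 \<Longrightarrow> Psi N v2 d b2"
  proof (rule overspill_codes[OF a2, of ?Adm])
    fix D v1 assume D: "D \<in> univ S" "v1 \<in> univ M" "\<forall>d. ein M d D \<longrightarrow> Psi M v1 d ?a2"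
    obtain v2 where v2: "v2 \<in> univ M" "\<forall>z. ein M z v2 \<longleftrightarrow> z = ?a2 \<or> ein M z v1"
      using M.insert_exists[OF a2 D(2)] by metis
    have P: "Psi M v2 d ?a2" if "ein M d D" for d
      by (rule M.Psi_mono[OF D(3)[rule_format, OF that]]) (use v2 in simp)
    have "D0 (\<lambda>M e. \<exists>a2. ein M a2 (e 0) \<and> (\<exists>a'. uin M a' a2 \<and> a2 = prd M a' (e 2) \<and>
      (\<forall>d. ein M d (e 1) \<longrightarrow> Psi M (e 0) d a2)))"
      by (intro D0_intros)
    from tr_D0[OF t this D(1) a b v2(1)] show "\<exists>v b. ?Adm v b \<and> (\<forall>d. ein N d D \<longrightarrow> Psi N v d b)"
      using v2(2) P M.uin_prd1[OF m a] by auto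
  next
    fix C w assume C: "C \<in> univ N" "w \<in> univ N"
    then have r: "range (v ## b ## (\<lambda>_. C)) \<subseteq> univ N" using b vN by (auto simp: range_push)
    have "D0 (\<lambda>M e. \<exists>v2. ein M v2 (e 1) \<and> (\<exists>a2. ein M a2 v2 \<and> (\<exists>a'. uin M a' a2 \<and>
      a2 = prd M a' (e 2)) \<and> (\<forall>d. ein M d (e 0) \<longrightarrow> ein M d (e 3) \<longrightarrow> Psi M v2 d a2)))"
      by (intro D0_intros)
    from N.separation[OF this r C(2)]
    show "\<exists>X \<in> univ N. \<forall>u. ein N u X \<longleftrightarrow> ein N u w \<and>
      (\<exists>v b. ?Adm v b \<and> (\<forall>d. ein N d u \<longrightarrow> ein N d C \<longrightarrow> Psi N v d b))"
      by (simp add: conj_assoc)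
  qed blast
  then obtain n where n: "ein N v2 v" "ein N b2 v2" "uin N n b2" "b2 = prd N n b" by blast
  have "b2 \<in> univ N" using n(2) by auto
  have "tr ?a2 b2 v"
    by (rule tr_of_codes[OF a2 \<open>b2 \<in> univ N\<close> lvl_trN[OF v] N.lvl_tran[OF v n(1)] v2(2)])
  moreover have "ein N n v"
    using N.lvl_tran[OF v N.lvl_tran[OF v n(1,2)]] n(3) N.lvl_tran[OF v] unfolding uin_def by blast
  ultimately show ?thesis using n(4) by blast
qed

text \<open>If \<open>l\<close> bounds the witnesses, then it contains a level that does: the existence of a level with
  witnesses for all of \<open>D \<in> S\<close> is true in \<open>M\<close>, hence witnessed in \<open>l\<close>.\<close>

lemma tr_lower:
  assumes t: "tr a b l" and l: "lvl N l" and a: "a \<in> univ M" and b: "b \<in> univ N"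
  shows "\<exists>v. ein N v l \<and> lvl N v \<and> tr a b v"
proof -
  have lN: "l \<in> univ N" using N.lvl_in[OF l] .
  obtain v b' where v: "ein N v l \<and> lvl N v \<and> b' = b"
    "\<And>d v'. d \<in> univ S \<Longrightarrow> v' \<in> univ M \<Longrightarrow> Psi M v' d a \<Longrightarrow> Psi N v d b'"
  proof (rule overspill_codes[OF a, of "\<lambda>v b'. ein N v l \<and> lvl N v \<and> b' = b"])
    fix D v1 assume D: "D \<in> univ S" "v1 \<in> univ M" "\<forall>d. ein M d D \<longrightarrow> Psi M v1 d a"
    obtain v2 where v2: "lvl M v2" "sbs M v1 v2" using M.sub_lvl_exists[OF D(2)] by blast
    have P: "Psi M v2 d a" if "ein M d D" for d
      by (rule M.Psi_mono[OF D(3)[rule_format, OF that]]) (rule M.sbsD[OF v2(2)])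
    have v2U: "v2 \<in> univ M" using M.lvl_in[OF v2(1)] .
    \<comment> \<open>The singleton of the level is the witness that is transferred.\<close>
    obtain V where V: "V \<in> univ M" "\<forall>z. ein M z V \<longleftrightarrow> z = v2 \<or> z = v2" using M.upair_exists[OF v2U v2U] by blast
    have "D0 (\<lambda>M e. \<exists>v. ein M v (e 0) \<and> lvl M v \<and> (\<forall>d. ein M d (e 1) \<longrightarrow> Psi M v d (e 2)))"
      by (intro D0_intros)
    from tr_D0[OF t this D(1) a b V(1)] obtain V' v where "ein N V' l"
      "ein N v V'" "lvl N v" "\<forall>d. ein N d D \<longrightarrow> Psi N v d b"
      using V(2) P v2(1) by auto
    then show "\<exists>v b'. (ein N v l \<and> lvl N v \<and> b' = b) \<and> (\<forall>d. ein N d D \<longrightarrow> Psi N v d b')"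
      using N.lvl_tran[OF l] by blast
  next
    fix C w assume C: "C \<in> univ N" "w \<in> univ N"
    then have r: "range (l ## b ## (\<lambda>_. C)) \<subseteq> univ N" using b lN by (auto simp: range_push)
    have "D0 (\<lambda>M e. \<exists>v. ein M v (e 1) \<and> lvl M v \<and>
      (\<forall>d. ein M d (e 0) \<longrightarrow> ein M d (e 3) \<longrightarrow> Psi M v d (e 2)))"
      by (intro D0_intros)
    from N.separation[OF this r C(2)]
    show "\<exists>X \<in> univ N. \<forall>u. ein N u X \<longleftrightarrow> ein N u w \<and>
      (\<exists>v b'. (ein N v l \<and> lvl N v \<and> b' = b) \<and> (\<forall>d. ein N d u \<longrightarrow> ein N d C \<longrightarrow> Psi N v d b'))"
      by (simp add: conj_assoc)
  qed blast
  have "tr a b v"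
    by (rule tr_of_codes[OF a b lvl_trN]) (use v in auto)
  then show ?thesis using v(1) by blast
qed

text \<open>The back step goes through the complement. Let \<open>C\<close> code the codes that fail in \<open>N\<close> below \<open>v\<close> for
  \<open>b\<close> extended by \<open>n\<close>. For \<open>u \<in> S\<close> some \<open>m \<in> l\<close> makes all codes of \<open>C\<close> in \<open>u\<close> false: otherwise each
  \<open>m \<in> l\<close> makes one of them true, which is a \<open>\<Sigma>\<^sub>1\<^sup>P\<close> statement by Collection, and transferred
  to \<open>N\<close> it contradicts the choice of \<open>C\<close> at \<open>n\<close>. Overspill, this time in \<open>M\<close>, gives one \<open>m\<close>
  for all codes in \<open>S\<close>.\<close>

lemma tr_back:
  assumes t: "tr a b v" and v: "lvl N v" and a: "a \<in> univ M" and b: "b \<in> univ N"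
    and l: "Comp j M l a" "l \<in> univ M" and l': "\<And>k. Comp j N k b \<Longrightarrow> k = l'" and n: "ein N n l'"
  shows "\<exists>m. ein M m l \<and> tr (prd M m a) (prd N n b) v"
proof -
  have nN: "n \<in> univ N" using n by auto
  have b2: "prd N n b \<in> univ N" using nN b by simp
  have vN: "v \<in> univ N" using N.lvl_in[OF v] .
  obtain w' where w': "lvl N w'" "\<forall>s \<in> univ S. ein N s w'" using N.S_bounded by blast
  have "D0 (\<lambda>M e. \<not> Psi M (e 1) (e 0) (e 2))" by (intro D0_intros)
  from N.separation[OF this, of "v ## (\<lambda>_. prd N n b)" w'] vN b2 N.lvl_in[OF w'(1)] obtain C' where
    C': "C' \<in> univ N" "\<forall>d. ein N d C' \<longleftrightarrow> ein N d w' \<and> \<not> Psi N v d (prd N n b)"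
    by (auto simp: range_push)
  obtain C where C: "C \<in> univ M" "\<forall>x \<in> univ S. ein N x C' \<longleftrightarrow> ein M x C" using NM_code[OF C'(1)] by blast
  have key: "\<exists>m. ein M m l \<and> (\<forall>d. ein M d u \<longrightarrow> ein M d C \<longrightarrow> \<not> (\<exists>v' \<in> univ M. Psi M v' d (prd M m a)))"
    if u: "u \<in> univ S" for u
  proof (rule ccontr)
    assume neg: "\<not> ?thesis"
    obtain D where D: "D \<in> univ S" "\<forall>d. ein M d D \<longleftrightarrow> ein M d u \<and> ein M d C" using M.S_inter[OF u C(1)] by blast
    have DM: "D \<in> univ M" using M.SU[OF D(1)] .
    have D0R: "D0 (\<lambda>M e. \<exists>a2. ein M a2 (e 0) \<and> a2 = prd M (e 1) (e 3) \<and>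
        (\<exists>d. ein M d (e 2) \<and> Psi M (e 0) d a2))" by (intro D0_intros)
    have ex: "\<exists>V \<in> univ M. \<exists>a2. ein M a2 V \<and> a2 = prd M m a \<and> (\<exists>d. ein M d D \<and> Psi M V d a2)"
      if m: "ein M m l" for m
    proof -
      obtain d v1 where d: "ein M d u" "ein M d C" "v1 \<in> univ M" "Psi M v1 d (prd M m a)"
        using neg m by blast
      have a2: "prd M m a \<in> univ M" using m a by auto
      obtain V where V: "V \<in> univ M" "\<forall>z. ein M z V \<longleftrightarrow> z = prd M m a \<or> ein M z v1"
        using M.insert_exists[OF a2 d(3)] by metis
      have "Psi M V d (prd M m a)" by (rule M.Psi_mono[OF d(4)]) (use V in simp)
      moreover have "ein M (prd M m a) V" using V(2) by simp
      moreover have "ein M d D" using D(2) d by blast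
      ultimately show ?thesis using V(1) by blast
    qed
    from M.collection[OF D0R, of "D ## (\<lambda>_. a)" l] ex DM a l(2) obtain y where
      y: "y \<in> univ M" "\<forall>m. ein M m l \<longrightarrow> (\<exists>V. ein M V y \<and>
        (\<exists>a2. ein M a2 V \<and> a2 = prd M m a \<and> (\<exists>d. ein M d D \<and> Psi M V d a2)))"
      by (auto simp: range_push)
    obtain V where V: "V \<in> univ M" "\<forall>z. ein M z V \<longleftrightarrow> uin M z y" using M.union_exists[OF y(1)] by blast
    have fin: "\<exists>a2. ein M a2 V \<and> a2 = prd M m a \<and> (\<exists>d. ein M d D \<and> Psi M V d a2)" if "ein M m l" for m
    proof -
      obtain V1 d where V1: "ein M V1 y" "ein M (prd M m a) V1" "ein M d D" "Psi M V1 d (prd M m a)"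
        using y(2) \<open>ein M m l\<close> by blast
      have s: "ein M z V" if "ein M z V1" for z using V(2) V1(1) that unfolding uin_def by blast
      then have "Psi M V d (prd M m a)" by (rule M.Psi_mono[OF V1(4)])
      then show ?thesis using s[OF V1(2)] V1(3) by blast
    qed
    have "D0 (\<lambda>M e. \<exists>l. Comp j M l (e 2) \<and> (\<forall>m. ein M m l \<longrightarrow>
        (\<exists>a2. ein M a2 (e 0) \<and> a2 = prd M m (e 2) \<and>
          (\<exists>d. ein M d (e 1) \<and> Psi M (e 0) d a2))))"
      by (intro D0_ex_Comp D0_intros)
    from tr_D0[OF t this D(1) a b V(1)] l(1) fin obtain W k where W: "ein N W v" "Comp j N k b"
      "\<forall>m. ein N m k \<longrightarrow> (\<exists>a2. ein N a2 W \<and> a2 = prd N m b \<and> (\<exists>d. ein N d D \<and> Psi N W d a2))"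
      by auto
    have "k = l'" using l'[OF W(2)] .
    then obtain d where d: "ein N d D" "Psi N W d (prd N n b)" using W(3) n by blast
    have "Psi N v d (prd N n b)" by (rule N.Psi_mono[OF d(2)]) (rule N.lvl_tran[OF v W(1)])
    moreover have "ein M d D" using S_elem_agree[OF D(1)] d(1) by blast
    then have "ein M d C" "d \<in> univ S" using D(2) M.S_trans[OF _ D(1)] by blast+
    then have "ein N d C'" using C(2) by blast
    ultimately show False using C'(2) by blast
  qed
  obtain w where w: "lvl M w" "\<forall>s \<in> univ S. ein M s w" using M.S_bounded by blast
  obtain q0 where q0: "lvl M q0" "ein M l q0" using M.in_lvl_exists[OF l(2)] by blast
  obtain q1 where q1: "lvl M q1" "ein M w q1" using M.in_lvl_exists[OF M.lvl_in[OF w(1)]] by blast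
  obtain q2 where q2: "lvl M q2" "ein M l q2" "ein M w q2"
    using M.lvl_linear[OF q0(1) q1(1)] q0 q1 M.lvl_tran[OF q0(1)] M.lvl_tran[OF q1(1)] by metis
  obtain q where q: "lvl M q" "\<forall>x y. ein M x q2 \<longrightarrow> ein M y q2 \<longrightarrow> ein M (prd M x y) q"
    using M.pair_lvl[OF q2(1)] by blast
  \<comment> \<open>Truth of codes for all \<open>m \<in> l\<close> at once is separated as a set \<open>G\<close> of pairs, so that the set \<open>X\<close> below
  becomes definable by a bounded formula.\<close>
  have "D0 (\<lambda>M e. \<exists>d. uin M d (e 1) \<and> (\<exists>m. uin M m (e 1) \<and> e 1 = prd M d m \<and>
      (\<exists>a2. ein M a2 (e 0) \<and> a2 = prd M m (e 2) \<and> Psi M (e 0) d a2)))"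
    by (intro D0_intros)
  from M.Sigma1_separation[OF this, of "\<lambda>_. a" q] a M.lvl_in[OF q(1)] obtain G where
    G: "G \<in> univ M" "\<forall>g. ein M g G \<longleftrightarrow> ein M g q \<and> (\<exists>V \<in> univ M. \<exists>d. uin M d g \<and> (\<exists>m. uin M m g \<and>
      g = prd M d m \<and> (\<exists>a2. ein M a2 V \<and> a2 = prd M m a \<and> Psi M V d a2)))" by auto
  have G2: "ein M (prd M d m) G \<longleftrightarrow> (\<exists>V \<in> univ M. Psi M V d (prd M m a))"
    if dm: "ein M d w" "ein M m l" for d m
  proof
    have U: "d \<in> univ M" "m \<in> univ M" using dm by auto
    { assume "ein M (prd M d m) G"
      then obtain V d' m' where *: "V \<in> univ M" "uin M d' (prd M d m)" "uin M m' (prd M d m)"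
        "prd M d m = prd M d' m'" "Psi M V d' (prd M m' a)" using G(2) by blast
      have "d' \<in> univ M" "m' \<in> univ M" using *(2,3) unfolding uin_def by auto
      then have "d' = d" "m' = m" using M.prd_inj[OF *(4) U] by auto
      then show "\<exists>V \<in> univ M. Psi M V d (prd M m a)" using * by blast }
    { assume "\<exists>V \<in> univ M. Psi M V d (prd M m a)"
      then obtain V where V: "V \<in> univ M" "Psi M V d (prd M m a)" by blast
      have a2: "prd M m a \<in> univ M" using U a by simp
      obtain V' where V': "V' \<in> univ M" "\<forall>z. ein M z V' \<longleftrightarrow> z = prd M m a \<or> ein M z V"
        using M.insert_exists[OF a2 V(1)] by metis
      have P: "Psi M V' d (prd M m a)" by (rule M.Psi_mono[OF V(2)]) (use V' in simp)
      have i: "ein M (prd M m a) V'" using V'(2) by simp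
      have "ein M d q2" "ein M m q2"
        using M.lvl_tran[OF q2(1) q2(2)] M.lvl_tran[OF q2(1) q2(3)] dm by blast+
      then have "ein M (prd M d m) q" using q(2) by blast
      moreover have "\<exists>V \<in> univ M. \<exists>d'. uin M d' (prd M d m) \<and> (\<exists>m'. uin M m' (prd M d m) \<and>
        prd M d m = prd M d' m' \<and> (\<exists>a2. ein M a2 V \<and> a2 = prd M m' a \<and> Psi M V d' a2))"
        using V'(1) P i M.uin_prd[OF U] by blast
      ultimately show "ein M (prd M d m) G" using G(2) by blast }
  qed
  have "D0 (\<lambda>M e. \<exists>m. ein M m (e 1) \<and> (\<forall>d. ein M d (e 0) \<longrightarrow> ein M d (e 2) \<longrightarrow>
      \<not> (\<exists>g. ein M g (e 3) \<and> g = prd M d m)))" by (intro D0_intros)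
  from M.separation[OF this, of "l ## C ## (\<lambda>_. G)" w] C(1) G(1) l(2) M.lvl_in[OF w(1)] obtain X where
    X: "X \<in> univ M" "\<forall>u. ein M u X \<longleftrightarrow> ein M u w \<and> (\<exists>m. ein M m l \<and>
      (\<forall>d. ein M d u \<longrightarrow> ein M d C \<longrightarrow> \<not> ein M (prd M d m) G))" by (auto simp: range_push)
  have "ein M u X" if u: "u \<in> univ S" for u
  proof -
    obtain m where m: "ein M m l"
      "\<forall>d. ein M d u \<longrightarrow> ein M d C \<longrightarrow> \<not> (\<exists>v' \<in> univ M. Psi M v' d (prd M m a))" using key[OF u] by blast
    have "ein M d w" if "ein M d u" for d using M.S_trans[OF that u] w(2) by blast
    then have "\<forall>d. ein M d u \<longrightarrow> ein M d C \<longrightarrow> \<not> ein M (prd M d m) G" using m G2 by blast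
    then show ?thesis using X(2) w(2) u m(1) by blast
  qed
  then obtain u where u: "lvl M u" "u \<notin> univ S" "ein M u X" using M.overspill[OF X(1)] by blast
  then obtain m where m: "ein M m l" "\<forall>d. ein M d u \<longrightarrow> ein M d C \<longrightarrow> \<not> ein M (prd M d m) G"
    using X(2) by blast
  have a2: "prd M m a \<in> univ M" using m(1) a by auto
  have "tr (prd M m a) (prd N n b) v"
  proof (rule tr_of_codes[OF a2 b2 lvl_trN[OF v]])
    show "\<And>z. ein N z v \<Longrightarrow> ein N z v" .
    fix d v' assume d: "d \<in> univ S" "v' \<in> univ M" "Psi M v' d (prd M m a)"
    then have "ein M (prd M d m) G" using G2 w(2) m(1) by blast
    then have "\<not> ein M d C" using m(2) M.S_below[OF u(1,2) d(1)] by blast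
    then show "Psi N v d (prd N n b)" using C(2) C'(2) w'(2) d(1) by blast
  qed
  then show ?thesis using m(1) by blast
qed

end

lemma rank_initial_absolute:
  assumes "kpp N" and ri: "rank_initial M N i" and p: "p \<in> Delta0P" "range e \<subseteq> univ M"
  shows "sat M e p \<longleftrightarrow> sat N (\<lambda>n. i (e n)) p"
proof -
  interpret N: kpp N by fact
  have emb: "embedding M N i" using ri unfolding rank_initial_def by blast
  have iU: "i m \<in> univ N" if "m \<in> univ M" for m using emb that unfolding embedding_def by blast
  have down: "n \<in> i ` univ M" if "n \<in> univ N" "m \<in> univ M" "sbs N (N.lv n) (N.lv (i m))" for n m
    using ri N.rank_le_iff[of n "i m"] that iU unfolding rank_initial_def by blast
  show ?thesis
  proof (rule Delta0P_absolute[OF emb _ _ p])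
    show "n \<in> i ` univ M" if h: "n \<in> univ N" "m \<in> univ M" "mem N n (i m)" for n m
    proof -
      have "ein N n (i m)" using h iU unfolding ein_def by blast
      then have "ein N (N.lv n) (N.lv (i m))" by (rule N.lv_elem)
      then show ?thesis using down[OF h(1,2)] N.lvl_mono[OF N.lvl_lv] iU h(2) by blast
    qed
    show "n \<in> i ` univ M" if h: "n \<in> univ N" "m \<in> univ M" "\<forall>z\<in>univ N. mem N z n \<longrightarrow> mem N z (i m)" for n m
    proof -
      have "sbs N n (i m)" using h iU unfolding sbs_def ein_def by blast
      then show ?thesis using down[OF h(1,2)] N.lv_mono by blast
    qed
  qed
qed

section \<open>The limit of a chain of partial embeddings\<close>

context cut_pair
begin

lemma tr_comp:
  assumes t: "tr (tup M xs) (tup N ys) v" and xs: "set xs \<subseteq> univ M" and ys: "set ys \<subseteq> univ N"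
    and len: "length xs = length ys" and i: "i < length xs" and j: "j < length xs"
    and s: "s \<in> univ S" and Q: "D0 (\<lambda>M e. Q M (e 0) (e 1) (e 2))"
  shows "Q M s (xs ! i) (xs ! j) \<longleftrightarrow> Q N s (ys ! i) (ys ! j)"
proof -
  have "D0 (\<lambda>M e. Q M (e (Suc (Suc 0))) (e (Suc 0)) (e 0))"
    using D0_ren[OF Q, of "\<lambda>n. 2 - n"] by (simp add: numeral_2_eq_2)
  then have "D0 (\<lambda>M e. \<exists>l. Comp i M l (e 1) \<and> (\<exists>k. Comp j M k (e 1) \<and> Q M (e 0) l k))"
    by (intro D0_ex_Comp)
  from tr_iff[OF t this s M.tup_in[OF xs] N.tup_in[OF ys]] show ?thesis
    using i j len by (simp add: M.Comp_tup[OF xs] N.Comp_tup[OF ys])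
qed

text \<open>The entry itself is the witness to be found in \<open>v\<close>.\<close>

lemma tr_bounded:
  assumes t: "tr (tup M xs) (tup N ys) v" and xs: "set xs \<subseteq> univ M" and ys: "set ys \<subseteq> univ N"
    and len: "length xs = length ys" and i: "i < length xs"
  shows "ein N (ys ! i) v"
proof -
  have R: "D0 (\<lambda>(M :: 'a eps_struct) e. Comp i M (e 0) (e 2))" by (intro D0_intros)
  have "xs ! i \<in> univ M" using i xs by auto
  from tr_D0[OF t R M.S_emp M.tup_in[OF xs] N.tup_in[OF ys] this] show ?thesis
    using i len by (simp add: M.Comp_tup[OF xs] N.Comp_tup[OF ys])
qed

type_synonym 'b state = "'b list \<times> 'b list \<times> 'b"

fun state :: "'a state \<Rightarrow> bool" where
  "state (xs, ys, v) \<longleftrightarrow> set xs \<subseteq> univ M \<and> set ys \<subseteq> univ N \<and> length xs = length ys \<and>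
     lvl N v \<and> tr (tup M xs) (tup N ys) v"

fun ext :: "'a state \<Rightarrow> 'a state \<Rightarrow> bool" where
  "ext (xs, ys, v) (xs', ys', v') \<longleftrightarrow> set (zip xs ys) \<subseteq> set (zip xs' ys') \<and> sbs N v' v"

text \<open>The second condition makes the image of the limit transitive, the third makes it topless.\<close>

fun met :: "'a \<Rightarrow> 'a \<Rightarrow> 'a state \<Rightarrow> bool" where
  "met m n (xs, ys, v) \<longleftrightarrow> m \<in> set xs \<and>
     (\<forall>k < length xs. xs ! k = m \<longrightarrow> ein N n (ys ! k) \<longrightarrow> n \<in> set ys) \<and>
     (lvl N n \<longrightarrow> tr (tup M xs) (tup N ys) n \<longrightarrow> ein N v n)"

lemma state_dense:
  assumes st: "state z" and m: "m \<in> univ M"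
  shows "\<exists>z'. state z' \<and> ext z z' \<and> met m n z'"
proof -
  obtain xs ys v where z: "z = (xs, ys, v)" by (cases z) auto
  have s: "set xs \<subseteq> univ M" "set ys \<subseteq> univ N" "length xs = length ys" "lvl N v"
    "tr (tup M xs) (tup N ys) v" using st unfolding z by auto
  obtain y where y: "ein N y v" "tr (prd M m (tup M xs)) (prd N y (tup N ys)) v"
    using tr_forth[OF s(5,4) M.tup_in[OF s(1)] N.tup_in[OF s(2)] m] by blast
  define xs1 ys1 where "xs1 = m # xs" and "ys1 = y # ys"
  have s1: "set xs1 \<subseteq> univ M" "set ys1 \<subseteq> univ N" "length xs1 = length ys1"
    "tr (tup M xs1) (tup N ys1) v" and m1: "m \<in> set xs1" and z1: "set (zip xs ys) \<subseteq> set (zip xs1 ys1)"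
    using s y m unfolding xs1_def ys1_def by auto
  obtain xs2 ys2 where s2: "set xs2 \<subseteq> univ M" "set ys2 \<subseteq> univ N" "length xs2 = length ys2"
    "tr (tup M xs2) (tup N ys2) v" and m2: "m \<in> set xs2" and z2: "set (zip xs ys) \<subseteq> set (zip xs2 ys2)"
    and b2: "\<forall>k < length xs2. xs2 ! k = m \<longrightarrow> ein N n (ys2 ! k) \<longrightarrow> n \<in> set ys2"
  proof (cases "\<exists>k < length xs1. xs1 ! k = m \<and> ein N n (ys1 ! k)")
    case False
    then show thesis using that[of xs1 ys1] s1 m1 z1 by blast
  next
    case True
    then obtain k where k: "k < length xs1" "xs1 ! k = m" "ein N n (ys1 ! k)" by blast
    have "Comp k M (xs1 ! k) (tup M xs1)" using M.Comp_tup[OF s1(1)] k by blast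
    moreover have "xs1 ! k \<in> univ M" using s1 k by auto
    moreover have "\<And>l. Comp k N l (tup N ys1) \<Longrightarrow> l = ys1 ! k" using N.Comp_tup[OF s1(2)] by blast
    ultimately obtain x where x: "ein M x (xs1 ! k)" "tr (prd M x (tup M xs1)) (prd N n (tup N ys1)) v"
      using tr_back[OF s1(4) s(4) M.tup_in[OF s1(1)] N.tup_in[OF s1(2)] _ _ _ k(3)] by blast
    show thesis
    proof (rule that[of "x # xs1" "n # ys1"])
      show "set (x # xs1) \<subseteq> univ M" "set (n # ys1) \<subseteq> univ N" using x(1) k(3) s1 by auto
      show "length (x # xs1) = length (n # ys1)" using s1 by simp
      show "tr (tup M (x # xs1)) (tup N (n # ys1)) v" using x(2) by simp
      show "m \<in> set (x # xs1)" using m1 by simp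
      show "set (zip xs ys) \<subseteq> set (zip (x # xs1) (n # ys1))" using z1 by auto
    qed simp
  qed
  show ?thesis
  proof (cases "lvl N n \<and> tr (tup M xs2) (tup N ys2) n \<and> \<not> ein N v n")
    case False
    have "sbs N v v" using N.sbs_refl N.lvl_in s(4) by blast
    then show ?thesis using False s2 m2 z2 b2 s(4) unfolding z
      by (intro exI[of _ "(xs2, ys2, v)"]) simp
  next
    case True
    then have nv: "sbs N n v"
      using N.lvl_linear[of n v] s(4) N.lvl_mono[of v n] N.sbs_refl N.lvl_in by blast
    obtain v' where v': "ein N v' n" "lvl N v'" "tr (tup M xs2) (tup N ys2) v'"
      using tr_lower[of _ _ n] True M.tup_in[OF s2(1)] N.tup_in[OF s2(2)] by blast
    have "sbs N v' v" using N.sbs_trans[OF N.lvl_mono nv] True v'(1) by blast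
    then show ?thesis using v' s2 m2 z2 b2 unfolding z
      by (intro exI[of _ "(xs2, ys2, v')"]) simp
  qed
qed

text \<open>A chain of states meeting the countably many requirements one after the other has a total limit, whose
  image is transitive. Levels are preserved, and each element lies in a level; so the image is also
  closed under subsets and under smaller ranks.\<close>

lemma embedding_exists:
  assumes cM: "countable (univ M)" and cN: "countable (univ N)"
    and Th: "\<And>p s. p \<in> Delta0P \<Longrightarrow> s \<in> univ S \<Longrightarrow>
      \<exists>x \<in> univ M. sat M (x ## s ## (\<lambda>_. emp M)) p \<Longrightarrow>
      \<exists>x \<in> univ N. sat N (x ## s ## (\<lambda>_. emp N)) p"
  shows "\<exists>i. topless M N i \<and> rank_initial M N i \<and> (\<forall>x \<in> univ S. i x = x)"
proof -
  obtain v0 where v0: "lvl N v0" "tr (emp M) (emp N) v0" using tr_init[OF Th] by blast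
  define req where "req = from_nat_into (univ M \<times> univ N)"
  have cnt: "countable (univ M \<times> univ N)" using cM cN by simp
  have ne: "univ M \<times> univ N \<noteq> {}" using M.emp_in N.emp_in by blast
  have req_in: "fst (req k) \<in> univ M" for k
    using from_nat_into[OF ne, of k] unfolding req_def by auto
  have req_onto: "\<exists>k. req k = (m, n)" if "m \<in> univ M" "n \<in> univ N" for m n
    using from_nat_into_surj[OF cnt, of "(m, n)"] that unfolding req_def by blast
  have "\<exists>f. \<forall>k. state (f k) \<and> (ext (f k) (f (Suc k)) \<and> met (fst (req k)) (snd (req k)) (f (Suc k)))"
  proof (rule dependent_nat_choice)
    show "\<exists>z. state z" by (rule exI[of _ "([], [], v0)"]) (use v0 in simp)
    show "\<exists>y. state y \<and> ext z y \<and> met (fst (req k)) (snd (req k)) y" if "state z" for z k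
      using state_dense[OF that req_in] .
  qed
  then obtain f where f: "\<And>k. state (f k)" "\<And>k. ext (f k) (f (Suc k))"
    "\<And>k. met (fst (req k)) (snd (req k)) (f (Suc k))" by blast
  define xs where "xs k = fst (f k)" for k
  define ys where "ys k = fst (snd (f k))" for k
  define v where "v k = snd (snd (f k))" for k
  have fk: "f k = (xs k, ys k, v k)" for k unfolding xs_def ys_def v_def by simp
  have st: "set (xs k) \<subseteq> univ M" "set (ys k) \<subseteq> univ N" "length (xs k) = length (ys k)"
    "lvl N (v k)" "tr (tup M (xs k)) (tup N (ys k)) (v k)" for k
    using f(1)[of k] unfolding fk by auto
  have mono: "set (zip (xs k) (ys k)) \<subseteq> set (zip (xs l) (ys l)) \<and> sbs N (v l) (v k)" if "k \<le> l" for k l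
    using that
  proof (induction l rule: dec_induct)
    case base
    show ?case using N.sbs_refl[OF N.lvl_in[OF st(4)]] by blast
  next
    case (step l)
    have "set (zip (xs l) (ys l)) \<subseteq> set (zip (xs (Suc l)) (ys (Suc l)))" "sbs N (v (Suc l)) (v l)"
      using f(2)[of l] unfolding fk by auto
    then show ?case using step.IH N.sbs_trans by blast
  qed
  define G where "G = (\<Union>k. set (zip (xs k) (ys k)))"
  have GU: "m \<in> univ M" "y \<in> univ N" if "(m, y) \<in> G" for m y
  proof -
    obtain k where "(m, y) \<in> set (zip (xs k) (ys k))" using \<open>(m, y) \<in> G\<close> unfolding G_def by blast
    then show "m \<in> univ M" "y \<in> univ N" using st(1,2)[of k] set_zip_leftD set_zip_rightD by fast+
  qed
  have Q: "Q M s m m' \<longleftrightarrow> Q N s y y'"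
    if g: "(m, y) \<in> G" "(m', y') \<in> G" and s: "s \<in> univ S"
      and Q: "D0 (\<lambda>M e. Q M (e 0) (e 1) (e 2))" for Q m m' y y' s
  proof -
    obtain k1 k2 where "(m, y) \<in> set (zip (xs k1) (ys k1))" "(m', y') \<in> set (zip (xs k2) (ys k2))"
      using g unfolding G_def by blast
    then have "(m, y) \<in> set (zip (xs (max k1 k2)) (ys (max k1 k2)))"
      "(m', y') \<in> set (zip (xs (max k1 k2)) (ys (max k1 k2)))"
      using mono[of k1 "max k1 k2"] mono[of k2 "max k1 k2"] by auto
    then obtain i j where ij: "i < length (xs (max k1 k2))" "j < length (xs (max k1 k2))"
      "m = xs (max k1 k2) ! i" "y = ys (max k1 k2) ! i" "m' = xs (max k1 k2) ! j" "y' = ys (max k1 k2) ! j"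
      unfolding set_zip by auto
    show ?thesis
      unfolding ij(3-6) by (rule tr_comp[OF st(5,1,2,3) ij(1,2) s Q])
  qed
  have Geq: "m = m' \<longleftrightarrow> y = y'" if "(m, y) \<in> G" "(m', y') \<in> G" for m m' y y'
    by (rule Q[OF that M.S_emp, of "\<lambda>M s x y. x = y"]) (intro D0_intros)
  have Gmem: "ein M m m' \<longleftrightarrow> ein N y y'" if "(m, y) \<in> G" "(m', y') \<in> G" for m m' y y'
    by (rule Q[OF that M.S_emp, of "\<lambda>M s x y. ein M x y"]) (intro D0_intros)
  have Glvl: "lvl M m \<longleftrightarrow> lvl N y" if "(m, y) \<in> G" for m y
    by (rule Q[OF that that M.S_emp, of "\<lambda>M s x y. lvl M x"]) (intro D0_intros)
  have GS: "s = m \<longleftrightarrow> s = y" if "(m, y) \<in> G" "s \<in> univ S" for m y s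
    by (rule Q[OF that(1,1,2), of "\<lambda>M s x y. s = x"]) (intro D0_intros)
  have total: "\<exists>y. (m, y) \<in> G" if m: "m \<in> univ M" for m
  proof -
    obtain k where "req k = (m, emp N)" using req_onto[OF m N.emp_in] by blast
    then have "m \<in> set (xs (Suc k))" using f(3)[of k] unfolding fk by simp
    then obtain j where "j < length (xs (Suc k))" "m = xs (Suc k) ! j" by (auto simp: in_set_conv_nth)
    then have "(m, ys (Suc k) ! j) \<in> set (zip (xs (Suc k)) (ys (Suc k)))"
      using st(3)[of "Suc k"] unfolding set_zip by auto
    then show ?thesis unfolding G_def by blast
  qed
  define i where "i m = (SOME y. (m, y) \<in> G)" for m
  have iG: "(m, i m) \<in> G" if "m \<in> univ M" for m
    unfolding i_def using someI_ex[OF total[OF that]] .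
  have Gi: "y = i m" if "(m, y) \<in> G" for m y
    using Geq[OF that iG[OF GU(1)[OF that]]] by blast
  have imem: "ein M x y \<longleftrightarrow> ein N (i x) (i y)" if "x \<in> univ M" "y \<in> univ M" for x y
    using Gmem[OF iG iG, OF that] .
  have iU: "i x \<in> univ N" if "x \<in> univ M" for x using GU(2)[OF iG[OF that]] .
  have emb: "embedding M N i"
    unfolding embedding_def
  proof (intro conjI ballI)
    show "i ` univ M \<subseteq> univ N" using iU by blast
    show "inj_on i (univ M)" using Geq[OF iG iG] unfolding inj_on_def by blast
    show "mem M x y \<longleftrightarrow> mem N (i x) (i y)" if "x \<in> univ M" "y \<in> univ M" for x y
      using imem[OF that] that iU unfolding ein_def by blast
  qed
  have fixS: "i s = s" if "s \<in> univ S" for s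
    using GS[OF iG[OF M.SU[OF that]] that] by simp
  have bounded: "ein N (i m) (v k)" if m: "m \<in> univ M" for m k
  proof -
    obtain l where "(m, i m) \<in> set (zip (xs l) (ys l))" using iG[OF m] unfolding G_def by blast
    then have "(m, i m) \<in> set (zip (xs (max k l)) (ys (max k l)))" using mono[of l "max k l"] by auto
    then obtain j where "j < length (xs (max k l))" "i m = ys (max k l) ! j" unfolding set_zip by auto
    then have "ein N (i m) (v (max k l))" using tr_bounded[OF st(5,1,2,3)] by simp
    then show ?thesis using mono[of k "max k l"] N.sbsD by auto
  qed
  have i_tr: "n \<in> i ` univ M" if m: "m \<in> univ M" and n: "ein N n (i m)" for m n
  proof -
    have "n \<in> univ N" using n by auto
    then obtain k where k: "req k = (m, n)" using req_onto m by blast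
    have met: "m \<in> set (xs (Suc k))"
      "\<forall>j < length (xs (Suc k)). xs (Suc k) ! j = m \<longrightarrow> ein N n (ys (Suc k) ! j) \<longrightarrow> n \<in> set (ys (Suc k))"
      using f(3)[of k] unfolding fk k by auto
    obtain j where j: "j < length (xs (Suc k))" "xs (Suc k) ! j = m"
      using met(1) by (auto simp: in_set_conv_nth)
    have inG: "(xs (Suc k) ! j, ys (Suc k) ! j) \<in> G" if "j < length (xs (Suc k))" for j
    proof -
      have "(xs (Suc k) ! j, ys (Suc k) ! j) \<in> set (zip (xs (Suc k)) (ys (Suc k)))"
        using that st(3)[of "Suc k"] unfolding set_zip by auto
      then show ?thesis unfolding G_def by blast
    qed
    have "ys (Suc k) ! j = i m" using Gi[OF inG[OF j(1)]] j(2) by simp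
    then have "n \<in> set (ys (Suc k))" using met(2) j n by auto
    then obtain j' where j': "j' < length (ys (Suc k))" "ys (Suc k) ! j' = n"
      by (auto simp: in_set_conv_nth)
    then have "(xs (Suc k) ! j', n) \<in> G" using inG[of j'] st(3)[of "Suc k"] by auto
    then show ?thesis using Gi GU(1) by blast
  qed
  have i_lvl: "\<exists>l \<in> univ M. lvl N (i l) \<and> ein N (i m) (i l)" if m: "m \<in> univ M" for m
  proof -
    obtain l where l: "lvl M l" "ein M m l" using M.in_lvl_exists[OF m] by blast
    have lM: "l \<in> univ M" using M.lvl_in[OF l(1)] .
    have "lvl N (i l)" using Glvl[OF iG[OF lM]] l(1) by blast
    moreover have "ein N (i m) (i l)" using imem[OF m lM] l(2) by blast
    ultimately show ?thesis using lM by blast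
  qed
  have i_down: "n \<in> i ` univ M" if m: "m \<in> univ M" and n: "n \<in> univ N" "sbs N (N.lv n) (N.lv (i m))" for m n
  proof -
    obtain l where l: "l \<in> univ M" "lvl N (i l)" "ein N (i m) (i l)" using i_lvl[OF m] by blast
    have "ein N (N.lv (i m)) (i l)" using N.in_lvl_iff[OF l(2) iU[OF m]] l(3) by blast
    moreover have "sbs N n (N.lv (i m))" using N.sbs_trans[OF N.sbs_lv[OF n(1)] n(2)] .
    ultimately have "ein N n (i l)" using N.lvl_stran[OF l(2)] by blast
    then show ?thesis using i_tr[OF l(1)] by blast
  qed
  have i_st: "n \<in> i ` univ M" if m: "m \<in> univ M" and n: "sbs N n (i m)" for m n
    using i_down[OF m _ N.lv_mono[OF n]] n by blast
  have ri: "rank_initial M N i"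
    unfolding rank_initial_def
  proof (intro conjI ballI impI emb)
    fix n assume n: "n \<in> univ N" and "\<exists>m \<in> univ M. ord_le N (rank N n) (rank N (i m))"
    then obtain m where m: "m \<in> univ M" "ord_le N (rank N n) (rank N (i m))" by blast
    then have "sbs N (N.lv n) (N.lv (i m))" using N.rank_le_iff[OF n iU] by blast
    then show "n \<in> i ` univ M" using i_down[OF m(1) n] by blast
  qed
  note abs = rank_initial_absolute[OF N.kpp_axioms ri]
  \<comment> \<open>The image is not a level: otherwise \<open>l\<close> is a possible bound at each stage, since by absoluteness
  all witnesses have images, and these are in \<open>l\<close>. So the bound was put below \<open>l\<close> when \<open>l\<close> was treated,
  and is then itself in the image, but images are elements of all bounds.\<close>
  have no_lvl: False if l: "lvl N l" and eq: "\<And>x. ein N x l \<longleftrightarrow> x \<in> i ` univ M" for l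
  proof -
    have lN: "l \<in> univ N" using N.lvl_in[OF l] .
    obtain k where k: "req k = (emp M, l)" using req_onto[OF M.emp_in lN] by blast
    let ?x = "xs (Suc k)" and ?y = "ys (Suc k)"
    have met: "tr (tup M ?x) (tup N ?y) l \<Longrightarrow> ein N (v (Suc k)) l"
      using f(3)[of k] l unfolding fk k by simp
    have iprd: "i (prd M x y) = prd N (i x) (i y)" if xy: "x \<in> univ M" "y \<in> univ M" for x y
    proof -
      have "D0 (\<lambda>(M :: 'a eps_struct) e. e 0 = prd M (e 1) (e 2))" by (intro D0_intros)
      then obtain p where p: "p \<in> Delta0P" "\<And>(M :: 'a eps_struct) e. kpp M \<Longrightarrow> range e \<subseteq> univ M \<Longrightarrow>
        sat M e p = (e 0 = prd M (e 1) (e 2))" unfolding D0_def by blast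
      let ?e = "prd M x y ## x ## (\<lambda>_. y)"
      have e: "range ?e \<subseteq> univ M" using xy M.prd_in[OF xy] by (auto simp: range_push)
      have e': "range (\<lambda>n. i (?e n)) \<subseteq> univ N" using e iU by blast
      have "sat M ?e p" using p(2)[OF M.kpp_axioms e] by simp
      then have "sat N (\<lambda>n. i (?e n)) p" using abs[OF p(1) e] by simp
      then show ?thesis using p(2)[OF N.kpp_axioms e'] by simp
    qed
    have iemp: "i (emp M) = emp N" using fixS[OF M.S_emp] emp_agree by simp
    have itup: "i (tup M zs) = tup N (map i zs)" if "set zs \<subseteq> univ M" for zs
      using that by (induction zs) (simp_all add: iemp iprd M.tup_in)
    have "map i ?x = ?y"
    proof (rule nth_equalityI)
      show "length (map i ?x) = length ?y" using st(3) by simp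
      fix j assume "j < length (map i ?x)"
      then have "(?x ! j, ?y ! j) \<in> set (zip ?x ?y)"
        using st(3)[of "Suc k"] unfolding set_zip by auto
      then have "(?x ! j, ?y ! j) \<in> G" unfolding G_def by blast
      then show "map i ?x ! j = ?y ! j" using Gi \<open>j < length (map i ?x)\<close> by simp
    qed
    then have ityp: "i (tup M ?x) = tup N ?y" using itup[OF st(1)] by simp
    have "tr (tup M ?x) (tup N ?y) l"
      unfolding tr_def
    proof (intro ballI impI)
      fix p s assume p: "p \<in> Delta0P" and s: "s \<in> univ S"
        and "\<exists>x\<in>univ M. sat M (x ## s ## tup M ?x ## (\<lambda>_. emp M)) p"
      then obtain x where x: "x \<in> univ M" "sat M (x ## s ## tup M ?x ## (\<lambda>_. emp M)) p" by blast
      let ?e = "x ## s ## tup M ?x ## (\<lambda>_. emp M)"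
      have e: "range ?e \<subseteq> univ M"
        using x(1) M.SU[OF s] M.tup_in[OF st(1)] M.const_env[OF M.emp_in] unfolding range_push by blast
      have "(\<lambda>n. i (?e n)) = i x ## s ## tup N ?y ## (\<lambda>_. emp N)"
        using fixS[OF s] ityp iemp by (intro ext) (simp split: nat.splits)
      then have "sat N (i x ## s ## tup N ?y ## (\<lambda>_. emp N)) p" using abs[OF p e] x(2) by simp
      moreover have "ein N (i x) l" using eq x(1) by blast
      ultimately show "\<exists>x. ein N x l \<and> sat N (x ## s ## tup N ?y ## (\<lambda>_. emp N)) p" by blast
    qed
    then have "v (Suc k) \<in> i ` univ M" using met eq by blast
    then obtain m where "m \<in> univ M" "v (Suc k) = i m" by blast
    then show False using bounded[of m "Suc k"] N.no_self by metis
  qed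
  have "topless M N i"
    unfolding topless_def
  proof (intro conjI emb)
    have vN: "v 0 \<in> univ N" using N.lvl_in[OF st(4)] .
    have "mem N (rank N (i m)) (N.rk (v 0))" if m: "m \<in> univ M" for m
      using N.rk_less[OF iU[OF m] vN N.lv_elem[OF bounded[OF m]]] N.rank_eq[OF iU[OF m]]
      unfolding ein_def by simp
    then show "\<exists>a\<in>Ord N. \<forall>m\<in>univ M. mem N (rank N (i m)) a"
      using N.rk_ord[OF vN] unfolding Ord_def by blast
    show "\<not> (\<exists>a\<in>Ord N - i ` univ M. \<forall>b\<in>Ord N - i ` univ M. ord_le N a b)"
    proof
      assume "\<exists>a\<in>Ord N - i ` univ M. \<forall>b\<in>Ord N - i ` univ M. ord_le N a b"
      then obtain a where a: "is_ord N a" "a \<notin> i ` univ M"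
        "\<And>b. is_ord N b \<Longrightarrow> b \<notin> i ` univ M \<Longrightarrow> ord_le N a b"
        unfolding Ord_def by blast
      have "\<exists>l. lvl N l \<and> (\<forall>x. ein N x l \<longleftrightarrow> x \<in> i ` univ M)"
      proof (rule N.least_ordinal_level[OF _ _ _ a])
        show "\<And>x y. ein N x y \<Longrightarrow> y \<in> i ` univ M \<Longrightarrow> x \<in> i ` univ M" using i_tr by blast
        show "\<And>x y. sbs N x y \<Longrightarrow> y \<in> i ` univ M \<Longrightarrow> x \<in> i ` univ M" using i_st by blast
        show "\<And>y. y \<in> i ` univ M \<Longrightarrow> \<exists>l\<in>i ` univ M. lvl N l \<and> ein N y l" using i_lvl by blast
      qed
      then show False using no_lvl by blast
    qed
  qed
  then show ?thesis using ri fixS by blast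
qed

end

section \<open>What a rank-initial embedding preserves\<close>

text \<open>The trace of \<open>c \<in> M\<close> is that of \<open>i c\<close>. For \<open>c' \<in> N\<close> choose a level \<open>w\<close> of \<open>M\<close> including \<open>S\<close>; then
  the intersection of \<open>c'\<close> with \<open>i w\<close> has the same trace and is in the image, by its rank.\<close>

lemma rank_initial_SSy:
  assumes M: "cut M S" and N: "cut N S" and ri: "rank_initial M N i" and fixS: "\<forall>x \<in> univ S. i x = x"
  shows "SSy S M = SSy S N"
proof -
  interpret M: cut M S by fact
  interpret N: cut N S by fact
  have emb: "embedding M N i" using ri unfolding rank_initial_def by blast
  have iU: "i m \<in> univ N" if "m \<in> univ M" for m using emb that unfolding embedding_def by blast
  have im: "mem M x y \<longleftrightarrow> mem N (i x) (i y)" if "x \<in> univ M" "y \<in> univ M" for x y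
    using emb that unfolding embedding_def by blast
  have 1: "{x \<in> univ S. mem M x c} = {x \<in> univ S. mem N x (i c)}" if c: "c \<in> univ M" for c
  proof -
    have "mem M x c \<longleftrightarrow> mem N x (i c)" if x: "x \<in> univ S" for x
      using im[OF M.SU[OF x] c] fixS x by simp
    then show ?thesis by blast
  qed
  have 2: "\<exists>c \<in> univ M. {x \<in> univ S. mem N x c'} = {x \<in> univ S. mem M x c}" if c': "c' \<in> univ N" for c'
  proof -
    obtain w where w: "lvl M w" "\<forall>s \<in> univ S. ein M s w" using M.S_bounded by blast
    have wM: "w \<in> univ M" using M.lvl_in[OF w(1)] .
    have "D0 (\<lambda>M e. ein M (e 0) (e 1))" by (intro D0_intros)
    from N.separation[OF this, of "\<lambda>_. c'" "i w"] c' iU[OF wM] obtain d where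
      d: "d \<in> univ N" "\<forall>x. ein N x d \<longleftrightarrow> ein N x (i w) \<and> ein N x c'" by auto
    have "sbs N d (i w)" using d iU[OF wM] unfolding sbs_def by blast
    then have "ord_le N (rank N d) (rank N (i w))"
      using N.rank_le_iff[OF d(1) iU[OF wM]] N.lv_mono by blast
    then obtain c where c: "c \<in> univ M" "d = i c" using ri d(1) wM unfolding rank_initial_def by blast
    have "mem N x c' \<longleftrightarrow> mem N x d" if x: "x \<in> univ S" for x
    proof -
      have "mem N x (i w)" using im[OF M.SU[OF x] wM] w(2) x fixS unfolding ein_def by simp
      then show ?thesis using d N.SU[OF x] c' iU[OF wM] unfolding ein_def by blast
    qed
    then have "{x \<in> univ S. mem N x c'} = {x \<in> univ S. mem N x (i c)}" using c(2) by blast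
    then show ?thesis using 1[OF c(1)] c(1) by blast
  qed
  have "{{x \<in> univ S. mem M x c} | c. c \<in> univ M} = {{x \<in> univ S. mem N x c} | c. c \<in> univ N}"
  proof (intro equalityI subsetI)
    fix X assume "X \<in> {{x \<in> univ S. mem M x c} | c. c \<in> univ M}"
    then obtain c where "c \<in> univ M" "X = {x \<in> univ S. mem M x c}" by blast
    then have "i c \<in> univ N" "X = {x \<in> univ S. mem N x (i c)}" using 1 iU by auto
    then show "X \<in> {{x \<in> univ S. mem N x c} | c. c \<in> univ N}" by blast
  next
    fix X assume "X \<in> {{x \<in> univ S. mem N x c} | c. c \<in> univ N}"
    then obtain c where c: "c \<in> univ N" "X = {x \<in> univ S. mem N x c}" by blast
    then show "X \<in> {{x \<in> univ S. mem M x c} | c. c \<in> univ M}" using 2[OF c(1)] by blast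
  qed
  then show ?thesis unfolding SSy_def by simp
qed

text \<open>The values of a list beyond its length are arbitrary and need not be in the universe.\<close>

lemma sat_pad:
  assumes "fv p \<subseteq> {..<length s}"
  shows "sat M (\<lambda>n. s ! n) p \<longleftrightarrow> sat M (\<lambda>n. if n < length s then s ! n else c) p"
  by (rule sat_fv) (use assms in auto)

lemma KPP_Iff_sat:
  assumes "kpp M" and "KPP \<turnstile> Iff p q" and "range e \<subseteq> univ M"
  shows "sat M e p \<longleftrightarrow> sat M e q"
proof -
  have "\<forall>r \<in> KPP. sat M e r" using kpp.axm[OF assms(1)] assms(3) by blast
  then have "sat M e (Iff p q)" using soundness assms(2,3) by blast
  then show ?thesis by simp
qed

lemma rank_initial_Th:
  assumes M: "cut M S" and N: "cut N S" and ri: "rank_initial M N i" and fixS: "\<forall>x \<in> univ S. i x = x"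
  shows "Th Sigma1P S M \<subseteq> Th Sigma1P S N"
proof
  interpret M: cut M S by fact
  interpret N: cut N S by fact
  have emb: "embedding M N i" using ri unfolding rank_initial_def by blast
  fix z assume z: "z \<in> Th Sigma1P S M"
  obtain p s where ps: "z = (p, s)" by (cases z) auto
  then have p: "p \<in> Sigma1P" "set s \<subseteq> univ S" "fv p \<subseteq> {..<length s}" "sat M (\<lambda>n. s ! n) p"
    using z unfolding Th_def by auto
  let ?e = "\<lambda>n. if n < length s then s ! n else emp M"
  have eS: "range ?e \<subseteq> univ S" using p(2) M.S_emp by auto
  then have e: "range ?e \<subseteq> univ M" "range ?e \<subseteq> univ N" using M.SU N.SU by blast+
  obtain q where q: "q \<in> Delta0P" "KPP \<turnstile> Iff p (fm.Ex q)"
    using p(1) unfolding Sigma1P_def SigmaP_def by auto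
  have "sat M ?e p" using p(3,4) sat_pad by fastforce
  then have "sat M ?e (fm.Ex q)" using KPP_Iff_sat[OF M.kpp_axioms q(2) e(1)] by blast
  then obtain x where x: "x \<in> univ M" "sat M (x ## ?e) q" by auto
  have "range (x ## ?e) \<subseteq> univ M" using x(1) e(1) by (simp add: range_push)
  then have "sat N (\<lambda>n. i ((x ## ?e) n)) q"
    using rank_initial_absolute[OF N.kpp_axioms ri q(1)] x(2) by blast
  moreover have "(\<lambda>n. i ((x ## ?e) n)) = i x ## ?e"
  proof
    fix n
    have "i (?e m) = ?e m" for m using eS fixS by blast
    then show "i ((x ## ?e) n) = (i x ## ?e) n" by (cases n) (simp_all del: if_split_asm)
  qed
  moreover have "i x \<in> univ N" using emb x(1) unfolding embedding_def by blast
  ultimately have "sat N ?e (fm.Ex q)" by auto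
  then have "sat N ?e p" using KPP_Iff_sat[OF N.kpp_axioms q(2) e(2)] by blast
  then have "sat N (\<lambda>n. s ! n) p" using p(3) sat_pad by fastforce
  then show "z \<in> Th Sigma1P S N" using p ps unfolding Th_def by auto
qed

text \<open>The sentences in \<open>Th\<close> come with finite tuples; padding the tuple with \<open>\<emptyset>\<close> reaches all variables of
  the formula.\<close>

lemma Th_transfer:
  assumes M: "cut M S" and N: "cut N S" and Th: "Th Sigma1P S M \<subseteq> Th Sigma1P S N"
    and eq: "emp M = emp N"
    and p: "p \<in> Delta0P" and s: "s \<in> univ S" and ex: "\<exists>x \<in> univ M. sat M (x ## s ## (\<lambda>_. emp M)) p"
  shows "\<exists>x \<in> univ N. sat N (x ## s ## (\<lambda>_. emp N)) p"
proof -
  interpret M: cut M S by fact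
  obtain k where k: "\<forall>n \<in> fv (fm.Ex p). n < k" using finite_fv finite_nat_set_iff_bounded by metis
  define L where "L = s # replicate k (emp M)"
  have fv: "fv (fm.Ex p) \<subseteq> {..<length L}" using k unfolding L_def by force
  have eL: "(\<lambda>n. if n < length L then L ! n else emp M) = s ## (\<lambda>_. emp M)"
    unfolding L_def by (rule ext) (auto split: nat.splits)
  have L: "sat K (\<lambda>n. L ! n) (fm.Ex p) \<longleftrightarrow> sat K (s ## (\<lambda>_. emp M)) (fm.Ex p)" for K
    using sat_pad[OF fv, of K "emp M"] unfolding eL .
  have "(fm.Ex p, L) \<in> Th Sigma1P S M"
    using Delta0P_subset_Sigma1P[OF p] fv ex L[of M] s M.S_emp unfolding Th_def by (auto simp: L_def)
  then have "sat N (\<lambda>n. L ! n) (fm.Ex p)" using Th unfolding Th_def by blast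
  then show ?thesis unfolding L eq by simp
qed

theorem corollary5p2p7:
  fixes M N S :: "'a eps_struct"
  assumes "M \<Turnstile> KPP \<union> Separation Sigma1P"
    and "N \<Turnstile> KPP \<union> Separation Sigma1P"
    and "countable (univ M)" and "countable (univ N)"
    and "nonstandard M" and "nonstandard N"
    and "substructure S M" and "rank_initial S M (\<lambda>x. x)" and "topless S M (\<lambda>x. x)"
    and "substructure S N" and "rank_initial S N (\<lambda>x. x)" and "topless S N (\<lambda>x. x)"
  shows "((\<exists>i. rank_initial M N i \<and> (\<forall>x \<in> univ S. i x = x))
           \<longleftrightarrow> (\<exists>i. topless M N i \<and> rank_initial M N i \<and> (\<forall>x \<in> univ S. i x = x)))
       \<and> ((\<exists>i. rank_initial M N i \<and> (\<forall>x \<in> univ S. i x = x))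
           \<longleftrightarrow> SSy S M = SSy S N \<and> Th Sigma1P S M \<subseteq> Th Sigma1P S N)"
proof -
  have M: "cut M S" and N: "cut N S" using assms by unfold_locales auto
  have ab: "SSy S M = SSy S N \<and> Th Sigma1P S M \<subseteq> Th Sigma1P S N"
    if "rank_initial M N i" "\<forall>x \<in> univ S. i x = x" for i
    using rank_initial_SSy[OF M N that] rank_initial_Th[OF M N that] by blast
  have ba: "\<exists>i. topless M N i \<and> rank_initial M N i \<and> (\<forall>x \<in> univ S. i x = x)"
    if b: "SSy S M = SSy S N" "Th Sigma1P S M \<subseteq> Th Sigma1P S N"
  proof -
    interpret cut_pair M N S
      using M N b(1) by (simp add: cut_pair_def cut_pair_axioms_def)
    show ?thesis
      using embedding_exists[OF assms(3,4) Th_transfer[OF M N b(2) emp_agree]] by blast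
  qed
  show ?thesis using ab ba by blast
qed

end
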